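(* Let $\nu,\mu\in\mathbb{C}^\ast$, $x\in\mathbb{C}\setminus((-\infty,-1]\cup[1,\infty))$, $\Re(\mu+\nu)>-3$, $\Re(\mu-\nu)>0$. Then $$\mathsf{P}_\nu^{-\mu}(x)=\frac{2(\nu-\mu)\Gamma(\frac{\mu-\nu+3}{2})\Gamma(\frac{\nu+\mu+2}{2})}{(\nu-\mu-1)\Gamma(\frac{\mu-\nu+2}{2})\Gamma(\frac{\nu+\mu+1}{2})}\int_x^1\mathsf{P}_\nu^{-\mu}(t)\,P_\nu\!\left(\frac{2-x^2-t^2}{2\sqrt{(1-x^2)(1-t^2)}}\right)\frac{dt}{1-t^2}.$$
   Context: $\mathbb{C}^\ast=\mathbb{C}\setminus\{0\}$. Let $\mathbf{F}(a,b;c;z)=\sum_{n\ge0}\frac{(a)_n(b)_n}{\Gamma(c+n)}\frac{z^n}{n!}$ (continued analytically) be the regularized Gauss hypergeometric function. Ferrers function of the first kind: $\mathsf{P}_\nu^{\mu}(x)=\left(\frac{1+x}{1-x}\right)^{\frac12\mu}\mathbf{F}\big(-\nu,\nu+1;1-\mu;\frac{1-x}{2}\big)$ for $x\in\mathbb{C}\setminus((-\infty,-1]\cup[1,\infty))$. Legendre function of the first kind: $P_\nu(z)=\mathbf{F}(-\nu,\nu+1;1;\frac{1-z}{2})$.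
   Formalization: The identity is asserted whenever the integral converges, and convergence is asserted for Re(μ+ν) > -1; for -3 < Re(μ+ν) ≤ -1 the integral generally diverges (e.g. ν=-3/2, μ=1/10). The square root is read as √(1-x²)·√(1-t²) with principal roots. *)

theory Defs
  imports "HOL-Complex_Analysis.Complex_Analysis"
begin

(* rGamma is the entire function 1/Gamma, so the terms with c + n a pole of Gamma vanish. *)
definition reg_hyp2f1_series :: "complex \<Rightarrow> complex \<Rightarrow> complex \<Rightarrow> complex \<Rightarrow> complex" where
  "reg_hyp2f1_series a b c z =
     (\<Sum>n. pochhammer a n * pochhammer b n * rGamma (c + of_nat n) * z ^ n / fact n)"

(* The principal branch: the holomorphic continuation of the series from the unit disc to the
   plane cut along [1,\<infinity>). It is unique on that domain by the identity theorem; values on the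
   cut itself are unspecified. *)
definition reg_hyp2f1 :: "complex \<Rightarrow> complex \<Rightarrow> complex \<Rightarrow> complex \<Rightarrow> complex" where
  "reg_hyp2f1 a b c =
     (SOME f. f holomorphic_on (- complex_of_real ` {1..}) \<and>
              (\<forall>z\<in>ball 0 1. f z = reg_hyp2f1_series a b c z))"

definition ferrers_domain :: "complex set" where
  "ferrers_domain = - complex_of_real ` ({..-1} \<union> {1..})"

(* On ferrers_domain the base (1 + x) / (1 - x) avoids (-\<infinity>,0], so the principal power is
   holomorphic there. *)
definition ferrers_P :: "complex \<Rightarrow> complex \<Rightarrow> complex \<Rightarrow> complex" where
  "ferrers_P \<nu> \<mu> x =
     ((1 + x) / (1 - x)) powr (\<mu> / 2) * reg_hyp2f1 (- \<nu>) (\<nu> + 1) (1 - \<mu>) ((1 - x) / 2)"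

definition legendre_P :: "complex \<Rightarrow> complex \<Rightarrow> complex" where
  "legendre_P \<nu> z = reg_hyp2f1 (- \<nu>) (\<nu> + 1) 1 ((1 - z) / 2)"

(* The square root of (1 - x^2)(1 - t^2) is the branch on ferrers_domain that is positive for
   x, t in (-1,1), i.e. the product of the principal roots. The principal root of the product is
   a different, discontinuous function when Re (1 - x^2) < 0. With w the quotient of the two
   roots, the argument of legendre_P is (w + 1/w) / 2 with w not in (-\<infinity>,0], so it stays off
   the cut (-\<infinity>,-1]. *)
definition ferrers_integrand :: "complex \<Rightarrow> complex \<Rightarrow> complex \<Rightarrow> complex \<Rightarrow> complex" where
  "ferrers_integrand \<nu> \<mu> x t =
     ferrers_P \<nu> (- \<mu>) t *
     legendre_P \<nu> ((2 - x\<^sup>2 - t\<^sup>2) / (2 * (csqrt (1 - x\<^sup>2) * csqrt (1 - t\<^sup>2)))) / (1 - t\<^sup>2)"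

end

theory Submission
  imports Defs
begin

text \<open>
  Put \<open>v = (1 - t\<^sup>2) / (1 - x\<^sup>2)\<close>. The kernel depends on \<open>v\<close> only and equals
  \<open>v\<close> to the power \<open>- N / 2\<close> times \<open>F(-N, 1/2; 1; 1 - v)\<close>, where \<open>N\<close> is either of \<open>\<nu>\<close> and
  \<open>- 1 - \<nu>\<close>, so for \<open>0 < x < 1\<close> the integral is a multiplicative convolution in \<open>1 - x\<^sup>2\<close>. By quadratic
  and Euler transformations both the Ferrers function \<open>f(x)\<close> and \<open>f(x) / x\<close> are \<open>1 - x\<^sup>2\<close> to the power
  \<open>\<mu> / 2\<close> times a hypergeometric series in \<open>1 - x\<^sup>2\<close>; integrating the second series term by term
  multiplies its coefficients by values of the Mellin transform of \<open>F(-N, 1/2; 1; 1 - v)\<close>. These values are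
  quotients of Gamma functions (Bateman's integral and Euler's integral at \<open>1\<close>) which turn the second
  series into a multiple of the first. Analytic continuation in \<open>x\<close> gives the whole domain.

  With \<open>N\<close> chosen such that \<open>Re N \<ge> - 1/2\<close>, the integral converges if \<open>Re (\<mu> - N) > 0\<close>. Otherwise the
  integrand behaves at the endpoint like a nonzero multiple of a power whose exponent has real part at
  most \<open>- 1\<close>, unless \<open>1 / \<Gamma>(1 + \<mu>) = 0\<close>; the hypotheses leave only \<open>\<mu> = - 1\<close> for this exception, and
  there the Ferrers function is a multiple of the one with \<open>\<mu> = 1\<close>.
\<close>

subsection \<open>Integrals depending holomorphically on a parameter\<close>

text \<open>Two choices diagonalise the integral operator. With
  \<open>v = (1 - t^2) / (1 - x^2)\<close> the differential \<open>dt\<close> is a multiple of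
  \<open>dv / t\<close>, which is why the series of f(t) / t is the one to integrate. With
  \<open>a = (\<mu> - N) / 2\<close> that series has numerator parameters \<open>a + N + 1\<close>
  and \<open>a + 1/2\<close>, while f(x) has \<open>a\<close> and \<open>a + N + 1/2\<close>. The
  n-th Mellin value carries these four numbers, as Gamma functions shifted by n, in just the
  quotient that exchanges the two pairs of Pochhammer symbols; what remains is the value at n = 0,
  twice the reciprocal of the stated factor if Re (\<mu> + \<nu>) > -1.

  As \<open>reg_hyp2f1\<close> is a choice, a continuation must first be shown to exist. The
  transformation formulas are then proved in one manner: both sides solve the same hypergeometric
  equation and agree at 0.

  For complex x the difficulty is the branches of powers and roots. On the segment from x to 1 the
  number 1 - t is a positive multiple of 1 - x, so only 1 + t has to be followed.

  Integrals are gauge integrals, which may converge conditionally; divergence cannot be read off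
  from norms.\<close>

lemma continuous_bounded_imp_absolutely_integrable:
  fixes f :: "real \<Rightarrow> complex" and g :: "real \<Rightarrow> real"
  assumes "continuous_on {a<..<b} f" "g integrable_on {a<..<b}"
    and "\<And>s. s \<in> {a<..<b} \<Longrightarrow> norm (f s) \<le> g s"
  shows "f absolutely_integrable_on {a<..<b}"
  by (rule measurable_bounded_by_integrable_imp_absolutely_integrable[OF _ _ assms(2,3)])
     (use assms(1) in \<open>auto intro!: continuous_imp_measurable_on_sets_lebesgue\<close>)

text \<open>Cauchy's inequality turns the local bound \<open>g\<close> for \<open>F\<close> into a
  bound for its derivative, hence for the difference quotients near \<open>x\<close>; dominated
  convergence then differentiates under the integral sign.\<close>

lemma holomorphic_on_dominated_integral:
  fixes F :: "complex \<Rightarrow> real \<Rightarrow> complex"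
  assumes U: "open U"
    and hol: "\<And>s. s \<in> S \<Longrightarrow> (\<lambda>x. F x s) holomorphic_on U"
    and int: "\<And>x. x \<in> U \<Longrightarrow> F x integrable_on S"
    and dom: "\<And>x. x \<in> U \<Longrightarrow> \<exists>r>0. \<exists>g. g integrable_on S \<and> ball x r \<subseteq> U \<and>
                 (\<forall>y\<in>ball x r. \<forall>s\<in>S. norm (F y s) \<le> g s)"
  shows "(\<lambda>x. integral S (F x)) holomorphic_on U"
proof -
  have "\<exists>D. ((\<lambda>x. integral S (F x)) has_field_derivative D) (at x)" if x: "x \<in> U" for x
  proof -
    obtain r g where r: "r > 0" and g: "g integrable_on S" and sub: "ball x r \<subseteq> U"
      and bd: "\<And>y s. y \<in> ball x r \<Longrightarrow> s \<in> S \<Longrightarrow> norm (F y s) \<le> g s"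
      using dom[OF x] by blast
    define D where "D = (\<lambda>s. deriv (\<lambda>x. F x s) x)"
    have der: "((\<lambda>x. F x s) has_field_derivative deriv (\<lambda>x. F x s) y) (at y)"
      if "y \<in> U" "s \<in> S" for y s
      using holomorphic_derivI[OF hol[OF that(2)] U that(1)] .
    \<comment> \<open>Discs of radius \<open>r/4\<close> around points of
      \<open>ball x (r/2)\<close> stay inside \<open>ball x r\<close>, where \<open>g\<close> is a
      bound.\<close>
    have dbd: "norm (deriv (\<lambda>x. F x s) y) \<le> g s / (r/4)" if y: "y \<in> ball x (r/2)" and s: "s \<in> S" for y s
    proof -
      have sub2: "cball y (r/4) \<subseteq> ball x r"
      proof
        fix z assume "z \<in> cball y (r/4)"
        thus "z \<in> ball x r" using y r dist_triangle[of x z y] by (auto simp: dist_commute)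
      qed
      have "norm ((deriv ^^ 1) (\<lambda>x. F x s) y) \<le> fact 1 * g s / (r/4) ^ 1"
      proof (rule Cauchy_inequality)
        show "(\<lambda>x. F x s) holomorphic_on ball y (r/4)"
          using hol[OF s] sub2 sub ball_subset_cball by (meson holomorphic_on_subset order_trans)
        show "continuous_on (cball y (r/4)) (\<lambda>x. F x s)"
          using hol[OF s] sub2 sub by (meson holomorphic_on_imp_continuous_on continuous_on_subset order_trans)
        show "0 < r/4" using r by simp
        fix z assume "norm (y - z) = r/4"
        hence "z \<in> cball y (r/4)" by (simp add: dist_norm)
        thus "norm (F z s) \<le> g s" using bd sub2 s by blast
      qed
      thus ?thesis by simp
    qed
    have lip: "norm (F y s - F x s) \<le> g s / (r/4) * norm (y - x)" if y: "y \<in> ball x (r/2)" and s: "s \<in> S" for y s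
    proof (rule field_differentiable_bound[of "ball x (r/2)" "\<lambda>x. F x s" "\<lambda>y. deriv (\<lambda>x. F x s) y"])
      show "((\<lambda>x. F x s) has_field_derivative deriv (\<lambda>x. F x s) z) (at z within ball x (r/2))"
        if "z \<in> ball x (r/2)" for z
      proof -
        have "dist x z < r" using that r by simp
        hence "z \<in> U" using sub by (simp add: subset_iff)
        thus ?thesis by (rule has_field_derivative_at_within[OF der[OF _ s]])
      qed
      show "norm (deriv (\<lambda>x. F x s) z) \<le> g s / (r/4)" if "z \<in> ball x (r/2)" for z
        by (rule dbd[OF that s])
      show "convex (ball x (r/2))" by simp
      show "y \<in> ball x (r/2)" "x \<in> ball x (r/2)" using y r by simp_all
    qed
    have "((\<lambda>y. (integral S (F y) - integral S (F x)) / (y - x)) \<longlongrightarrow> integral S D) (at x)"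
    unfolding tendsto_at_iff_sequentially
    proof (intro allI impI)
      fix X :: "nat \<Rightarrow> complex" assume X: "\<forall>i. X i \<in> UNIV - {x}" and lim: "X \<longlonglongrightarrow> x"
      \<comment> \<open>Dominated convergence works along sequences; the first \<open>n0\<close>
        terms are dropped so that the rest stays where \<open>lip\<close> holds.\<close>
      obtain n0 where n0: "\<And>n. n \<ge> n0 \<Longrightarrow> X n \<in> ball x (r/2)"
        using lim r unfolding lim_sequentially by (metis dist_commute half_gt_zero mem_ball)
      define Z where "Z = (\<lambda>n. X (n + n0))"
      have Z: "Z n \<in> ball x (r/2)" "Z n \<noteq> x" for n using n0[of "n+n0"] X by (auto simp: Z_def)
      have Zl: "Z \<longlonglongrightarrow> x" unfolding Z_def using lim by (rule LIMSEQ_ignore_initial_segment)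
      have ZU: "Z n \<in> U" for n using Z(1)[of n] sub r by auto
      have "(\<lambda>n. integral S (\<lambda>s. (F (Z n) s - F x s) / (Z n - x))) \<longlonglongrightarrow> integral S D"
      proof (rule dominated_convergence(2))
        show "(\<lambda>s. (F (Z n) s - F x s) / (Z n - x)) integrable_on S" for n
          using int ZU x by (intro integrable_on_divide integrable_diff) auto
        show "(\<lambda>s. g s / (r/4)) integrable_on S" using g by (rule integrable_on_divide)
        show "norm ((F (Z n) s - F x s) / (Z n - x)) \<le> g s / (r/4)" if "s \<in> S" for n s
          using lip[OF Z(1)[of n] that] Z(2)[of n] r by (simp add: norm_divide pos_divide_le_eq)
        show "(\<lambda>n. (F (Z n) s - F x s) / (Z n - x)) \<longlonglongrightarrow> D s" if "s \<in> S" for s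
        proof -
          have "((\<lambda>y. (F y s - F x s) / (y - x)) \<longlongrightarrow> D s) (at x)"
            using der[OF x that] unfolding D_def has_field_derivative_iff .
          thus ?thesis using Z(2) Zl
            unfolding tendsto_at_iff_sequentially by (auto simp: o_def)
        qed
      qed
      moreover have "integral S (\<lambda>s. (F (Z n) s - F x s) / (Z n - x)) =
          (integral S (F (Z n)) - integral S (F x)) / (Z n - x)" for n
        using int ZU x by (simp add: integral_diff)
      ultimately have "(\<lambda>n. (integral S (F (Z n)) - integral S (F x)) / (Z n - x)) \<longlonglongrightarrow> integral S D"
        by (simp only:)
      thus "((\<lambda>y. (integral S (F y) - integral S (F x)) / (y - x)) \<circ> X) \<longlonglongrightarrow> integral S D"
        unfolding Z_def using LIMSEQ_offset[of "(\<lambda>y. (integral S (F y) - integral S (F x)) / (y - x)) \<circ> X" n0]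
        by (simp only: o_def)
    qed
    thus ?thesis unfolding has_field_derivative_iff by blast
  qed
  thus ?thesis using U by (auto simp: holomorphic_on_open)
qed

section \<open>The Beta integral with complex parameters\<close>

lemma Beta_integrable_open:
  assumes "a > 0" "b > (0::real)"
  shows "(\<lambda>t. t powr (a - 1) * (1 - t) powr (b - 1)) integrable_on {0<..<1}"
  using integrable_Beta'[OF assms] by (simp add: integrable_on_Icc_iff_Ioo)

lemma norm_Beta_integrand:
  assumes "t \<in> {0<..<1::real}"
  shows "norm (complex_of_real t powr (a - 1) * (1 - complex_of_real t) powr (b - 1)) =
           t powr (Re a - 1) * (1 - t) powr (Re b - 1)"
proof -
  have "norm ((1 - complex_of_real t) powr (b - 1)) = (1 - t) powr (Re b - 1)"
    using assms norm_powr_real_powr[of "1 - complex_of_real t" "b - 1"] by (auto simp: complex_is_Real_iff)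
  thus ?thesis using assms by (simp add: norm_mult norm_powr_real_powr)
qed

lemma Beta_absolutely_integrable_complex:
  assumes "Re a > 0" "Re b > 0"
  shows "(\<lambda>t. complex_of_real t powr (a - 1) * (1 - complex_of_real t) powr (b - 1)) absolutely_integrable_on {0<..<1}"
proof (rule continuous_bounded_imp_absolutely_integrable)
  show "continuous_on {0<..<1} (\<lambda>t. complex_of_real t powr (a - 1) * (1 - complex_of_real t) powr (b - 1))"
    by (intro continuous_intros) (auto simp: complex_nonpos_Reals_iff)
  show "(\<lambda>t. t powr (Re a - 1) * (1 - t) powr (Re b - 1)) integrable_on {0<..<1}"
    using assms by (rule Beta_integrable_open)
qed (simp add: norm_Beta_integrand)

lemma powr_antimono_unit_interval:
  fixes t :: real
  assumes "t \<in> {0<..<1}" "p \<le> q"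
  shows "t powr q \<le> t powr p"
  using assms by (intro powr_mono') auto

lemma Beta_integral_holomorphic:
  assumes "Re b > 0"
  shows "(\<lambda>a. integral {0<..<1} (\<lambda>t. complex_of_real t powr (a - 1) * (1 - complex_of_real t) powr (b - 1)))
           holomorphic_on {a. Re a > 0}"
proof (rule holomorphic_on_dominated_integral)
  show "open {a. Re a > 0}" by (rule open_halfspace_Re_gt)
  show "(\<lambda>a. complex_of_real t powr (a - 1) * (1 - complex_of_real t) powr (b - 1)) holomorphic_on {a. Re a > 0}"
    if "t \<in> {0<..<1}" for t
    using that by (intro holomorphic_intros) auto
  show "(\<lambda>t. complex_of_real t powr (a - 1) * (1 - complex_of_real t) powr (b - 1)) integrable_on {0<..<1}"
    if "a \<in> {a. Re a > 0}" for a
    using Beta_absolutely_integrable_complex[of a b] that assms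
    by (intro set_lebesgue_integral_eq_integral(1)) simp
  fix a assume a: "a \<in> {a. Re a > 0}"
  have sub: "Re y > Re a / 2" if "y \<in> ball a (Re a / 2)" for y
  proof -
    have "\<bar>Re (a - y)\<bar> \<le> norm (a - y)" by (rule abs_Re_le_cmod)
    thus ?thesis using that by (simp add: dist_norm)
  qed
  show "\<exists>r>0. \<exists>g. g integrable_on {0<..<1} \<and> ball a r \<subseteq> {a. Re a > 0} \<and>
      (\<forall>y\<in>ball a r. \<forall>t\<in>{0<..<1}. norm (complex_of_real t powr (y - 1) * (1 - complex_of_real t) powr (b - 1)) \<le> g t)"
  proof (intro exI[of _ "Re a / 2"] exI[of _ "\<lambda>t. t powr (Re a / 2 - 1) * (1 - t) powr (Re b - 1)"] conjI ballI)
    show "ball a (Re a / 2) \<subseteq> {a. Re a > 0}" using sub a by fastforce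
    fix y t assume "y \<in> ball a (Re a / 2)" and t: "t \<in> {0<..<1::real}"
    thus "norm (complex_of_real t powr (y - 1) * (1 - complex_of_real t) powr (b - 1)) \<le> t powr (Re a / 2 - 1) * (1 - t) powr (Re b - 1)"
      unfolding norm_Beta_integrand[OF t] using sub[of y]
      by (intro mult_right_mono powr_antimono_unit_interval) auto
  qed (use a assms in \<open>auto intro!: Beta_integrable_open\<close>)
qed

lemma Beta_holomorphic_halfplane: "Re b > 0 \<Longrightarrow> (\<lambda>a. Beta a b) holomorphic_on {a. Re a > 0}"
  by (intro holomorphic_intros) (auto dest!: nonpos_Ints_nonpos simp: complex_is_Real_iff elim!: nonpos_Ints_cases)

lemma halfplane_continuation:
  assumes "f holomorphic_on {a. Re a > 0}" "g holomorphic_on {a. Re a > 0}"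
    and "\<And>x. x > 0 \<Longrightarrow> f (complex_of_real x) = g (complex_of_real x)" and "Re a > 0"
  shows "f a = g a"
proof -
  have "f a - g a = 0"
  proof (rule analytic_continuation[of "\<lambda>z. f z - g z" "{a. Re a > 0}" "complex_of_real ` {0<..}" 1])
    show "(\<lambda>z. f z - g z) holomorphic_on {a. Re a > 0}" using assms by (intro holomorphic_intros)
    show "(1::complex) islimpt complex_of_real ` {0<..}"
      unfolding islimpt_approachable
    proof (intro allI impI)
      fix e :: real assume "e > 0"
      thus "\<exists>x'\<in>complex_of_real ` {0<..}. x' \<noteq> 1 \<and> dist x' 1 < e"
        by (intro bexI[of _ "complex_of_real (1 + e/2)"]) (auto simp: dist_norm intro!: image_eqI[of _ _ "1 + e/2"])
    qed
  qed (use assms in \<open>auto intro: open_halfspace_Re_gt convex_connected convex_halfspace_Re_gt\<close>)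
  thus ?thesis by simp
qed

text \<open>The identity for real parameters is continued in one argument and, after the
  substitution of \<open>1 - t\<close> for \<open>t\<close> has exchanged the two, in the other.
  Thus holomorphy is needed only in the first argument.\<close>

theorem has_integral_Beta_complex:
  assumes "Re a > 0" "Re b > 0"
  shows "((\<lambda>t. complex_of_real t powr (a - 1) * (1 - complex_of_real t) powr (b - 1)) has_integral Beta a b) {0<..<1}"
proof -
  define I where "I = (\<lambda>a b. integral {0<..<1} (\<lambda>t. complex_of_real t powr (a - 1) * (1 - complex_of_real t) powr (b - 1)))"
  have int: "(\<lambda>t. complex_of_real t powr (a - 1) * (1 - complex_of_real t) powr (b - 1)) integrable_on {0<..<1}"
    if "Re a > 0" "Re b > 0" for a b
    using Beta_absolutely_integrable_complex[OF that] by (rule set_lebesgue_integral_eq_integral(1))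
  have sym: "I a b = I b a" if ab: "Re a > 0" "Re b > 0" for a b
  proof -
    have "((\<lambda>t. complex_of_real t powr (a - 1) * (1 - complex_of_real t) powr (b - 1)) has_integral I a b) {0..1}"
      using int[OF ab] by (simp add: I_def has_integral_Icc_iff_Ioo integrable_integral)
    from has_integral_affinity[of _ _ 0 "1::real" "-1" 1, OF this[folded box_real]]
    have "((\<lambda>t. complex_of_real (1 - t) powr (a - 1) * (1 - complex_of_real (1 - t)) powr (b - 1)) has_integral I a b)
        ((\<lambda>t. 1 - t) ` {0..1})" by simp
    also have "(\<lambda>t::real. 1 - t) ` {0..1} = {0..1}" by (auto intro!: image_eqI[of _ _ "1 - x" for x])
    finally have "((\<lambda>t. complex_of_real t powr (b - 1) * (1 - complex_of_real t) powr (a - 1)) has_integral I a b) {0<..<1}"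
      by (simp add: has_integral_Icc_iff_Ioo mult.commute)
    thus ?thesis by (simp add: I_def integral_unique)
  qed
  have real: "I (of_real x) (of_real y) = Beta (of_real x) (of_real y)" if "x > 0" "y > 0" for x y
  proof -
    have "((\<lambda>t. complex_of_real (t powr (x - 1) * (1 - t) powr (y - 1))) has_integral of_real (Beta x y)) {0<..<1}"
      using has_integral_Beta_real[OF that]
      by (intro has_integral_of_real) (simp add: has_integral_Icc_iff_Ioo)
    also have "?this \<longleftrightarrow> ((\<lambda>t. complex_of_real t powr (of_real x - 1) * (1 - complex_of_real t) powr (of_real y - 1)) has_integral of_real (Beta x y)) {0<..<1}"
    proof (rule has_integral_cong)
      fix t :: real assume t: "t \<in> {0<..<1}"
      have "complex_of_real t powr (of_real x - 1) = of_real (t powr (x - 1))"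
        using powr_of_real[of t "x - 1"] t by simp
      moreover have "(1 - complex_of_real t) powr (of_real y - 1) = of_real ((1 - t) powr (y - 1))"
        using powr_of_real[of "1 - t" "y - 1"] t by simp
      ultimately show "complex_of_real (t powr (x - 1) * (1 - t) powr (y - 1)) =
          complex_of_real t powr (of_real x - 1) * (1 - complex_of_real t) powr (of_real y - 1)" by simp
    qed
    finally show ?thesis unfolding I_def by (simp add: integral_unique Beta_complex_of_real)
  qed
  have hol: "(\<lambda>a. I a b) holomorphic_on {a. Re a > 0}" if "Re b > 0" for b
    unfolding I_def using that by (rule Beta_integral_holomorphic)
  have 1: "I a (of_real y) = Beta a (of_real y)" if "Re a > 0" "y > 0" for a y
    by (rule halfplane_continuation[OF hol Beta_holomorphic_halfplane real])
       (simp_all add: that)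
  \<comment> \<open>Now the second argument is the complex number \<open>a\<close>; on the positive
    reals \<open>sym\<close> reduces the claim to \<open>1\<close>.\<close>
  have "I b a = Beta b a"
  proof (rule halfplane_continuation[OF hol Beta_holomorphic_halfplane])
    show "I (complex_of_real x) a = Beta (complex_of_real x) a" if "x > 0" for x
      using 1[OF assms(1) that] sym[OF assms(1), of "complex_of_real x"] that by (simp add: Beta_commute)
  qed (simp_all add: assms)
  hence "I a b = Beta a b" using sym assms by (simp add: Beta_commute)
  thus ?thesis using int[OF assms] by (simp add: has_integral_iff I_def)
qed

subsection \<open>The hypergeometric series\<close>

definition cut_plane :: "complex set" where "cut_plane = - complex_of_real ` {1..}"

lemma cut_plane_iff: "z \<in> cut_plane \<longleftrightarrow> Im z \<noteq> 0 \<or> Re z < 1"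
  by (auto simp: cut_plane_def image_iff complex_eq_iff not_le)

lemma open_cut_plane: "open cut_plane"
proof -
  have "cut_plane = {z. Re z < 1} \<union> ({z. Im z > 0} \<union> {z. Im z < 0})"
    using cut_plane_iff by (auto simp: linorder_neq_iff)
  also have "open \<dots>"
    by (intro open_Un open_halfspace_Re_lt open_halfspace_Im_gt open_halfspace_Im_lt)
  finally show ?thesis .
qed

lemma of_real_mult_in_cut_plane:
  assumes "z \<in> cut_plane" "0 \<le> s" "s \<le> 1"
  shows "complex_of_real s * z \<in> cut_plane"
proof (cases "s = 0 \<or> Im z \<noteq> 0")
  case True thus ?thesis using assms by (cases "s = 0") (auto simp: cut_plane_iff)
next
  case False
  hence "Re z < 1" using assms by (auto simp: cut_plane_iff)
  have "s * Re z \<le> max 0 (Re z)"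
    using assms(2,3) mult_right_mono[of s 1 "Re z"] mult_nonneg_nonpos[of s "Re z"] by (cases "Re z \<ge> 0") auto
  hence "s * Re z < 1" using \<open>Re z < 1\<close> by simp
  thus ?thesis by (simp add: cut_plane_iff)
qed

lemma connected_cut_plane: "connected cut_plane"
proof -
  have "closed_segment 0 z \<subseteq> cut_plane" if "z \<in> cut_plane" for z
    using of_real_mult_in_cut_plane[OF that] by (auto simp: closed_segment_def scaleR_conv_of_real)
  hence "starlike cut_plane" unfolding starlike_def by (intro bexI[of _ 0]) (auto simp: cut_plane_iff)
  thus ?thesis by (rule starlike_imp_connected)
qed

lemma ball_subset_cut_plane: "ball 0 1 \<subseteq> cut_plane"
proof
  fix z :: complex assume "z \<in> ball 0 1"
  hence "Re z < 1" using complex_Re_le_cmod[of z] by simp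
  thus "z \<in> cut_plane" by (simp add: cut_plane_iff)
qed

text \<open>Keeps the factor \<open>1 - s z\<close> of Euler's integrand off the branch cut of the
  power.\<close>

lemma one_minus_of_real_mult_notin_nonpos:
  assumes "z \<in> cut_plane" "0 \<le> s" "s \<le> 1"
  shows "1 - complex_of_real s * z \<notin> \<real>\<^sub>\<le>\<^sub>0"
  using of_real_mult_in_cut_plane[OF assms] by (auto simp: complex_nonpos_Reals_iff cut_plane_iff)

definition hyp_coeff :: "complex \<Rightarrow> complex \<Rightarrow> complex \<Rightarrow> nat \<Rightarrow> complex" where
  "hyp_coeff a b c n = pochhammer a n * pochhammer b n * rGamma (c + of_nat n) / fact n"

definition hyp_fps :: "complex \<Rightarrow> complex \<Rightarrow> complex \<Rightarrow> complex fps" where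
  "hyp_fps a b c = Abs_fps (hyp_coeff a b c)"

text \<open>Left without division because \<open>c + n\<close> can vanish; it still holds then,
  since \<open>z * rGamma (z + 1) = rGamma z\<close> for every \<open>z\<close>.\<close>

lemma hyp_coeff_Suc:
  "(c + of_nat n) * of_nat (Suc n) * hyp_coeff a b c (Suc n) = (a + of_nat n) * (b + of_nat n) * hyp_coeff a b c n"
proof -
  have "rGamma (c + of_nat n) = (c + of_nat n) * rGamma (c + of_nat (Suc n))"
    using rGamma_plus1[of "c + of_nat n"] by (simp add: add_ac)
  thus ?thesis unfolding hyp_coeff_def pochhammer_Suc fact_Suc
    by (simp add: divide_simps del: of_nat_Suc)
qed

lemma hyp_coeff_summable:
  assumes "norm z < 1"
  shows "summable (\<lambda>n. norm (hyp_coeff a b c n * z ^ n))"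
proof -
  \<comment> \<open>The quotient of consecutive terms, each fraction written as 1 plus a null
    sequence. It is used only for large \<open>n\<close>, where \<open>c + n\<close> is
    nonzero.\<close>
  define q where "q = (\<lambda>n::nat. (1 + (a - 1) / of_nat (Suc n)) * (1 + (b - c) / (c + of_nat n)) * z)"
  have inf: "filterlim (\<lambda>n::nat. d + of_nat n :: complex) at_infinity sequentially" for d
    by (intro tendsto_add_filterlim_at_infinity[OF tendsto_const] tendsto_of_nat)
  have "q \<longlonglongrightarrow> (1 + 0) * (1 + 0) * z"
    unfolding q_def using inf[of 1] inf[of c]
    by (intro tendsto_intros tendsto_divide_0[OF tendsto_const]) (auto simp: add.commute)
  hence "(\<lambda>n. norm (q n)) \<longlonglongrightarrow> norm z" by (intro tendsto_norm) simp
  hence ev: "eventually (\<lambda>n. norm (q n) < (1 + norm z) / 2) sequentially"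
    by (rule order_tendstoD) (use assms in simp)
  have "eventually (\<lambda>n::nat. norm (c + of_nat n) \<ge> 1) sequentially"
    using filterlim_at_infinity_imp_norm_at_top[OF inf[of c]] by (simp add: filterlim_at_top)
  hence "eventually (\<lambda>n::nat. c + of_nat n \<noteq> 0) sequentially"
    by (rule eventually_mono) auto
  from eventually_conj[OF this ev] obtain N where N: "\<And>n. n \<ge> N \<Longrightarrow> c + of_nat n \<noteq> 0 \<and> norm (q n) < (1 + norm z) / 2"
    unfolding eventually_sequentially by blast
  show ?thesis
  proof (rule summable_ratio_test[of "(1 + norm z) / 2" N])
    fix n assume "n \<ge> N"
    note n = N[OF this]
    have "hyp_coeff a b c (Suc n) = (a + of_nat n) * (b + of_nat n) / ((c + of_nat n) * of_nat (Suc n)) * hyp_coeff a b c n"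
    proof -
      have "(c + of_nat n) * of_nat (Suc n) \<noteq> 0" using n by (simp del: of_nat_Suc)
      from eq_divide_imp[OF this, of "hyp_coeff a b c (Suc n)"] hyp_coeff_Suc[of c n a b]
      show ?thesis by (metis mult.commute times_divide_eq_left)
    qed
    also have "(a + of_nat n) * (b + of_nat n) / ((c + of_nat n) * of_nat (Suc n)) =
        (1 + (a - 1) / of_nat (Suc n)) * (1 + (b - c) / (c + of_nat n))"
    proof -
      have gen: "(u + a') * (w + b') / (w * u) = (1 + a' / u) * (1 + b' / w)" if "u \<noteq> 0" "w \<noteq> 0" for u w a' b' :: complex
        using that by (simp add: field_simps)
      have "of_nat (Suc n) \<noteq> (0::complex)" by (simp del: of_nat_Suc)
      from gen[OF this, of "c + of_nat n" "a - 1" "b - c"] n show ?thesis by (simp add: algebra_simps)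
    qed
    finally have "hyp_coeff a b c (Suc n) * z ^ Suc n = q n * (hyp_coeff a b c n * z ^ n)"
      by (simp add: q_def mult_ac)
    hence "norm (hyp_coeff a b c (Suc n) * z ^ Suc n) = norm (q n) * norm (hyp_coeff a b c n * z ^ n)"
      by (simp only: norm_mult)
    also have "\<dots> \<le> (1 + norm z) / 2 * norm (hyp_coeff a b c n * z ^ n)"
      using n by (intro mult_right_mono) auto
    finally show "norm (norm (hyp_coeff a b c (Suc n) * z ^ Suc n)) \<le> (1 + norm z) / 2 * norm (norm (hyp_coeff a b c n * z ^ n))"
      by simp
  qed (use assms in simp)
qed

lemma hyp_coeff_sums:
  assumes "norm z < 1"
  shows "(\<lambda>n. hyp_coeff a b c n * z ^ n) sums reg_hyp2f1_series a b c z"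
  using summable_norm_cancel[OF hyp_coeff_summable[OF assms]]
  unfolding reg_hyp2f1_series_def hyp_coeff_def by (simp add: summable_sums_iff)

lemma hyp_fps_conv_radius: "fps_conv_radius (hyp_fps a b c) \<ge> 1"
  unfolding fps_conv_radius_def
proof (rule conv_radius_geI_ex')
  fix r :: real assume "0 < r" "ereal r < 1"
  thus "summable (\<lambda>n. fps_nth (hyp_fps a b c) n * of_real r ^ n)"
    using summable_norm_cancel[OF hyp_coeff_summable[of "of_real r" a b c]] by (simp add: hyp_fps_def)
qed

lemma eval_hyp_fps: "norm z < 1 \<Longrightarrow> eval_fps (hyp_fps a b c) z = reg_hyp2f1_series a b c z"
  unfolding eval_fps_def hyp_fps_def using hyp_coeff_sums[of z a b c] by (simp add: sums_iff)

lemma binomial_sums: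
  fixes z a :: complex
  assumes "norm z < 1"
  shows "(\<lambda>n. pochhammer a n / fact n * z ^ n) sums ((1 - z) powr (- a))"
proof -
  have "(- a gchoose n) * (- z) ^ n = pochhammer a n / fact n * z ^ n" for n
    unfolding gbinomial_pochhammer by (cases "even n") simp_all
  thus ?thesis using gen_binomial_complex[of "-z" "-a"] assms by simp
qed

subsection \<open>Continuation to the cut plane\<close>

text \<open>Makes \<open>hyp_coeff_summable\<close> available for the binomial series.\<close>

lemma binomial_eq_hyp_coeff: "pochhammer a n / fact n = hyp_coeff a 1 1 n"
  by (simp add: hyp_coeff_def pochhammer_fact[symmetric] rGamma_inverse_Gamma Gamma_fact field_simps)

definition euler_integral :: "complex \<Rightarrow> complex \<Rightarrow> complex \<Rightarrow> complex \<Rightarrow> complex" where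
  "euler_integral a b c z = integral {0<..<1} (\<lambda>s. of_real s powr (b - 1) * (1 - of_real s) powr (c - b - 1)
     * (1 - of_real s * z) powr (- a))"

lemma continuous_on_powr_const:
  fixes f :: "'a::topological_space \<Rightarrow> complex"
  assumes "continuous_on A f" "\<And>x. x \<in> A \<Longrightarrow> f x \<notin> \<real>\<^sub>\<le>\<^sub>0"
  shows "continuous_on A (\<lambda>x. f x powr p)"
proof -
  have "continuous_on (- \<real>\<^sub>\<le>\<^sub>0) (\<lambda>w. w powr p)"
    by (intro holomorphic_on_imp_continuous_on holomorphic_intros) auto
  from continuous_on_compose2[OF this assms(1)] show ?thesis using assms(2) by auto
qed

text \<open>Joint continuity including both ends of the interval, so that compactness yields one
  bound for all \<open>s\<close> and all \<open>z\<close> in a compact set.\<close>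

lemma continuous_on_euler_factor:
  "continuous_on (cut_plane \<times> {0..1}) (\<lambda>(z, s). (1 - complex_of_real s * z) powr (- a))"
  unfolding case_prod_unfold
proof (rule continuous_on_powr_const)
  show "1 - complex_of_real (snd x) * fst x \<notin> \<real>\<^sub>\<le>\<^sub>0" if "x \<in> cut_plane \<times> {0..1}" for x
    using that by (intro one_minus_of_real_mult_notin_nonpos) auto
qed (intro continuous_intros)

lemma euler_factor_bounded:
  assumes "K \<subseteq> cut_plane" "compact K"
  obtains B where "\<And>z s. z \<in> K \<Longrightarrow> s \<in> {0..1} \<Longrightarrow> norm ((1 - complex_of_real s * z) powr (- a)) \<le> B"
proof -
  have "compact ((\<lambda>(z, s). (1 - complex_of_real s * z) powr (- a)) ` (K \<times> {0..1}))"
    by (intro compact_continuous_image continuous_on_subset[OF continuous_on_euler_factor] compact_Times)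
       (use assms in auto)
  from compact_imp_bounded[OF this] show ?thesis
    using that unfolding bounded_iff by fastforce
qed

lemma euler_integrand_absolutely_integrable:
  assumes "Re b > 0" "Re c > Re b" "z \<in> cut_plane"
  shows "(\<lambda>s. complex_of_real s powr (b - 1) * (1 - of_real s) powr (c - b - 1) * (1 - of_real s * z) powr (- a))
           absolutely_integrable_on {0<..<1}"
proof -
  obtain B where B: "\<And>s. s \<in> {0..1} \<Longrightarrow> norm ((1 - complex_of_real s * z) powr (- a)) \<le> B"
  proof (rule euler_factor_bounded[of "{z}" a])
    fix B assume "\<And>w s. w \<in> {z} \<Longrightarrow> s \<in> {0..1} \<Longrightarrow> norm ((1 - complex_of_real s * w) powr (- a)) \<le> B"
    thus thesis by (intro that) auto
  qed (use assms(3) in auto)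
  show ?thesis
  proof (rule continuous_bounded_imp_absolutely_integrable)
    have "continuous_on {0<..<1} ((\<lambda>(z, s). (1 - complex_of_real s * z) powr (- a)) \<circ> (\<lambda>s. (z, s)))"
      by (rule continuous_on_compose[OF _ continuous_on_subset[OF continuous_on_euler_factor]])
         (use assms(3) in \<open>auto intro!: continuous_intros\<close>)
    hence "continuous_on {0<..<1} (\<lambda>s. (1 - complex_of_real s * z) powr (- a))" by (simp add: o_def)
    thus "continuous_on {0<..<1} (\<lambda>s. complex_of_real s powr (b - 1) * (1 - of_real s) powr (c - b - 1) * (1 - of_real s * z) powr (- a))"
      by (intro continuous_on_mult) (auto intro!: continuous_intros simp: complex_nonpos_Reals_iff)
    show "(\<lambda>s. s powr (Re b - 1) * (1 - s) powr (Re (c - b) - 1) * B) integrable_on {0<..<1}"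
      using assms by (intro integrable_on_mult_left Beta_integrable_open) auto
    fix s :: real assume s: "s \<in> {0<..<1}"
    show "norm (complex_of_real s powr (b - 1) * (1 - of_real s) powr (c - b - 1) * (1 - of_real s * z) powr (- a))
        \<le> s powr (Re b - 1) * (1 - s) powr (Re (c - b) - 1) * B"
      using norm_Beta_integrand[OF s, of b "c - b"] B[of s] s
      by (subst norm_mult) (auto intro!: mult_left_mono)
  qed
qed

lemma euler_integral_holomorphic:
  assumes "Re b > 0" "Re c > Re b"
  shows "euler_integral a b c holomorphic_on cut_plane"
  unfolding euler_integral_def
proof (rule holomorphic_on_dominated_integral[OF open_cut_plane])
  show "(\<lambda>z. of_real s powr (b - 1) * (1 - of_real s) powr (c - b - 1) * (1 - of_real s * z) powr (- a)) holomorphic_on cut_plane"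
    if "s \<in> {0<..<1}" for s :: real
    using one_minus_of_real_mult_notin_nonpos that by (intro holomorphic_intros) auto
  show "(\<lambda>s. complex_of_real s powr (b - 1) * (1 - of_real s) powr (c - b - 1) * (1 - of_real s * z) powr (- a)) integrable_on {0<..<1}"
    if "z \<in> cut_plane" for z
    using euler_integrand_absolutely_integrable[OF assms that] by (rule set_lebesgue_integral_eq_integral(1))
  fix z assume "z \<in> cut_plane"
  then obtain r where r: "r > 0" "cball z r \<subseteq> cut_plane"
    using open_cut_plane open_contains_cball by blast
  obtain B where B: "\<And>w s. w \<in> cball z r \<Longrightarrow> s \<in> {0..1} \<Longrightarrow> norm ((1 - complex_of_real s * w) powr (- a)) \<le> B"
    using euler_factor_bounded[OF r(2) compact_cball] by blast
  show "\<exists>r>0. \<exists>g. g integrable_on {0<..<1} \<and> ball z r \<subseteq> cut_plane \<and> (\<forall>y\<in>ball z r. \<forall>s\<in>{0<..<1}.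
      norm (complex_of_real s powr (b - 1) * (1 - of_real s) powr (c - b - 1) * (1 - of_real s * y) powr (- a)) \<le> g s)"
  proof (intro exI[of _ r] conjI exI[of _ "\<lambda>s. s powr (Re b - 1) * (1 - s) powr (Re (c - b) - 1) * B"] ballI)
    show "ball z r \<subseteq> cut_plane" using r(2) ball_subset_cball by blast
    show "(\<lambda>s. s powr (Re b - 1) * (1 - s) powr (Re (c - b) - 1) * B) integrable_on {0<..<1}"
      using assms by (intro integrable_on_mult_left Beta_integrable_open) auto
    fix y s assume y: "y \<in> ball z r" and s: "s \<in> {0<..<1::real}"
    show "norm (complex_of_real s powr (b - 1) * (1 - of_real s) powr (c - b - 1) * (1 - of_real s * y) powr (- a))
        \<le> s powr (Re b - 1) * (1 - s) powr (Re (c - b) - 1) * B"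
      using norm_Beta_integrand[OF s, of b "c - b"] B[of y s] s y
      by (subst norm_mult) (auto intro!: mult_left_mono)
  qed (use r in auto)
qed

lemma Gamma_plus_nat: "b \<notin> \<int>\<^sub>\<le>\<^sub>0 \<Longrightarrow> Gamma (b + of_nat n) = pochhammer b n * Gamma (b::complex)"
  by (simp add: pochhammer_Gamma Gamma_eq_zero_iff)

lemma Re_pos_notin_nonpos_Ints: "Re b > 0 \<Longrightarrow> b \<notin> \<int>\<^sub>\<le>\<^sub>0"
  by (auto elim!: nonpos_Ints_cases)

text \<open>The binomial series of \<open>(1 - s z) powr (- a)\<close> is integrated term by term
  against the Beta weight. The partial sums are dominated by the weight times the sum of the norms
  of \<open>u n\<close>.\<close>

lemma euler_integral_series:
  assumes b: "Re b > 0" "Re c > Re b" and z: "norm z < 1"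
  shows "euler_integral a b c z = Gamma b * Gamma (c - b) * reg_hyp2f1_series a b c z"
proof -
  define w where "w = (\<lambda>s. complex_of_real s powr (b - 1) * (1 - of_real s) powr (c - b - 1))"
  define u where "u = (\<lambda>n. hyp_coeff a 1 1 n * z ^ n)"
  have su: "summable (\<lambda>n. norm (u n))" unfolding u_def by (rule hyp_coeff_summable[OF z])
  have trm: "((\<lambda>s. w s * (u n * of_real s ^ n)) has_integral (u n * Beta (b + of_nat n) (c - b))) {0<..<1}" for n
  proof -
    have "((\<lambda>s. u n * (complex_of_real s powr (b + of_nat n - 1) * (1 - of_real s) powr (c - b - 1))) has_integral
             (u n * Beta (b + of_nat n) (c - b))) {0<..<1}"
      using b by (intro has_integral_mult_right has_integral_Beta_complex) auto
    moreover have "u n * (complex_of_real s powr (b + of_nat n - 1) * (1 - of_real s) powr (c - b - 1)) = w s * (u n * of_real s ^ n)"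
      if "s \<in> {0<..<1}" for s
    proof -
      have "complex_of_real s powr (b + of_nat n - 1) = of_real s powr (b - 1) * of_real s powr (of_nat n)"
        by (simp flip: powr_add add: algebra_simps)
      also have "complex_of_real s powr (of_nat n) = of_real s ^ n" using that by (simp add: powr_nat)
      finally show ?thesis by (simp add: w_def mult_ac)
    qed
    ultimately show ?thesis by (rule has_integral_eq[rotated])
  qed
  have Beta: "u n * Beta (b + of_nat n) (c - b) = Gamma b * Gamma (c - b) * (hyp_coeff a b c n * z ^ n)" for n
  proof -
    have "Beta (b + of_nat n) (c - b) = pochhammer b n * Gamma b * Gamma (c - b) * rGamma (c + of_nat n)"
      using Re_pos_notin_nonpos_Ints[OF b(1)] by (simp add: Beta_altdef Gamma_plus_nat algebra_simps)
    moreover have "u n = pochhammer a n / fact n * z ^ n" unfolding u_def binomial_eq_hyp_coeff ..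
    ultimately show ?thesis by (simp add: hyp_coeff_def)
  qed
  have "((\<lambda>s. w s * (1 - of_real s * z) powr (- a)) has_integral (Gamma b * Gamma (c - b) * reg_hyp2f1_series a b c z)) {0<..<1}"
  proof (rule has_integral_dominated_convergence)
    show "((\<lambda>s. \<Sum>n<k. w s * (u n * of_real s ^ n)) has_integral (\<Sum>n<k. u n * Beta (b + of_nat n) (c - b))) {0<..<1}" for k
      by (intro has_integral_sum trm) auto
    show "(\<lambda>s. s powr (Re b - 1) * (1 - s) powr (Re (c - b) - 1) * (\<Sum>n. norm (u n))) integrable_on {0<..<1}"
      using b by (intro integrable_on_mult_left Beta_integrable_open) auto
    show "\<forall>s\<in>{0<..<1}. norm (\<Sum>n<k. w s * (u n * of_real s ^ n)) \<le> s powr (Re b - 1) * (1 - s) powr (Re (c - b) - 1) * (\<Sum>n. norm (u n))" for k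
    proof
      fix s :: real assume s: "s \<in> {0<..<1}"
      have "norm (\<Sum>n<k. u n * of_real s ^ n) \<le> (\<Sum>n<k. norm (u n * of_real s ^ n))" by (rule norm_sum)
      also have "\<dots> \<le> (\<Sum>n<k. norm (u n))"
        using s by (intro sum_mono) (auto simp: norm_mult norm_power intro!: mult_right_le_one_le power_le_one)
      also have "\<dots> \<le> (\<Sum>n. norm (u n))" by (intro sum_le_suminf su) auto
      finally have "norm (w s) * norm (\<Sum>n<k. u n * of_real s ^ n) \<le> norm (w s) * (\<Sum>n. norm (u n))"
        by (rule mult_left_mono) simp
      thus "norm (\<Sum>n<k. w s * (u n * of_real s ^ n)) \<le> s powr (Re b - 1) * (1 - s) powr (Re (c - b) - 1) * (\<Sum>n. norm (u n))"
        using norm_Beta_integrand[OF s, of b "c - b"] by (simp add: w_def sum_distrib_left[symmetric] norm_mult)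
    qed
    show "\<forall>s\<in>{0<..<1}. (\<lambda>k. \<Sum>n<k. w s * (u n * of_real s ^ n)) \<longlonglongrightarrow> w s * (1 - of_real s * z) powr (- a)"
    proof
      fix s :: real assume s: "s \<in> {0<..<1}"
      have "norm (of_real s * z) < 1" using s z by (simp add: norm_mult) (smt (verit) mult_left_le_one_le norm_ge_zero)
      hence "(\<lambda>n. w s * (pochhammer a n / fact n * (of_real s * z) ^ n)) sums (w s * (1 - of_real s * z) powr (- a))"
        by (intro sums_mult binomial_sums)
      thus "(\<lambda>k. \<Sum>n<k. w s * (u n * of_real s ^ n)) \<longlonglongrightarrow> w s * (1 - of_real s * z) powr (- a)"
        unfolding sums_def u_def binomial_eq_hyp_coeff by (simp add: power_mult_distrib mult_ac)
    qed
    have "(\<lambda>n. Gamma b * Gamma (c - b) * (hyp_coeff a b c n * z ^ n)) sums (Gamma b * Gamma (c - b) * reg_hyp2f1_series a b c z)"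
      by (intro sums_mult hyp_coeff_sums z)
    thus "(\<lambda>k. \<Sum>n<k. u n * Beta (b + of_nat n) (c - b)) \<longlonglongrightarrow> Gamma b * Gamma (c - b) * reg_hyp2f1_series a b c z"
      unfolding sums_def Beta .
  qed
  thus ?thesis unfolding euler_integral_def w_def by (rule integral_unique)
qed

text \<open>The property behind the choice in \<open>reg_hyp2f1\<close>. Exhibiting one such
  function settles existence, and by the identity theorem any such function equals
  \<open>reg_hyp2f1\<close> on the cut plane.\<close>

definition hyp_continuation :: "complex \<Rightarrow> complex \<Rightarrow> complex \<Rightarrow> (complex \<Rightarrow> complex) \<Rightarrow> bool" where
  "hyp_continuation a b c f \<longleftrightarrow> f holomorphic_on cut_plane \<and> (\<forall>z\<in>ball 0 1. f z = reg_hyp2f1_series a b c z)"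

lemma hyp_continuation_euler:
  assumes "Re b > 0" "Re c > Re b"
  shows "hyp_continuation a b c (\<lambda>z. euler_integral a b c z / (Gamma b * Gamma (c - b)))"
proof -
  have "Gamma b \<noteq> 0" "Gamma (c - b) \<noteq> 0"
    using Re_pos_notin_nonpos_Ints[of b] Re_pos_notin_nonpos_Ints[of "c - b"] assms by (auto simp: Gamma_eq_zero_iff)
  thus ?thesis unfolding hyp_continuation_def
    using euler_integral_series[OF assms, of _ a] euler_integral_holomorphic[OF assms, of a]
    by (auto intro!: holomorphic_intros)
qed

text \<open>The operator on the left multiplies the n-th coefficient by \<open>c + n\<close>, and
  \<open>(c + n) * rGamma (c + n + 1) = rGamma (c + n)\<close>.\<close>

lemma hyp_fps_lower_c:
  "fps_X * fps_deriv (hyp_fps a b (c + 1)) + fps_const c * hyp_fps a b (c + 1) = hyp_fps a b c"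
proof (rule fps_ext)
  fix n
  have "fps_nth (fps_X * fps_deriv (hyp_fps a b (c + 1)) + fps_const c * hyp_fps a b (c + 1)) n = (c + of_nat n) * hyp_coeff a b (c + 1) n"
    by (cases n) (simp_all add: hyp_fps_def algebra_simps)
  also have "\<dots> = hyp_coeff a b c n"
    using rGamma_plus1[of "c + of_nat n"] by (simp add: hyp_coeff_def add_ac)
  finally show "fps_nth (fps_X * fps_deriv (hyp_fps a b (c + 1)) + fps_const c * hyp_fps a b (c + 1)) n = fps_nth (hyp_fps a b c) n"
    by (simp add: hyp_fps_def)
qed

lemma hyp_fps_lower_b:
  "fps_X * (1 - fps_X) * fps_deriv (hyp_fps a (b + 1) c) + (fps_const (c - b - 1) - fps_const a * fps_X) * hyp_fps a (b + 1) c
     = fps_const (c - b - 1) * hyp_fps a b c"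
  (is "?L = ?R")
proof (rule fps_ext)
  fix n
  define u where "u = hyp_coeff a (b + 1) c"
  have L: "?L = fps_X * fps_deriv (Abs_fps u) - fps_X * (fps_X * fps_deriv (Abs_fps u))
      + fps_const (c - b - 1) * Abs_fps u - fps_const a * (fps_X * Abs_fps u)"
    by (simp add: u_def hyp_fps_def algebra_simps)
  show "fps_nth ?L n = fps_nth ?R n"
  proof (cases n)
    case 0
    thus ?thesis unfolding L by (simp add: hyp_fps_def u_def hyp_coeff_def)
  next
    case (Suc m)
    have "fps_nth ?L n = of_nat (Suc m) * u (Suc m) - of_nat m * u m + (c - b - 1) * u (Suc m) - a * u m"
      unfolding L by (cases m) (simp_all add: Suc)
    also have "\<dots> = (of_nat (Suc m) + c - b - 1) * u (Suc m) - (of_nat m + a) * u m"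
      by (simp add: algebra_simps)
    also have "\<dots> = (c - b - 1) * hyp_coeff a b c (Suc m)"
    proof -
      \<comment> \<open>The common factor of the three coefficients involved; once it is taken out,
        a polynomial identity in \<open>m\<close> remains.\<close>
      define q where "q = pochhammer a (Suc m) * pochhammer (b + 1) m * rGamma (c + of_nat (Suc m)) / fact (Suc m)"
      have "rGamma (c + of_nat m) = (c + of_nat m) * rGamma (c + of_nat (Suc m))"
        using rGamma_plus1[of "c + of_nat m"] by (simp add: add_ac)
      hence "(of_nat m + a) * u m = of_nat (Suc m) * (c + of_nat m) * q"
        unfolding u_def hyp_coeff_def q_def fact_Suc pochhammer_Suc
        by (simp add: divide_simps del: of_nat_Suc)
      moreover have "u (Suc m) = (b + 1 + of_nat m) * q"
        unfolding u_def hyp_coeff_def q_def by (simp add: pochhammer_Suc mult_ac)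
      moreover have "hyp_coeff a b c (Suc m) = b * q"
        unfolding hyp_coeff_def q_def by (simp add: pochhammer_rec mult_ac)
      ultimately show ?thesis by (simp add: algebra_simps)
    qed
    also have "\<dots> = fps_nth ?R n" by (simp add: hyp_fps_def Suc)
    finally show ?thesis .
  qed
qed

lemma less_hyp_fps_conv_radius:
  assumes "norm z < 1"
  shows "ereal (norm z) < fps_conv_radius (hyp_fps a b c)"
    and "ereal (norm z) < fps_conv_radius (fps_deriv (hyp_fps a b c))"
    and "ereal (norm z) < fps_conv_radius (fps_deriv (fps_deriv (hyp_fps a b c)))"
proof -
  have "ereal (norm z) < 1" using assms by simp
  also note hyp_fps_conv_radius
  finally show 1: "ereal (norm z) < fps_conv_radius (hyp_fps a b c)" .
  also note fps_conv_radius_deriv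
  finally show 2: "ereal (norm z) < fps_conv_radius (fps_deriv (hyp_fps a b c))" .
  also note fps_conv_radius_deriv
  finally show "ereal (norm z) < fps_conv_radius (fps_deriv (fps_deriv (hyp_fps a b c)))" .
qed

lemma hyp_continuation_derivs:
  assumes "hyp_continuation a b c f" "norm z < 1"
  shows "f z = eval_fps (hyp_fps a b c) z"
    and "deriv f z = eval_fps (fps_deriv (hyp_fps a b c)) z"
    and "deriv (deriv f) z = eval_fps (fps_deriv (fps_deriv (hyp_fps a b c))) z"
proof -
  have ev: "eventually (\<lambda>w. w \<in> ball 0 1) (nhds z)" if "norm z < 1" for z :: complex
    using that by (intro eventually_nhds_in_open) auto
  have 0: "f z = eval_fps (hyp_fps a b c) z" if "norm z < 1" for z
    using assms(1) that by (simp add: hyp_continuation_def eval_hyp_fps)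
  have 1: "deriv f z = eval_fps (fps_deriv (hyp_fps a b c)) z" if z: "norm z < 1" for z
  proof -
    have "deriv f z = deriv (eval_fps (hyp_fps a b c)) z"
      by (intro deriv_cong_ev eventually_mono[OF ev[OF z]]) (simp_all add: 0)
    also have "\<dots> = eval_fps (fps_deriv (hyp_fps a b c)) z"
      by (intro DERIV_imp_deriv has_field_derivative_eval_fps less_hyp_fps_conv_radius z)
    finally show ?thesis .
  qed
  show "f z = eval_fps (hyp_fps a b c) z" "deriv f z = eval_fps (fps_deriv (hyp_fps a b c)) z"
    using 0 1 assms(2) by auto
  have "deriv (deriv f) z = deriv (eval_fps (fps_deriv (hyp_fps a b c))) z"
    by (intro deriv_cong_ev eventually_mono[OF ev[OF assms(2)]]) (simp_all add: 1)
  also have "\<dots> = eval_fps (fps_deriv (fps_deriv (hyp_fps a b c))) z"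
    by (intro DERIV_imp_deriv has_field_derivative_eval_fps less_hyp_fps_conv_radius assms)
  finally show "deriv (deriv f) z = eval_fps (fps_deriv (fps_deriv (hyp_fps a b c))) z" .
qed

lemma less_conv_radius_intros:
  fixes f g :: "complex fps"
  assumes "ereal r < fps_conv_radius f" "ereal r < fps_conv_radius g"
  shows "ereal r < fps_conv_radius (f * g)" "ereal r < fps_conv_radius (f + g)" "ereal r < fps_conv_radius (f - g)"
  using assms fps_conv_radius_mult[of f g] fps_conv_radius_add[of f g] fps_conv_radius_diff[of f g]
  by (auto simp: min_def split: if_splits intro: less_le_trans)

lemmas eval_hyp_simps = eval_fps_add eval_fps_diff eval_fps_mult less_conv_radius_intros less_hyp_fps_conv_radius

text \<open>These two contiguous relations reduce the existence of the continuation to the range of parameters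
  in which Euler's integral converges.\<close>

lemma hyp_continuation_lower_c:
  assumes "hyp_continuation a b (c + 1) f"
  shows "hyp_continuation a b c (\<lambda>z. z * deriv f z + c * f z)"
  unfolding hyp_continuation_def
proof (intro conjI ballI)
  show "(\<lambda>z. z * deriv f z + c * f z) holomorphic_on cut_plane"
    using assms open_cut_plane by (auto simp: hyp_continuation_def intro!: holomorphic_intros)
  fix z :: complex assume "z \<in> ball 0 1"
  hence z: "norm z < 1" by simp
  have "z * deriv f z + c * f z =
      eval_fps (fps_X * fps_deriv (hyp_fps a b (c + 1)) + fps_const c * hyp_fps a b (c + 1)) z"
    unfolding hyp_continuation_derivs[OF assms z] using z by (simp add: eval_hyp_simps)
  thus "z * deriv f z + c * f z = reg_hyp2f1_series a b c z"
    unfolding hyp_fps_lower_c eval_hyp_fps[OF z] .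
qed

lemma hyp_continuation_lower_b:
  assumes "hyp_continuation a (b + 1) c f" "c - b - 1 \<noteq> 0"
  shows "hyp_continuation a b c (\<lambda>z. (z * (1 - z) * deriv f z + (c - b - 1 - a * z) * f z) / (c - b - 1))"
  unfolding hyp_continuation_def
proof (intro conjI ballI)
  show "(\<lambda>z. (z * (1 - z) * deriv f z + (c - b - 1 - a * z) * f z) / (c - b - 1)) holomorphic_on cut_plane"
    using assms open_cut_plane by (auto simp: hyp_continuation_def intro!: holomorphic_intros)
  fix z :: complex assume "z \<in> ball 0 1"
  hence z: "norm z < 1" by simp
  have "z * (1 - z) * deriv f z + (c - b - 1 - a * z) * f z =
      eval_fps (fps_X * (1 - fps_X) * fps_deriv (hyp_fps a (b + 1) c) + (fps_const (c - b - 1) - fps_const a * fps_X) * hyp_fps a (b + 1) c) z"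
    unfolding hyp_continuation_derivs[OF assms(1) z] using z by (simp add: eval_hyp_simps)
  also have "\<dots> = (c - b - 1) * reg_hyp2f1_series a b c z"
    unfolding hyp_fps_lower_b using z by (simp add: eval_hyp_simps eval_hyp_fps)
  finally show "(z * (1 - z) * deriv f z + (c - b - 1 - a * z) * f z) / (c - b - 1) = reg_hyp2f1_series a b c z"
    using assms(2) by simp
qed

text \<open>Descends from \<open>b + m\<close>, where Euler's integral converges, to
  \<open>b\<close>. The second condition keeps the divisor \<open>c - b - 1\<close> of the
  contiguous relation away from 0 in each step.\<close>

lemma hyp_continuation_exists_small_b:
  assumes "Re b + real m > 0" "Re c > Re b + real m"
  shows "\<exists>f. hyp_continuation a b c f"
  using assms
proof (induction m arbitrary: b)
  case 0
  thus ?case using hyp_continuation_euler[of b c a] by auto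
next
  case (Suc m)
  have "\<exists>f. hyp_continuation a (b + 1) c f" using Suc.prems by (intro Suc.IH) auto
  then obtain f where f: "hyp_continuation a (b + 1) c f" by blast
  have "Re (c - b - 1) > 0" using Suc.prems by simp
  hence "c - b - 1 \<noteq> 0" by (metis less_irrefl zero_complex.sel(1))
  thus ?case using hyp_continuation_lower_b[OF f] by blast
qed

text \<open>The parameter \<open>c\<close> is raised by \<open>k\<close> until the descent in
  \<open>b\<close> is possible, and lowered again afterwards; the relation that lowers
  \<open>c\<close> contains no division.\<close>

lemma hyp_continuation_exists: "\<exists>f. hyp_continuation a b c f"
proof -
  have lower: "\<exists>f. hyp_continuation a b c f" if "\<exists>f. hyp_continuation a b (c + of_nat k) f" for k c
    using that
  proof (induction k arbitrary: c)
    case (Suc k)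
    hence "\<exists>f. hyp_continuation a b (c + 1) f" using Suc.IH[of "c + 1"] by (simp add: add_ac)
    thus ?case using hyp_continuation_lower_c by blast
  qed simp
  obtain m where m: "real m > - Re b" using reals_Archimedean2 by blast
  obtain k where k: "real k > Re b + real m - Re c" using reals_Archimedean2 by blast
  have "\<exists>f. hyp_continuation a b (c + of_nat k) f"
    by (rule hyp_continuation_exists_small_b[of b m]) (use m k in simp_all)
  thus ?thesis by (rule lower)
qed

lemma hyp_continuation_reg_hyp2f1: "hyp_continuation a b c (reg_hyp2f1 a b c)"
  using someI_ex[OF hyp_continuation_exists[of a b c]]
  unfolding hyp_continuation_def reg_hyp2f1_def cut_plane_def .

lemma reg_hyp2f1_holomorphic: "reg_hyp2f1 a b c holomorphic_on cut_plane"
  using hyp_continuation_reg_hyp2f1 by (simp add: hyp_continuation_def)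

lemma reg_hyp2f1_eq_series: "norm z < 1 \<Longrightarrow> reg_hyp2f1 a b c z = reg_hyp2f1_series a b c z"
  using hyp_continuation_reg_hyp2f1 by (simp add: hyp_continuation_def)

lemma hyp_continuation_unique:
  assumes "hyp_continuation a b c f" "z \<in> cut_plane"
  shows "f z = reg_hyp2f1 a b c z"
proof (rule analytic_continuation_open[of "ball 0 1" cut_plane f "reg_hyp2f1 a b c"])
  show "f w = reg_hyp2f1 a b c w" if "w \<in> ball 0 1" for w
    using that assms(1) by (simp add: hyp_continuation_def reg_hyp2f1_eq_series)
qed (use assms open_cut_plane connected_cut_plane ball_subset_cut_plane reg_hyp2f1_holomorphic in
      \<open>auto simp: hyp_continuation_def\<close>)

lemma reg_hyp2f1_commute: "reg_hyp2f1 a b c = reg_hyp2f1 b a c"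
proof -
  have "reg_hyp2f1_series a b c = reg_hyp2f1_series b a c"
    by (simp add: fun_eq_iff reg_hyp2f1_series_def mult_ac)
  thus ?thesis by (simp add: reg_hyp2f1_def)
qed

lemma reg_hyp2f1_0: "reg_hyp2f1 a b c 0 = rGamma c"
  using eval_hyp_fps[of 0 a b c] by (simp add: reg_hyp2f1_eq_series eval_fps_at_0 hyp_fps_def hyp_coeff_def)

lemma reg_hyp2f1_euler_integral:
  assumes "Re b > 0" "Re c > Re b" "z \<in> cut_plane"
  shows "Gamma b * Gamma (c - b) * reg_hyp2f1 a b c z = euler_integral a b c z"
proof -
  have "Gamma b \<noteq> 0" "Gamma (c - b) \<noteq> 0"
    using Re_pos_notin_nonpos_Ints[of b] Re_pos_notin_nonpos_Ints[of "c - b"] assms by (auto simp: Gamma_eq_zero_iff)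
  thus ?thesis using hyp_continuation_unique[OF hyp_continuation_euler[OF assms(1,2)] assms(3), of a]
    by (simp add: field_simps)
qed

text \<open>Computed for an arbitrary series, because the recurrence serves twice: for the equation
  satisfied by \<open>hyp_fps\<close> and for the uniqueness of its solutions.\<close>

lemma hyp_fps_operator_nth:
  fixes F :: "complex fps"
  shows "fps_nth (fps_X * (1 - fps_X) * fps_deriv (fps_deriv F) +
     (fps_const c - fps_const (a + b + 1) * fps_X) * fps_deriv F - fps_const (a * b) * F) n =
       (c + of_nat n) * of_nat (Suc n) * fps_nth F (Suc n) - (a + of_nat n) * (b + of_nat n) * fps_nth F n"
  (is "fps_nth ?L n = _")
proof -
  have L: "?L = fps_X * fps_deriv (fps_deriv F) - fps_X * (fps_X * fps_deriv (fps_deriv F))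
      + fps_const c * fps_deriv F - fps_const (a + b + 1) * (fps_X * fps_deriv F) - fps_const (a * b) * F"
    by (simp add: algebra_simps)
  have "fps_nth ?L n = of_nat n * of_nat (Suc n) * fps_nth F (Suc n) - of_nat n * (of_nat n - 1) * fps_nth F n
      + c * of_nat (Suc n) * fps_nth F (Suc n) - (a + b + 1) * of_nat n * fps_nth F n - a * b * fps_nth F n"
    unfolding L by (cases n; cases "n - 1") (simp_all add: algebra_simps)
  thus ?thesis by (simp add: algebra_simps)
qed

lemma hyp_fps_ode:
  "fps_X * (1 - fps_X) * fps_deriv (fps_deriv (hyp_fps a b c)) +
     (fps_const c - fps_const (a + b + 1) * fps_X) * fps_deriv (hyp_fps a b c) - fps_const (a * b) * hyp_fps a b c = 0"
  (is "?L = 0")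
proof (rule fps_ext)
  fix n
  have "(c + of_nat n) * of_nat (Suc n) * fps_nth (hyp_fps a b c) (Suc n) - (a + of_nat n) * (b + of_nat n) * fps_nth (hyp_fps a b c) n = 0"
    using hyp_coeff_Suc[of c n a b] by (simp add: hyp_fps_def)
  thus "fps_nth ?L n = fps_nth 0 n"
    unfolding hyp_fps_operator_nth by simp
qed

text \<open>Extended from the disc to the whole cut plane because the argument \<open>H u\<close> in
  \<open>legendre_P_joukowski\<close> is unbounded.\<close>

lemma reg_hyp2f1_ode:
  assumes "z \<in> cut_plane"
  shows "z * (1 - z) * deriv (deriv (reg_hyp2f1 a b c)) z + (c - (a + b + 1) * z) * deriv (reg_hyp2f1 a b c) z
           - a * b * reg_hyp2f1 a b c z = 0"
proof -
  define f where "f = reg_hyp2f1 a b c"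
  have f: "f holomorphic_on cut_plane" unfolding f_def by (rule reg_hyp2f1_holomorphic)
  have "z * (1 - z) * deriv (deriv f) z + (c - (a + b + 1) * z) * deriv f z - a * b * f z = 0"
  proof (rule analytic_continuation_open[of "ball 0 1" cut_plane
      "\<lambda>z. z * (1 - z) * deriv (deriv f) z + (c - (a + b + 1) * z) * deriv f z - a * b * f z" "\<lambda>_. 0"])
  show "(\<lambda>z. z * (1 - z) * deriv (deriv f) z + (c - (a + b + 1) * z) * deriv f z - a * b * f z) holomorphic_on cut_plane"
    by (intro holomorphic_intros f holomorphic_deriv open_cut_plane)
  fix w :: complex assume "w \<in> ball 0 1"
  hence w: "norm w < 1" by simp
  have "w * (1 - w) * deriv (deriv f) w + (c - (a + b + 1) * w) * deriv f w - a * b * f w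
     = eval_fps (fps_X * (1 - fps_X) * fps_deriv (fps_deriv (hyp_fps a b c)) +
     (fps_const c - fps_const (a + b + 1) * fps_X) * fps_deriv (hyp_fps a b c) - fps_const (a * b) * hyp_fps a b c) w"
    unfolding f_def hyp_continuation_derivs[OF hyp_continuation_reg_hyp2f1 w] using w
    by (simp add: eval_hyp_simps)
  thus "w * (1 - w) * deriv (deriv f) w + (c - (a + b + 1) * w) * deriv f w - a * b * f w = 0"
    by (simp add: hyp_fps_ode)
qed (use open_cut_plane connected_cut_plane ball_subset_cut_plane assms in auto)
  thus ?thesis by (simp add: f_def)
qed

subsection \<open>The hypergeometric equation and its transformations\<close>

text \<open>As \<open>c + n\<close> never vanishes, the recurrence determines all Taylor
  coefficients from the value at 0. This is the common tool for the transformations: check the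
  equation for one side and compare values at 0.\<close>

lemma hyp_ode_unique:
  fixes g g1 g2 :: "complex \<Rightarrow> complex"
  assumes r: "r \<le> 1" and c: "c \<notin> \<int>\<^sub>\<le>\<^sub>0"
    and d1: "\<And>z. z \<in> ball 0 r \<Longrightarrow> (g has_field_derivative g1 z) (at z)"
    and d2: "\<And>z. z \<in> ball 0 r \<Longrightarrow> (g1 has_field_derivative g2 z) (at z)"
    and ode: "\<And>z. z \<in> ball 0 r \<Longrightarrow> z * (1 - z) * g2 z + (c - (a + b + 1) * z) * g1 z - a * b * g z = 0"
    and z: "z \<in> ball 0 r"
  shows "g z = g 0 * Gamma c * reg_hyp2f1 a b c z"
proof -
  have "0 < r" using z by (auto intro: le_less_trans[OF norm_ge_zero])
  have hol: "g holomorphic_on ball 0 r" unfolding holomorphic_on_open[OF open_ball] using d1 by blast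
  define G where "G = fps_expansion g 0"
  have G: "g has_fps_expansion G" unfolding G_def
    using hol \<open>0 < r\<close> by (intro has_fps_expansion_fps_expansion) auto
  have ev: "eventually (\<lambda>w. w \<in> ball 0 r) (nhds w)" if "w \<in> ball 0 r" for w :: complex
    using that by (intro eventually_nhds_in_open) auto
  have D1: "deriv g w = g1 w" if "w \<in> ball 0 r" for w using d1[OF that] by (rule DERIV_imp_deriv)
  have D2: "deriv (deriv g) w = g2 w" if w: "w \<in> ball 0 r" for w
  proof -
    have "deriv (deriv g) w = deriv g1 w" by (intro deriv_cong_ev eventually_mono[OF ev[OF w]] D1 refl)
    thus ?thesis using DERIV_imp_deriv[OF d2[OF w]] by simp
  qed
  define L where "L = fps_X * (1 - fps_X) * fps_deriv (fps_deriv G) +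
     (fps_const c - fps_const (a + b + 1) * fps_X) * fps_deriv G - fps_const (a * b) * G"
  define l where "l = (\<lambda>z. z * (1 - z) * deriv (deriv g) z + (c - (a + b + 1) * z) * deriv g z - a * b * g z)"
  have 1: "l has_fps_expansion L"
    unfolding l_def L_def by (intro fps_expansion_intros G)
  have "eventually (\<lambda>w. l w = 0) (nhds 0)"
  proof (rule eventually_mono[OF ev[of 0]])
    fix w :: complex assume w: "w \<in> ball 0 r"
    show "l w = 0" using ode[OF w] by (simp add: l_def D1[OF w] D2[OF w])
  qed (use \<open>0 < r\<close> in simp)
  hence "l has_fps_expansion 0" by (simp add: has_fps_expansion_0_iff)
  hence "L = 0" using 1 fps_expansion_unique_complex by blast
  have rec: "(c + of_nat n) * of_nat (Suc n) * fps_nth G (Suc n) = (a + of_nat n) * (b + of_nat n) * fps_nth G n" for n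
  proof -
    have "fps_nth L n = (c + of_nat n) * of_nat (Suc n) * fps_nth G (Suc n) - (a + of_nat n) * (b + of_nat n) * fps_nth G n"
      unfolding L_def by (rule hyp_fps_operator_nth)
    thus ?thesis using \<open>L = 0\<close> by simp
  qed
  have cn: "c + of_nat n \<noteq> 0" for n
    using c by (metis add_eq_0_iff2 minus_of_nat_in_nonpos_Ints of_int_of_nat_eq of_nat_0_le_iff nonpos_Ints_of_int)
  have Gn: "fps_nth G n = g 0 * Gamma c * hyp_coeff a b c n" for n
  proof (induction n)
    case 0
    have "fps_nth G 0 = g 0" using has_fps_expansion_imp_0_eq_fps_nth_0[OF G] by simp
    thus ?case using c by (simp add: hyp_coeff_def rGamma_inverse_Gamma Gamma_eq_zero_iff)
  next
    case (Suc n)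
    have "(c + of_nat n) * of_nat (Suc n) * fps_nth G (Suc n) =
        (c + of_nat n) * of_nat (Suc n) * (g 0 * Gamma c * hyp_coeff a b c (Suc n))"
      unfolding rec Suc using hyp_coeff_Suc[of c n a b] by (simp only: mult_ac)
    moreover have "(c + of_nat n) * of_nat (Suc n) \<noteq> 0" using cn[of n] by (simp del: of_nat_Suc)
    ultimately show ?case by simp
  qed
  have z1: "norm z < 1" "norm z < r" using z r by auto
  have "g z = eval_fps G z" using has_fps_expansion_imp_eval_fps_eq[OF G z1(2) hol] by simp
  also have "G = fps_const (g 0 * Gamma c) * hyp_fps a b c"
    by (rule fps_ext) (simp add: Gn hyp_fps_def)
  also have "eval_fps \<dots> z = g 0 * Gamma c * reg_hyp2f1 a b c z"
    using z1 by (simp add: eval_hyp_simps eval_hyp_fps reg_hyp2f1_eq_series)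
  finally show ?thesis .
qed

lemma reg_hyp2f1_derivs:
  assumes "z \<in> cut_plane"
  shows "(reg_hyp2f1 a b c has_field_derivative deriv (reg_hyp2f1 a b c) z) (at z)"
    and "(deriv (reg_hyp2f1 a b c) has_field_derivative deriv (deriv (reg_hyp2f1 a b c)) z) (at z)"
  using assms reg_hyp2f1_holomorphic open_cut_plane by (auto intro!: holomorphic_derivI holomorphic_deriv)

lemma Re_one_minus_pos: "norm z < 1 \<Longrightarrow> Re (1 - z) > 0"
  using complex_Re_le_cmod[of z] by simp

lemma notin_nonpos_Reals_Re_pos: "Re z > 0 \<Longrightarrow> z \<notin> \<real>\<^sub>\<le>\<^sub>0"
  by (auto simp: complex_nonpos_Reals_iff)

lemma one_minus_notin_nonpos_Reals_iff: "1 - z \<notin> \<real>\<^sub>\<le>\<^sub>0 \<longleftrightarrow> z \<in> cut_plane"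
  by (auto simp: complex_nonpos_Reals_iff cut_plane_iff)

text \<open>The right side solves the equation with parameters \<open>a\<close>, \<open>b\<close>,
  \<open>c\<close> and has the value \<open>rGamma c\<close> at 0, so the sides agree on the disc
  and then on the cut plane.\<close>

theorem euler_transformation:
  assumes c: "c \<notin> \<int>\<^sub>\<le>\<^sub>0" and z: "z \<in> cut_plane"
  shows "reg_hyp2f1 a b c z = (1 - z) powr (c - a - b) * reg_hyp2f1 (c - a) (c - b) c z"
proof -
  define p T T1 T2 where "p = c - a - b" and "T = reg_hyp2f1 (c - a) (c - b) c" and "T1 = deriv T" and "T2 = deriv T1"
  define g g1 g2 where "g = (\<lambda>z. (1 - z) powr p * T z)"
    and "g1 = (\<lambda>z. (1 - z) powr p * T1 z - p * (1 - z) powr (p - 1) * T z)"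
    and "g2 = (\<lambda>z. (1 - z) powr p * T2 z - 2 * p * (1 - z) powr (p - 1) * T1 z + p * (p - 1) * (1 - z) powr (p - 2) * T z)"
  have dT: "(T has_field_derivative T1 z) (at z)" "(T1 has_field_derivative T2 z) (at z)" if "z \<in> cut_plane" for z
    unfolding T_def T1_def T2_def using that by (rule reg_hyp2f1_derivs)+
  have g_ball: "g z = reg_hyp2f1 a b c z" if z: "z \<in> ball 0 1" for z
  proof -
    have "g z = g 0 * Gamma c * reg_hyp2f1 a b c z"
    proof (rule hyp_ode_unique[where g = g and ?g1.0 = g1 and ?g2.0 = g2 and r = 1])
      fix z :: complex assume "z \<in> ball 0 1"
      hence z: "z \<in> cut_plane" and nz: "1 - z \<noteq> 0" and n: "1 - z \<notin> \<real>\<^sub>\<le>\<^sub>0"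
        using ball_subset_cut_plane Re_one_minus_pos[of z] notin_nonpos_Reals_Re_pos[of "1 - z"] by auto
      show "(g has_field_derivative g1 z) (at z)"
        unfolding g_def g1_def using n by (auto intro!: derivative_eq_intros dT z simp: algebra_simps)
      show "(g1 has_field_derivative g2 z) (at z)"
        unfolding g1_def g2_def using n by (auto intro!: derivative_eq_intros dT z simp: algebra_simps)
      \<comment> \<open>All powers become multiples of the lowest one, which leaves a polynomial
        identity: the operator applied to \<open>g\<close> is \<open>(1 - z) powr p\<close> times
        the operator with parameters \<open>c - a\<close>, \<open>c - b\<close> applied to
        \<open>T\<close>.\<close>
      define P where "P = (1 - z) powr (p - 2)"
      have P1: "(1 - z) powr (p - 1) = (1 - z) * P"
        using nz powr_add[of "1 - z" 1 "p - 2"] by (simp add: P_def)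
      have P0: "(1 - z) powr p = (1 - z)\<^sup>2 * P"
        using nz powr_add[of "1 - z" 1 "p - 1"] P1 by (simp add: power2_eq_square)
      have cp: "c = p + a + b" by (simp add: p_def)
      have ode: "z * (1 - z) * T2 z + (c - ((c - a) + (c - b) + 1) * z) * T1 z - (c - a) * (c - b) * T z = 0"
        unfolding T_def T1_def T2_def using reg_hyp2f1_ode[OF z] .
      have "z * (1 - z) * g2 z + (c - (a + b + 1) * z) * g1 z - a * b * g z =
          P * (1 - z)\<^sup>2 * (z * (1 - z) * T2 z + (c - ((c - a) + (c - b) + 1) * z) * T1 z - (c - a) * (c - b) * T z)"
        unfolding g_def g1_def g2_def P0 P1 P_def[symmetric] cp
        by (simp add: algebra_simps power2_eq_square)
      thus "z * (1 - z) * g2 z + (c - (a + b + 1) * z) * g1 z - a * b * g z = 0"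
        unfolding ode by simp
    qed (use c z in auto)
    also have "g 0 = rGamma c" by (simp add: g_def T_def reg_hyp2f1_0)
    finally show ?thesis using c by (simp add: rGamma_inverse_Gamma Gamma_eq_zero_iff)
  qed
  have "g z = reg_hyp2f1 a b c z"
  proof (rule hyp_continuation_unique[OF _ z])
    have "T holomorphic_on cut_plane" unfolding T_def by (rule reg_hyp2f1_holomorphic)
    hence "g holomorphic_on cut_plane"
      unfolding g_def by (intro holomorphic_intros) (simp_all add: one_minus_notin_nonpos_Reals_iff)
    thus "hyp_continuation a b c g"
      using g_ball by (simp add: hyp_continuation_def reg_hyp2f1_eq_series)
  qed
  thus ?thesis by (simp add: g_def T_def p_def)
qed

lemma Re_csqrt_pos:
  assumes "z \<notin> \<real>\<^sub>\<le>\<^sub>0"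
  shows "Re (csqrt z) > 0"
proof (rule ccontr)
  assume "\<not> Re (csqrt z) > 0"
  hence "Re (csqrt z) = 0" using Re_csqrt[of z] by simp
  hence "csqrt z = \<i> * of_real (Im (csqrt z))" by (simp add: complex_eq_iff)
  hence "z = - of_real ((Im (csqrt z))\<^sup>2)"
    by (metis power2_csqrt power_mult_distrib power2_i mult_minus1 of_real_power)
  thus False using assms by (metis complex_nonpos_Reals_iff Im_complex_of_real Re_complex_of_real
      neg_le_0_iff_le of_real_minus zero_le_power2)
qed

lemma DERIV_csqrt_one_minus:
  assumes "z \<in> cut_plane"
  shows "((\<lambda>z. csqrt (1 - z)) has_field_derivative - 1 / (2 * csqrt (1 - z))) (at z)"
proof -
  have "1 - z \<notin> \<real>\<^sub>\<le>\<^sub>0" using assms by (simp add: one_minus_notin_nonpos_Reals_iff)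
  thus ?thesis by (auto intro!: derivative_eq_intros simp: field_simps)
qed

text \<open>Classically \<open>F(2a, 2b; a+b+1/2; z) = F(a, b; a+b+1/2; 4z(1-z))\<close>. It is
  written through the root \<open>z\<close> of \<open>4z(1-z) = Y\<close> that vanishes at
  \<open>Y = 0\<close>, so that uniqueness can be applied in the variable \<open>Y\<close>.\<close>

theorem quadratic_transformation:
  assumes c: "a + b + 1/2 \<notin> \<int>\<^sub>\<le>\<^sub>0" and Y: "norm Y < 1"
  shows "reg_hyp2f1 (2 * a) (2 * b) (a + b + 1/2) ((1 - csqrt (1 - Y)) / 2) = reg_hyp2f1 a b (a + b + 1/2) Y"
proof -
  define c' where "c' = a + b + 1/2"
  define T T1 T2 where "T = reg_hyp2f1 (2 * a) (2 * b) c'" and "T1 = deriv T" and "T2 = deriv T1"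
  define y h where "y = (\<lambda>Y. csqrt (1 - Y))" and "h = (\<lambda>Y. (1 - csqrt (1 - Y)) / 2)"
  define g g1 g2 where "g = (\<lambda>Y. T (h Y))"
    and "g1 = (\<lambda>Y. T1 (h Y) / (4 * y Y))"
    and "g2 = (\<lambda>Y. T2 (h Y) / (16 * y Y ^ 2) + T1 (h Y) / (8 * y Y ^ 3))"
  have dT: "(T has_field_derivative T1 z) (at z)" "(T1 has_field_derivative T2 z) (at z)" if "z \<in> cut_plane" for z
    unfolding T_def T1_def T2_def using that by (rule reg_hyp2f1_derivs)+
  have "g Y = g 0 * Gamma c' * reg_hyp2f1 a b c' Y"
  proof (rule hyp_ode_unique[where g = g and ?g1.0 = g1 and ?g2.0 = g2 and r = 1])
    fix Y :: complex assume "Y \<in> ball 0 1"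
    hence n: "1 - Y \<notin> \<real>\<^sub>\<le>\<^sub>0" and Y: "Y \<in> cut_plane"
      using ball_subset_cut_plane by (auto simp: one_minus_notin_nonpos_Reals_iff)
    have Re: "Re (y Y) > 0" unfolding y_def using n by (rule Re_csqrt_pos)
    hence nz: "y Y \<noteq> 0" by auto
    have hY: "h Y = (1 - y Y) / 2" by (simp add: h_def y_def)
    have hc: "h Y \<in> cut_plane" using Re by (simp add: cut_plane_iff hY)
    have dy: "(y has_field_derivative - 1 / (2 * y Y)) (at Y)"
      unfolding y_def using Y by (rule DERIV_csqrt_one_minus)
    have dh: "(h has_field_derivative 1 / (4 * y Y)) (at Y)"
    proof -
      have "h = (\<lambda>Y. (1 - y Y) / 2)" by (simp add: h_def y_def fun_eq_iff)
      moreover have "((\<lambda>Y. (1 - y Y) / 2) has_field_derivative 1 / (4 * y Y)) (at Y)"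
        by (rule dy derivative_eq_intros refl | (use nz in simp; fail))+
      ultimately show ?thesis by simp
    qed
    have dT1: "((\<lambda>Y. T1 (h Y)) has_field_derivative T2 (h Y) * (1 / (4 * y Y))) (at Y)"
      by (rule DERIV_chain2[OF dT(2)[OF hc] dh])
    show "(g has_field_derivative g1 Y) (at Y)"
      unfolding g_def g1_def using DERIV_chain2[OF dT(1)[OF hc] dh] by simp
    show "(g1 has_field_derivative g2 Y) (at Y)"
      unfolding g1_def g2_def
      by (rule dT1 dy derivative_eq_intros refl | (use nz in simp; fail))+
         (use nz in \<open>simp add: field_simps power2_eq_square power3_eq_cube\<close>)
    have YY: "Y = 1 - (y Y)\<^sup>2" by (simp add: y_def)
    have ode: "h Y * (1 - h Y) * T2 (h Y) + (c' - (2 * a + 2 * b + 1) * h Y) * T1 (h Y) - 2 * a * (2 * b) * T (h Y) = 0"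
      unfolding T_def T1_def T2_def using reg_hyp2f1_ode[OF hc] .
    \<comment> \<open>With \<open>q\<close> for \<open>csqrt (1 - Y)\<close>: the operator in
      \<open>Y\<close> is a quarter of the operator with doubled parameters in
      \<open>h Y\<close>.\<close>
    have alg: "(1 - q\<^sup>2) * (1 - (1 - q\<^sup>2)) * (t2 / (16 * q ^ 2) + t1 / (8 * q ^ 3)) + (c' - (a + b + 1) * (1 - q\<^sup>2)) * (t1 / (4 * q)) - a * b * t
      = ((1 - q) / 2 * (1 - (1 - q) / 2) * t2 + (c' - (2 * a + 2 * b + 1) * ((1 - q) / 2)) * t1 - 2 * a * (2 * b) * t) / 4"
      if "q \<noteq> 0" for q t t1 t2 :: complex
      using that unfolding c'_def by (simp add: field_simps power2_eq_square power3_eq_cube)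
    have "Y * (1 - Y) * g2 Y + (c' - (a + b + 1) * Y) * g1 Y - a * b * g Y =
      (h Y * (1 - h Y) * T2 (h Y) + (c' - (2 * a + 2 * b + 1) * h Y) * T1 (h Y) - 2 * a * (2 * b) * T (h Y)) / 4"
      using alg[OF nz, of "T2 (h Y)" "T1 (h Y)" "T (h Y)"]
      unfolding g_def g1_def g2_def YY[symmetric] hY[symmetric] .
    thus "Y * (1 - Y) * g2 Y + (c' - (a + b + 1) * Y) * g1 Y - a * b * g Y = 0" unfolding ode by simp
  qed (use assms in \<open>auto simp: c'_def\<close>)
  also have "g 0 = rGamma c'" by (simp add: g_def T_def h_def reg_hyp2f1_0)
  finally show ?thesis using c by (simp add: g_def T_def h_def c'_def rGamma_inverse_Gamma Gamma_eq_zero_iff)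
qed

text \<open>Both \<open>y\<close> and \<open>1 / y\<close> have positive real part, so the real part
  of the argument is below 1/2.\<close>

lemma joukowski_in_cut_plane:
  assumes "Re y > 0"
  shows "(2 - y - 1 / y) / 4 \<in> cut_plane"
proof -
  have "Re (1 / y) > 0" using assms by (simp add: Re_divide sum_power2_gt_zero_iff)
  thus ?thesis using assms by (simp add: cut_plane_iff)
qed

text \<open>Another quadratic transformation, proved in the variable \<open>u = 1 - v\<close>:
  multiplied by \<open>v powr (N / 2)\<close>, the left side solves the equation of
  \<open>F(-N, 1/2; 1; u)\<close> and equals 1 at \<open>u = 0\<close>.\<close>

theorem legendre_P_joukowski:
  assumes "v \<notin> \<real>\<^sub>\<le>\<^sub>0"
  shows "legendre_P N ((csqrt v + 1 / csqrt v) / 2) = v powr (- N / 2) * reg_hyp2f1 (- N) (1/2) 1 (1 - v)"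
proof -
  define p where "p = N / 2"
  define R R1 R2 where "R = reg_hyp2f1 (- N) (N + 1) 1" and "R1 = deriv R" and "R2 = deriv R1"
  define y H where "y = (\<lambda>u. csqrt (1 - u))" and "H = (\<lambda>u. (2 - y u - 1 / y u) / 4)"
  define W W' where "W = (\<lambda>u. (1 - y u ^ 2) / (8 * y u ^ 3))" and "W' = (\<lambda>u. (y u ^ 2 - 3) / (16 * y u ^ 5))"
  define g g1 g2 where "g = (\<lambda>u. (1 - u) powr p * R (H u))"
    and "g1 = (\<lambda>u. - p * (1 - u) powr (p - 1) * R (H u) - (1 - u) powr p * R1 (H u) * W u)"
    and "g2 = (\<lambda>u. p * (p - 1) * (1 - u) powr (p - 2) * R (H u) + 2 * p * (1 - u) powr (p - 1) * R1 (H u) * W u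
        + (1 - u) powr p * (R2 (H u) * (W u)\<^sup>2 + R1 (H u) * W' u))"
  have dR: "(R has_field_derivative R1 z) (at z)" "(R1 has_field_derivative R2 z) (at z)" if "z \<in> cut_plane" for z
    unfolding R_def R1_def R2_def using that by (rule reg_hyp2f1_derivs)+
  have Re: "Re (y u) > 0" if "u \<in> cut_plane" for u
    unfolding y_def using that by (intro Re_csqrt_pos) (simp add: one_minus_notin_nonpos_Reals_iff)
  have Hc: "H u \<in> cut_plane" if "u \<in> cut_plane" for u
    unfolding H_def using Re[OF that] by (rule joukowski_in_cut_plane)
  have g_ball: "g u = reg_hyp2f1 (- N) (1/2) 1 u" if u: "norm u < 1" for u
  proof -
    have "g u = g 0 * Gamma 1 * reg_hyp2f1 (- N) (1/2) 1 u"
    proof (rule hyp_ode_unique[where g = g and ?g1.0 = g1 and ?g2.0 = g2 and r = 1])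
      fix u :: complex assume "u \<in> ball 0 1"
      hence n: "1 - u \<notin> \<real>\<^sub>\<le>\<^sub>0" and u: "u \<in> cut_plane"
        using ball_subset_cut_plane by (auto simp: one_minus_notin_nonpos_Reals_iff)
      have nz: "y u \<noteq> 0" "1 - u \<noteq> 0" using Re[OF u] n by auto
      have dy: "(y has_field_derivative - 1 / (2 * y u)) (at u)"
        unfolding y_def using u by (rule DERIV_csqrt_one_minus)
      have dH: "(H has_field_derivative - W u) (at u)"
        unfolding H_def W_def
        by (rule dy derivative_eq_intros refl | (use nz in simp; fail))+
           (use nz in \<open>simp add: field_simps power2_eq_square power3_eq_cube\<close>)
      have dRH: "((\<lambda>u. R (H u)) has_field_derivative R1 (H u) * - W u) (at u)"
        by (rule DERIV_chain2[OF dR(1)[OF Hc[OF u]] dH])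
      have dR1H: "((\<lambda>u. R1 (H u)) has_field_derivative R2 (H u) * - W u) (at u)"
        by (rule DERIV_chain2[OF dR(2)[OF Hc[OF u]] dH])
      have dpw: "((\<lambda>u. (1 - u) powr q) has_field_derivative - q * (1 - u) powr (q - 1)) (at u)" for q
        using n by (auto intro!: derivative_eq_intros)
      show "(g has_field_derivative g1 u) (at u)"
        unfolding g_def g1_def
        by (rule dpw dRH derivative_eq_intros refl)+ (simp add: algebra_simps add_divide_distrib diff_divide_distrib)
      define P where "P = (1 - u) powr (p - 2)"
      have P1: "(1 - u) powr (p - 1) = y u ^ 2 * P"
        using nz powr_add[of "1 - u" 1 "p - 2"] by (simp add: P_def y_def)
      have P0: "(1 - u) powr p = y u ^ 4 * P"
      proof -
        have "(1 - u) powr p = (1 - u) * (1 - u) powr (p - 1)"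
          using nz powr_add[of "1 - u" 1 "p - 1"] by simp
        also have "\<dots> = (y u)\<^sup>2 * (y u ^ 2 * P)" unfolding P1 by (simp add: y_def)
        finally show ?thesis by (simp add: power4_eq_xxxx power2_eq_square)
      qed
      have dW: "(W has_field_derivative - W' u) (at u)"
        unfolding W_def W'_def
        by (rule dy derivative_eq_intros refl | (use nz in simp; fail))+
           (use nz in \<open>simp add: divide_simps\<close>, simp add: algebra_simps eval_nat_numeral)
      show "(g1 has_field_derivative g2 u) (at u)"
        unfolding g1_def g2_def
        by (rule dpw dRH dR1H dW derivative_eq_intros refl)+
           (simp add: algebra_simps power2_eq_square)
      have uu: "u = 1 - (y u)\<^sup>2" by (simp add: y_def)
      have ode: "H u * (1 - H u) * R2 (H u) + (1 - (- N + (N + 1) + 1) * H u) * R1 (H u) - - N * (N + 1) * R (H u) = 0"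
        unfolding R_def R1_def R2_def using reg_hyp2f1_ode[OF Hc[OF u]] .
      \<comment> \<open>The operator applied to \<open>g\<close> is a multiple of the Legendre
        operator at \<open>H u\<close>. In \<open>alg\<close> the letter \<open>q\<close> stands for
        \<open>y u\<close>, which makes this a rational identity.\<close>
      have "u * (1 - u) * g2 u + (1 - (- N + 1/2 + 1) * u) * g1 u - - N * (1/2) * g u =
        - P * (y u)\<^sup>2 * (1 - (y u)\<^sup>2) / 4 * (H u * (1 - H u) * R2 (H u) + (1 - (- N + (N + 1) + 1) * H u) * R1 (H u) - - N * (N + 1) * R (H u))"
      proof -
        have alg: "(1 - q\<^sup>2) * (1 - (1 - q\<^sup>2)) * (p * (p - 1) * P * r + 2 * p * (q ^ 2 * P) * r1 * ((1 - q ^ 2) / (8 * q ^ 3))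
            + q ^ 4 * P * (r2 * ((1 - q ^ 2) / (8 * q ^ 3))\<^sup>2 + r1 * ((q ^ 2 - 3) / (16 * q ^ 5))))
            + (1 - (- N + 1/2 + 1) * (1 - q\<^sup>2)) * (- p * (q ^ 2 * P) * r - q ^ 4 * P * r1 * ((1 - q ^ 2) / (8 * q ^ 3)))
            - - N * (1/2) * (q ^ 4 * P * r) =
          - P * q\<^sup>2 * (1 - q\<^sup>2) / 4 * ((2 - q - 1 / q) / 4 * (1 - (2 - q - 1 / q) / 4) * r2 + (1 - (- N + (N + 1) + 1) * ((2 - q - 1 / q) / 4)) * r1 - - N * (N + 1) * r)"
          if "q \<noteq> 0" for q r r1 r2 :: complex
        proof -
          have Np: "N = 2 * p" by (simp add: p_def)
          show ?thesis using that unfolding Np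
            by (simp add: divide_simps) (simp add: algebra_simps eval_nat_numeral)
        qed
        have Hu: "H u = (2 - y u - 1 / y u) / 4" by (simp add: H_def)
        show ?thesis
          using alg[OF nz(1), of "R (H u)" "R1 (H u)" "R2 (H u)"]
          unfolding g_def g1_def g2_def W_def W'_def P0 P1 P_def[symmetric] uu[symmetric] Hu[symmetric] .
      qed
      thus "u * (1 - u) * g2 u + (1 - (- N + 1/2 + 1) * u) * g1 u - - N * (1/2) * g u = 0" unfolding ode by simp
    qed (use u in auto)
    also have "g 0 = 1" by (simp add: g_def R_def H_def y_def reg_hyp2f1_0)
    finally show ?thesis by simp
  qed
  have v: "1 - v \<in> cut_plane" using assms by (simp flip: one_minus_notin_nonpos_Reals_iff)
  have "g (1 - v) = reg_hyp2f1 (- N) (1/2) 1 (1 - v)"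
  proof (rule hyp_continuation_unique[OF _ v])
    have Rh: "R holomorphic_on cut_plane" unfolding R_def by (rule reg_hyp2f1_holomorphic)
    have yh: "y holomorphic_on cut_plane"
      unfolding y_def by (intro holomorphic_intros) (simp_all add: one_minus_notin_nonpos_Reals_iff)
    have ynz: "y u \<noteq> 0" if "u \<in> cut_plane" for u using Re[OF that] by auto
    have "H holomorphic_on cut_plane" unfolding H_def by (intro holomorphic_intros yh) (use ynz in auto)
    hence "(R \<circ> H) holomorphic_on cut_plane" by (rule holomorphic_on_compose_gen[OF _ Rh]) (use Hc in auto)
    hence "(\<lambda>u. R (H u)) holomorphic_on cut_plane" by (simp add: o_def)
    hence "g holomorphic_on cut_plane"
      unfolding g_def by (intro holomorphic_intros) (simp_all add: one_minus_notin_nonpos_Reals_iff)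
    thus "hyp_continuation (- N) (1/2) 1 g"
      using g_ball by (simp add: hyp_continuation_def reg_hyp2f1_eq_series)
  qed
  moreover have "g (1 - v) = v powr (N / 2) * legendre_P N ((csqrt v + 1 / csqrt v) / 2)"
  proof -
    have Hv: "H (1 - v) = (1 - (csqrt v + 1 / csqrt v) / 2) / 2"
      by (simp add: H_def y_def add_divide_distrib diff_divide_distrib)
    show ?thesis unfolding legendre_P_def Hv[symmetric] by (simp add: g_def p_def R_def)
  qed
  moreover have "v powr (- N / 2) * v powr (N / 2) = 1"
    using assms by (auto simp flip: powr_add)
  ultimately show ?thesis by (metis mult.assoc mult_1)
qed

subsection \<open>The Legendre kernel near the endpoint\<close>

lemma norm_powr_le:
  fixes z w :: complex
  assumes "z \<noteq> 0"
  shows "norm (z powr w) \<le> exp (pi * \<bar>Im w\<bar>) * norm z powr Re w"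
proof -
  have "norm (z powr w) = exp (Re w * ln (norm z) - Im w * Im (Ln z))"
    using assms by (simp add: powr_def)
  also have "\<dots> \<le> exp (Re w * ln (norm z) + pi * \<bar>Im w\<bar>)"
  proof -
    have "- (Im w * Im (Ln z)) \<le> \<bar>Im w\<bar> * \<bar>Im (Ln z)\<bar>"
      using abs_ge_self[of "- Im w * Im (Ln z)"] by (simp add: abs_mult)
    also have "\<bar>Im w\<bar> * \<bar>Im (Ln z)\<bar> \<le> \<bar>Im w\<bar> * pi"
      using mpi_less_Im_Ln[OF assms] Im_Ln_le_pi[OF assms] by (intro mult_left_mono) auto
    finally show ?thesis by (simp add: mult.commute)
  qed
  finally have "norm (z powr w) \<le> exp (Re w * ln (norm z) + pi * \<bar>Im w\<bar>)" .
  thus ?thesis using assms by (simp add: powr_def exp_add mult.commute)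
qed

text \<open>By homogeneity \<open>p + q = 1\<close> may be assumed. The point then lies on the
  segment from 1 to \<open>w\<close>, which misses 0 because \<open>w\<close> is off the nonpositive
  axis; compactness gives a positive minimum.\<close>

lemma sector_lower_bound:
  assumes "compact K" "K \<inter> \<real>\<^sub>\<le>\<^sub>0 = {}"
  obtains k where "k > 0"
    "\<And>w p q. w \<in> K \<Longrightarrow> p \<ge> 0 \<Longrightarrow> q \<ge> 0 \<Longrightarrow> norm (complex_of_real p + of_real q * w) \<ge> k * (p + q)"
proof (cases "K = {}")
  case True thus ?thesis using that[of 1] by simp
next
  case False
  define f where "f = (\<lambda>(w, q). norm (complex_of_real (1 - q) + of_real q * w))"
  have "continuous_on (K \<times> {0..1}) f" unfolding f_def case_prod_unfold by (intro continuous_intros)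
  moreover have "compact (K \<times> {0..1::real})" by (intro compact_Times assms) auto
  ultimately obtain m where m: "m \<in> K \<times> {0..1}" "\<And>x. x \<in> K \<times> {0..1} \<Longrightarrow> f m \<le> f x"
    using continuous_attains_inf[of "K \<times> {0..1}" f] False by auto
  obtain w0 q0 where wq: "m = (w0, q0)" by (cases m)
  have "complex_of_real (1 - q0) + of_real q0 * w0 \<notin> \<real>\<^sub>\<le>\<^sub>0"
  proof -
    have "1 - w0 \<in> cut_plane" using m(1) assms(2) unfolding wq by (subst one_minus_notin_nonpos_Reals_iff[symmetric]) auto
    from one_minus_of_real_mult_notin_nonpos[OF this, of q0] m(1) show ?thesis
      unfolding wq by (simp add: algebra_simps)
  qed
  hence pos: "f m > 0" unfolding wq f_def by auto
  show ?thesis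
  proof (rule that[OF pos])
    fix w :: complex and p q :: real assume w: "w \<in> K" and pq: "p \<ge> 0" "q \<ge> 0"
    show "f m * (p + q) \<le> norm (complex_of_real p + of_real q * w)"
    proof (cases "p + q = 0")
      case False
      hence s: "p + q > 0" using pq by simp
      have "f m \<le> f (w, q / (p + q))" using s pq w by (intro m(2)) (auto simp: divide_simps)
      also have "\<dots> = norm ((complex_of_real p + of_real q * w) / of_real (p + q))"
      proof -
        have "1 - q / (p + q) = p / (p + q)" using s by (simp add: field_simps)
        thus ?thesis unfolding f_def case_prod_conv by (simp only: of_real_divide times_divide_eq_left add_divide_distrib)
      qed
      also have "\<dots> = norm (complex_of_real p + of_real q * w) / (p + q)"
        using s by (simp only: norm_divide norm_of_real abs_of_pos)
      finally show ?thesis using s by (simp add: field_simps)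
    qed (use pq in auto)
  qed
qed

text \<open>Exhibits the Euler factor as a combination of 1 and \<open>w\<close> with nonnegative
  coefficients, as \<open>sector_lower_bound\<close> requires.\<close>

lemma one_minus_mult_one_minus:
  "1 - complex_of_real s * (1 - of_real r * w) = of_real (1 - s) + of_real (s * r) * w"
  by (simp add: algebra_simps)

lemma powr_le_powr_bounded:
  fixes x p q M :: real
  assumes "0 < x" "x \<le> M" "1 \<le> M" "p \<le> q"
  shows "x powr q \<le> M powr (q - p) * x powr p"
proof -
  have "x powr q = x powr (q - p) * x powr p" using assms by (simp flip: powr_add)
  also have "\<dots> \<le> M powr (q - p) * x powr p"
    using assms by (intro mult_right_mono powr_mono2) auto
  finally show ?thesis .
qed

text \<open>A lower bound for the base controls only nonpositive powers, hence the exponent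
  \<open>q\<close>; the excess \<open>Re N - q\<close> is paid by the upper bound \<open>M\<close>
  for the base.\<close>

lemma euler_factor_estimate:
  assumes "compact K" "K \<inter> \<real>\<^sub>\<le>\<^sub>0 = {}" "q \<le> Re N" "q \<le> 0"
  obtains C where "C > 0"
    "\<And>w r s. w \<in> K \<Longrightarrow> r \<in> {0..1} \<Longrightarrow> s \<in> {0<..<1} \<Longrightarrow>
       norm ((1 - complex_of_real s * (1 - of_real r * w)) powr N) \<le> C * (1 - s + s * r) powr q"
proof -
  obtain k where k: "k > 0" "\<And>w p q. w \<in> K \<Longrightarrow> p \<ge> 0 \<Longrightarrow> q \<ge> 0 \<Longrightarrow> norm (complex_of_real p + of_real q * w) \<ge> k * (p + q)"
    using sector_lower_bound[OF assms(1,2)] by blast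
  obtain B where B: "B > 0" "\<And>w. w \<in> K \<Longrightarrow> norm w \<le> B"
    using compact_imp_bounded[OF assms(1)] unfolding bounded_pos by blast
  define M where "M = 1 + B"
  define C where "C = exp (pi * \<bar>Im N\<bar>) * (M powr (Re N - q) * k powr q)"
  show ?thesis
  proof (rule that[of C])
    show "C > 0" using k(1) B(1) by (simp add: C_def M_def)
    fix w :: complex and r s :: real assume w: "w \<in> K" and r: "r \<in> {0..1}" and s: "s \<in> {0<..<1}"
    define X where "X = 1 - complex_of_real s * (1 - of_real r * w)"
    have X: "X = of_real (1 - s) + of_real (s * r) * w" unfolding X_def by (rule one_minus_mult_one_minus)
    have sr: "0 \<le> s * r" "s * r \<le> 1" using r s by (auto intro: mult_le_one)
    have T: "1 - s + s * r > 0" using sr s by auto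
    have lower: "norm X \<ge> k * (1 - s + s * r)" unfolding X using k(2)[OF w, of "1 - s" "s * r"] sr s by auto
    hence Xpos: "norm X > 0" using k(1) T by (meson less_le_trans mult_pos_pos)
    have "norm X \<le> norm (complex_of_real (1 - s)) + norm (of_real (s * r) * w)" unfolding X by (rule norm_triangle_ineq)
    also have "\<dots> \<le> 1 + 1 * B" unfolding norm_mult norm_of_real
      using s sr B(2)[OF w] by (intro add_mono mult_mono) auto
    finally have upper: "norm X \<le> M" by (simp add: M_def)
    have "norm (X powr N) \<le> exp (pi * \<bar>Im N\<bar>) * norm X powr Re N"
      using Xpos by (intro norm_powr_le) auto
    also have "norm X powr Re N \<le> M powr (Re N - q) * (k powr q * (1 - s + s * r) powr q)"
    proof -
      have "norm X powr Re N \<le> M powr (Re N - q) * norm X powr q"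
        using Xpos upper B(1) assms(3) by (intro powr_le_powr_bounded) (auto simp: M_def)
      also have "norm X powr q \<le> (k * (1 - s + s * r)) powr q"
        using lower k(1) T assms(4) by (intro powr_mono2') auto
      also have "\<dots> = k powr q * (1 - s + s * r) powr q"
        by (rule powr_mult)
      finally show ?thesis by (simp add: mult_left_mono)
    qed
    finally show "norm ((1 - complex_of_real s * (1 - of_real r * w)) powr N) \<le> C * (1 - s + s * r) powr q"
      unfolding X_def[symmetric] C_def by (simp add: mult_ac mult_left_mono)
  qed
qed

lemma scaled_in_cut_plane:
  assumes "w \<notin> \<real>\<^sub>\<le>\<^sub>0" "r > 0"
  shows "1 - complex_of_real r * w \<in> cut_plane"
  using assms by (auto simp: cut_plane_iff complex_nonpos_Reals_iff mult_le_0_iff)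

text \<open>For \<open>N = -1/2\<close> the kernel grows logarithmically at 0, so some loss
  \<open>r powr (- e)\<close> is unavoidable. Any small \<open>e\<close> suffices for the
  integrability of the convolution.\<close>

lemma legendre_kernel_bound:
  assumes K: "compact K" "K \<inter> \<real>\<^sub>\<le>\<^sub>0 = {}" and N: "Re N \<ge> -1/2" and e: "0 < e" "e \<le> 1/2"
  obtains C where "C > 0"
    "\<And>w r. w \<in> K \<Longrightarrow> r \<in> {0<..1} \<Longrightarrow> norm (reg_hyp2f1 (- N) (1/2) 1 (1 - of_real r * w)) \<le> C * r powr (- e)"
proof -
  obtain C where C: "C > 0" "\<And>w r s. w \<in> K \<Longrightarrow> r \<in> {0..1} \<Longrightarrow> s \<in> {0<..<1} \<Longrightarrow>
       norm ((1 - complex_of_real s * (1 - of_real r * w)) powr N) \<le> C * (1 - s + s * r) powr (-1/2)"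
    using euler_factor_estimate[OF K, of "-1/2" N] N by auto
  define D where "D = integral {0<..<1::real} (\<lambda>s. s powr (1/2 - 1) * (1 - s) powr (e - 1))"
  have int: "(\<lambda>s. s powr (1/2 - 1) * (1 - s) powr (e - 1)) integrable_on {0<..<1::real}"
    using e by (intro Beta_integrable_open) auto
  have "D \<ge> 0" unfolding D_def by (intro integral_nonneg int) auto
  show ?thesis
  \<comment> \<open>The number pi is \<open>Gamma (1/2)\<close> squared, from Euler's integral; the
    summand 1 secures positivity, as only \<open>D \<ge> 0\<close> is at hand.\<close>
  proof (rule that[of "C * D / pi + 1"])
    fix w r assume w: "w \<in> K" and r: "r \<in> {0<..1::real}"
    define z where "z = 1 - complex_of_real r * w"
    let ?f = "\<lambda>s. complex_of_real s powr (1 / 2 - 1) * (1 - complex_of_real s) powr (1 - 1 / 2 - 1) * (1 - complex_of_real s * z) powr - (- N)"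
    have z: "z \<in> cut_plane" unfolding z_def using w K(2) r by (intro scaled_in_cut_plane) auto
    have "Gamma (1/2) * Gamma (1/2) * reg_hyp2f1 (- N) (1/2) 1 z = euler_integral (- N) (1/2) 1 z"
      using reg_hyp2f1_euler_integral[of "1/2" 1 z "- N"] z by simp
    hence "euler_integral (- N) (1/2) 1 z = of_real pi * reg_hyp2f1 (- N) (1/2) 1 z"
      by (simp add: Gamma_one_half_complex flip: of_real_mult)
    hence "norm (euler_integral (- N) (1/2) 1 z) = pi * norm (reg_hyp2f1 (- N) (1/2) 1 z)"
      by (simp add: norm_mult)
    moreover have "integral {0<..<1} (\<lambda>s. (C * r powr (- e)) * (s powr (1/2 - 1) * (1 - s) powr (e - 1))) = C * r powr (- e) * D"
      unfolding D_def by (rule integral_mult_right)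
    moreover have "norm (euler_integral (- N) (1/2) 1 z) \<le> integral {0<..<1} (\<lambda>s. (C * r powr (- e)) * (s powr (1/2 - 1) * (1 - s) powr (e - 1)))"
      unfolding euler_integral_def
    proof (rule integral_norm_bound_integral)
      show "?f integrable_on {0<..<1}"
        using euler_integrand_absolutely_integrable[of "1/2" 1 z "- N"] z by (intro set_lebesgue_integral_eq_integral(1)) simp
      show "(\<lambda>s. (C * r powr (- e)) * (s powr (1/2 - 1) * (1 - s) powr (e - 1))) integrable_on {0<..<1}"
        by (intro integrable_on_mult_right int)
      fix s :: real assume s: "s \<in> {0<..<1}"
      define T where "T = 1 - s + s * r"
      have T: "T \<ge> 1 - s" "T \<ge> r" "T > 0"
      proof -
        have "(1 - r) * s \<le> (1 - r) * 1" using s r by (intro mult_left_mono) auto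
        thus "T \<ge> r" by (simp add: T_def algebra_simps)
      qed (use s r in \<open>auto simp: T_def add_pos_pos\<close>)
      have "norm ((1 - complex_of_real s * z) powr N) \<le> C * T powr (-1/2)"
        unfolding z_def T_def using C(2)[OF w _ s, of r] r by auto
      \<comment> \<open>Of the two bounds, \<open>T \<ge> 1 - s\<close> is spent on integrability at
        \<open>s = 1\<close>, and \<open>T \<ge> r\<close> on the growth in
        \<open>r\<close>.\<close>
      also have "T powr (-1/2) = T powr (e - 1/2) * T powr (- e)" by (simp flip: powr_add)
      also have "\<dots> \<le> (1 - s) powr (e - 1/2) * r powr (- e)"
        using T s r e by (intro mult_mono powr_mono2') auto
      finally have *: "norm ((1 - complex_of_real s * z) powr N) \<le> C * ((1 - s) powr (e - 1/2) * r powr (- e))"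
        using C(1) by simp
      have "norm (?f s)
          = s powr (1/2 - 1) * (1 - s) powr (1/2 - 1) * norm ((1 - complex_of_real s * z) powr N)"
        using norm_Beta_integrand[OF s, of "1/2" "1 - 1/2"] by (simp add: norm_mult)
      also have "\<dots> \<le> s powr (1/2 - 1) * (1 - s) powr (1/2 - 1) * (C * ((1 - s) powr (e - 1/2) * r powr (- e)))"
        by (intro mult_left_mono *) auto
      also have "\<dots> = (C * r powr (- e)) * (s powr (1/2 - 1) * ((1 - s) powr (1/2 - 1) * (1 - s) powr (e - 1/2)))"
        by (simp only: mult_ac)
      also have "(1 - s) powr (1/2 - 1) * (1 - s) powr (e - 1/2) = (1 - s) powr (e - 1)" by (simp flip: powr_add)
      finally show "norm (?f s)
          \<le> (C * r powr (- e)) * (s powr (1/2 - 1) * (1 - s) powr (e - 1))" .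
    qed
    ultimately have "pi * norm (reg_hyp2f1 (- N) (1/2) 1 z) \<le> C * r powr (- e) * D" by metis
    hence "norm (reg_hyp2f1 (- N) (1/2) 1 z) \<le> C * D / pi * r powr (- e)"
      by (simp add: field_simps)
    also have "\<dots> \<le> (C * D / pi + 1) * r powr (- e)" by (intro mult_right_mono) auto
    finally show "norm (reg_hyp2f1 (- N) (1/2) 1 (1 - of_real r * w)) \<le> (C * D / pi + 1) * r powr (- e)" unfolding z_def .
  qed (use C(1) \<open>D \<ge> 0\<close> in \<open>auto intro!: add_nonneg_pos\<close>)
qed

text \<open>Euler's integral at the argument 1, approached along points \<open>1 - r w\<close>. The
  factor \<open>w n\<close> may vary in a compact set because the proof of divergence applies this
  along a complex segment, where the ratio moves.\<close>

lemma euler_integral_limit: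
  assumes K: "compact K" "K \<inter> \<real>\<^sub>\<le>\<^sub>0 = {}" and w: "\<And>n::nat. w n \<in> K" and b: "Re b > 0" and c: "Re c > Re b" and q: "q \<le> 0" "q \<le> Re N" "Re c - Re b + q > 0"
    and r: "\<And>n. r n \<in> {0<..1}" "r \<longlonglongrightarrow> 0"
  shows "(\<lambda>n. euler_integral (- N) b c (1 - of_real (r n) * w n)) \<longlonglongrightarrow> Beta b (c - b + N)"
proof -
  obtain C where C: "C > 0" "\<And>w r s. w \<in> K \<Longrightarrow> r \<in> {0..1} \<Longrightarrow> s \<in> {0<..<1} \<Longrightarrow>
       norm ((1 - complex_of_real s * (1 - of_real r * w)) powr N) \<le> C * (1 - s + s * r) powr q"
    using euler_factor_estimate[OF K q(2,1)] by blast
  obtain B where B: "\<And>w. w \<in> K \<Longrightarrow> norm w \<le> B"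
    using compact_imp_bounded[OF K(1)] unfolding bounded_iff by blast
  have rw: "(\<lambda>n. of_real (r n) * w n) \<longlonglongrightarrow> 0"
  proof (rule Lim_null_comparison)
    show "\<forall>\<^sub>F n in sequentially. norm (of_real (r n) * w n) \<le> r n * B"
    proof (intro always_eventually allI)
      fix n show "norm (of_real (r n) * w n) \<le> r n * B"
        using r(1)[of n] B[OF w[of n]] by (simp add: norm_mult mult_left_mono)
    qed
    show "(\<lambda>n. r n * B) \<longlonglongrightarrow> 0" using tendsto_mult_right[OF r(2), of B] by simp
  qed
  define g where "g = (\<lambda>s. complex_of_real s powr (b - 1) * (1 - of_real s) powr (c - b + N - 1))"
  let ?f = "\<lambda>n s. complex_of_real s powr (b - 1) * (1 - of_real s) powr (c - b - 1)
     * (1 - of_real s * (1 - of_real (r n) * w n)) powr (- (- N))"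
  have "(\<lambda>n. integral {0<..<1} (?f n)) \<longlonglongrightarrow> integral {0<..<1} g"
  proof (rule dominated_convergence(2))
    show "?f n integrable_on {0<..<1}" for n
    proof -
      have "1 - complex_of_real (r n) * w n \<in> cut_plane"
        using r(1)[of n] w[of n] K(2) by (intro scaled_in_cut_plane) auto
      thus ?thesis
        using b c by (intro set_lebesgue_integral_eq_integral(1) euler_integrand_absolutely_integrable)
    qed
    show "(\<lambda>s. C * (s powr (Re b - 1) * (1 - s) powr (Re c - Re b + q - 1))) integrable_on {0<..<1}"
      using b q by (intro integrable_on_mult_right Beta_integrable_open) auto
    fix s :: real assume s: "s \<in> {0<..<1}"
    show "norm (?f n s) \<le> C * (s powr (Re b - 1) * (1 - s) powr (Re c - Re b + q - 1))" for n
    proof -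
      define rn wn where "rn = r n" and "wn = w n"
      have rn: "rn \<in> {0<..1}" unfolding rn_def by (rule r)
      have "norm ((1 - complex_of_real s * (1 - of_real rn * wn)) powr N) \<le> C * (1 - s + s * rn) powr q"
        using rn s w[of n] by (intro C(2)) (auto simp: wn_def)
      also have "\<dots> \<le> C * (1 - s) powr q"
        using C(1) s rn q by (intro mult_left_mono powr_mono2') auto
      finally have *: "norm ((1 - complex_of_real s * (1 - of_real rn * wn)) powr N) \<le> C * (1 - s) powr q" .
      have "norm (complex_of_real s powr (b - 1) * (1 - of_real s) powr (c - b - 1)
     * (1 - of_real s * (1 - of_real rn * wn)) powr (- (- N))) =
        s powr (Re b - 1) * (1 - s) powr (Re (c - b) - 1) * norm ((1 - complex_of_real s * (1 - of_real rn * wn)) powr N)"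
        using norm_Beta_integrand[OF s, of b "c - b"] by (simp add: norm_mult)
      also have "\<dots> \<le> s powr (Re b - 1) * (1 - s) powr (Re (c - b) - 1) * (C * (1 - s) powr q)"
        by (intro mult_left_mono *) auto
      also have "\<dots> = C * (s powr (Re b - 1) * ((1 - s) powr (Re (c - b) - 1) * (1 - s) powr q))" by (simp only: mult_ac)
      also have "(1 - s) powr (Re (c - b) - 1) * (1 - s) powr q = (1 - s) powr (Re c - Re b + q - 1)"
        by (simp flip: powr_add add: algebra_simps)
      finally show ?thesis unfolding rn_def wn_def .
    qed
    show "(\<lambda>n. ?f n s) \<longlonglongrightarrow> g s"
    proof -
      have "(\<lambda>n. 1 - complex_of_real s * (1 - of_real (r n) * w n)) \<longlonglongrightarrow> 1 - of_real s * (1 - 0)"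
        by (intro tendsto_intros rw)
      hence "(\<lambda>n. 1 - complex_of_real s * (1 - of_real (r n) * w n)) \<longlonglongrightarrow> 1 - of_real s" by simp
      hence "(\<lambda>n. (1 - complex_of_real s * (1 - of_real (r n) * w n)) powr N) \<longlonglongrightarrow> (1 - of_real s) powr N"
        using s by (intro tendsto_powr_complex tendsto_const) (auto simp: complex_nonpos_Reals_iff)
      hence "(\<lambda>n. ?f n s) \<longlonglongrightarrow>
        complex_of_real s powr (b - 1) * (1 - of_real s) powr (c - b - 1) * (1 - of_real s) powr N"
        unfolding minus_minus by (intro tendsto_mult tendsto_const)
      also have "complex_of_real s powr (b - 1) * (1 - of_real s) powr (c - b - 1) * (1 - of_real s) powr N = g s"
        using s by (simp add: g_def mult.assoc flip: powr_add) (simp add: algebra_simps)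
      finally show ?thesis .
    qed
  qed
  also have "integral {0<..<1} g = Beta b (c - b + N)"
    unfolding g_def using b q by (intro integral_unique has_integral_Beta_complex) auto
  finally show ?thesis unfolding euler_integral_def .
qed

subsection \<open>The Mellin transform of the Legendre kernel\<close>

lemma reg_hyp2f1_continuous: "continuous_on cut_plane (reg_hyp2f1 a b c)"
  using reg_hyp2f1_holomorphic by (rule holomorphic_on_imp_continuous_on)

lemma powr_integrable_open: "p > 0 \<Longrightarrow> (\<lambda>t::real. t powr (p - 1)) integrable_on {0<..<1}"
  using Beta_integrable_open[of p 1] by (rule integrable_eq) auto

text \<open>The series for \<open>F(-N, 1/2; 1; 1 - v)\<close> need not converge at \<open>v = 0\<close>. Hence \<open>1 - v\<close> is first replaced
  by \<open>z (1 - v)\<close>, and \<open>z\<close> then tends to \<open>1\<close>.\<close>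

lemma mellin_partial:
  assumes a: "Re a > 0" and z: "0 < z" "z < (1::real)"
  shows "((\<lambda>v. of_real v powr (a - 1) * reg_hyp2f1 \<alpha> \<beta> 1 (of_real (z * (1 - v)))) has_integral
           Gamma a * reg_hyp2f1 \<alpha> \<beta> (a + 1) (of_real z)) {0<..<1}"
proof -
  define h where "h = hyp_coeff \<alpha> \<beta> 1"
  have zn: "norm (complex_of_real z) < 1" using z by simp
  have su: "summable (\<lambda>n. norm (h n * of_real z ^ n))" unfolding h_def by (rule hyp_coeff_summable[OF zn])
  have trm: "((\<lambda>v. of_real v powr (a - 1) * (h n * of_real (z * (1 - v)) ^ n)) has_integral
      (Gamma a * (hyp_coeff \<alpha> \<beta> (a + 1) n * of_real z ^ n))) {0<..<1}" for n
  proof -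
    have "((\<lambda>v. (h n * of_real z ^ n) * (complex_of_real v powr (a - 1) * (1 - of_real v) powr (of_nat (Suc n) - 1))) has_integral
             (h n * of_real z ^ n * Beta a (of_nat (Suc n)))) {0<..<1}"
      using a by (intro has_integral_mult_right has_integral_Beta_complex) auto
    moreover have "(h n * of_real z ^ n) * (complex_of_real v powr (a - 1) * (1 - of_real v) powr (of_nat (Suc n) - 1)) =
        of_real v powr (a - 1) * (h n * of_real (z * (1 - v)) ^ n)" if "v \<in> {0<..<1}" for v
    proof -
      have "(1 - complex_of_real v) powr (of_nat (Suc n) - 1) = (1 - of_real v) ^ n"
        using that powr_nat[of "1 - complex_of_real v" n] by (auto simp: complex_eq_iff)
      thus ?thesis by (simp add: power_mult_distrib mult_ac)
    qed
    ultimately have "((\<lambda>v. of_real v powr (a - 1) * (h n * of_real (z * (1 - v)) ^ n)) has_integral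
             (h n * of_real z ^ n * Beta a (of_nat (Suc n)))) {0<..<1}"
      by (rule has_integral_eq[rotated])
    \<comment> \<open>\<open>Gamma (n + 1)\<close> from the Beta value cancels
      \<open>rGamma (1 + n)\<close>, while the denominator of the Beta value supplies
      \<open>rGamma (a + 1 + n)\<close>: the lower parameter rises from 1 to
      \<open>a + 1\<close>.\<close>
    moreover have "h n * Beta a (of_nat (Suc n)) = Gamma a * hyp_coeff \<alpha> \<beta> (a + 1) n"
    proof -
      have "Gamma (of_nat (Suc n)) * rGamma (1 + of_nat n) = (1::complex)"
        by (simp add: rGamma_inverse_Gamma Gamma_fact add.commute)
      thus ?thesis by (simp add: Beta_altdef h_def hyp_coeff_def add_ac mult_ac)
    qed
    ultimately show ?thesis by (metis (no_types, lifting) mult.assoc mult.commute)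
  qed
  show ?thesis
  proof (rule has_integral_dominated_convergence)
    show "((\<lambda>v. \<Sum>n<k. of_real v powr (a - 1) * (h n * of_real (z * (1 - v)) ^ n)) has_integral
        (\<Sum>n<k. Gamma a * (hyp_coeff \<alpha> \<beta> (a + 1) n * of_real z ^ n))) {0<..<1}" for k
      by (intro has_integral_sum trm) auto
    show "(\<lambda>v. v powr (Re a - 1) * (\<Sum>n. norm (h n * of_real z ^ n))) integrable_on {0<..<1}"
      using a by (intro integrable_on_mult_left powr_integrable_open) auto
    show "\<forall>v\<in>{0<..<1}. norm (\<Sum>n<k. of_real v powr (a - 1) * (h n * of_real (z * (1 - v)) ^ n)) \<le> v powr (Re a - 1) * (\<Sum>n. norm (h n * of_real z ^ n))" for k
    proof
      fix v :: real assume v: "v \<in> {0<..<1}"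
      have "norm (\<Sum>n<k. h n * of_real (z * (1 - v)) ^ n) \<le> (\<Sum>n<k. norm (h n * of_real (z * (1 - v)) ^ n))" by (rule norm_sum)
      also have "\<dots> \<le> (\<Sum>n<k. norm (h n * of_real z ^ n))"
        using v z unfolding norm_mult norm_power norm_of_real
        by (intro sum_mono mult_left_mono power_mono) (auto simp: abs_mult mult_left_le)
      also have "\<dots> \<le> (\<Sum>n. norm (h n * of_real z ^ n))" by (intro sum_le_suminf su) auto
      finally have "norm (complex_of_real v powr (a - 1)) * norm (\<Sum>n<k. h n * of_real (z * (1 - v)) ^ n)
          \<le> norm (complex_of_real v powr (a - 1)) * (\<Sum>n. norm (h n * of_real z ^ n))"
        by (rule mult_left_mono) simp
      moreover have "norm (complex_of_real v powr (a - 1)) = v powr (Re a - 1)"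
        using v by (simp add: norm_powr_real_powr)
      ultimately show "norm (\<Sum>n<k. of_real v powr (a - 1) * (h n * of_real (z * (1 - v)) ^ n)) \<le> v powr (Re a - 1) * (\<Sum>n. norm (h n * of_real z ^ n))"
        by (simp only: sum_distrib_left[symmetric] norm_mult)
    qed
    show "\<forall>v\<in>{0<..<1}. (\<lambda>k. \<Sum>n<k. of_real v powr (a - 1) * (h n * of_real (z * (1 - v)) ^ n)) \<longlonglongrightarrow>
        of_real v powr (a - 1) * reg_hyp2f1 \<alpha> \<beta> 1 (of_real (z * (1 - v)))"
    proof
      fix v :: real assume v: "v \<in> {0<..<1}"
      have "\<bar>z * (1 - v)\<bar> < 1" using v z by (simp add: abs_mult) (smt (verit) mult_left_le)
      hence "norm (complex_of_real (z * (1 - v))) < 1" by (simp only: norm_of_real)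
      from sums_mult[OF hyp_coeff_sums[OF this, of \<alpha> \<beta> 1], of "of_real v powr (a - 1)"]
      show "(\<lambda>k. \<Sum>n<k. of_real v powr (a - 1) * (h n * of_real (z * (1 - v)) ^ n)) \<longlonglongrightarrow>
        of_real v powr (a - 1) * reg_hyp2f1 \<alpha> \<beta> 1 (of_real (z * (1 - v)))"
        unfolding sums_def h_def reg_hyp2f1_eq_series[OF \<open>norm (complex_of_real (z * (1 - v))) < 1\<close>] .
    qed
    have "(\<lambda>n. Gamma a * (hyp_coeff \<alpha> \<beta> (a + 1) n * of_real z ^ n)) sums (Gamma a * reg_hyp2f1 \<alpha> \<beta> (a + 1) (of_real z))"
      unfolding reg_hyp2f1_eq_series[OF zn] by (intro sums_mult hyp_coeff_sums zn)
    thus "(\<lambda>k. \<Sum>n<k. Gamma a * (hyp_coeff \<alpha> \<beta> (a + 1) n * of_real z ^ n)) \<longlonglongrightarrow> Gamma a * reg_hyp2f1 \<alpha> \<beta> (a + 1) (of_real z)"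
      unfolding sums_def .
  qed
qed

text \<open>Gauss's value of \<open>Gamma a\<close> times the regularized
  \<open>F(-N, 1/2; a+1; 1)\<close>.\<close>

definition mellin_value :: "complex \<Rightarrow> complex \<Rightarrow> complex" where
  "mellin_value N a = Gamma a * Gamma (a + N + 1/2) / (Gamma (a + 1/2) * Gamma (a + N + 1))"

lemma mellin_transform:
  assumes N: "Re N \<ge> -1/2" and a: "Re a > 0"
  shows "(\<lambda>v. of_real v powr (a - 1) * reg_hyp2f1 (- N) (1/2) 1 (1 - of_real v)) absolutely_integrable_on {0<..<1}"
    and "integral {0<..<1} (\<lambda>v. of_real v powr (a - 1) * reg_hyp2f1 (- N) (1/2) 1 (1 - of_real v)) = mellin_value N a"
proof -
  define \<Phi> where "\<Phi> = (\<lambda>v. reg_hyp2f1 (- N) (1/2) 1 (1 - complex_of_real v))"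
  \<comment> \<open>Small enough that \<open>v\<close> to the power \<open>Re a - e - 1\<close> is
    still integrable at 0.\<close>
  define e where "e = min (1/2) (Re a / 2)"
  have e: "0 < e" "e \<le> 1/2" "e < Re a" using a by (auto simp: e_def)
  obtain C where C: "C > 0" "\<And>r. r \<in> {0<..1} \<Longrightarrow> norm (\<Phi> r) \<le> C * r powr (- e)"
  proof (rule legendre_kernel_bound[of "{1}" N e])
    fix C assume "C > 0" "\<And>w r. w \<in> {1} \<Longrightarrow> r \<in> {0<..1} \<Longrightarrow> norm (reg_hyp2f1 (- N) (1/2) 1 (1 - of_real r * w)) \<le> C * r powr (- e)"
    thus thesis by (intro that) (auto simp: \<Phi>_def)
  qed (use N e in auto)
  have cont: "continuous_on {0<..1} \<Phi>"
    unfolding \<Phi>_def by (rule continuous_on_compose2[OF reg_hyp2f1_continuous]) (auto intro!: continuous_intros simp: cut_plane_iff)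
  have int: "(\<lambda>v. C * v powr (Re a - e - 1)) integrable_on {0<..<1}"
    using e by (intro integrable_on_mult_right powr_integrable_open) auto
  \<comment> \<open>Stated for every \<open>r \<ge> v\<close> because the approximating kernels
    below are evaluated at \<open>1 - (1 - r n) * (1 - v)\<close>, which is at least
    \<open>v\<close>. One dominating function then serves all \<open>n\<close>.\<close>
  have bnd: "norm (complex_of_real v powr (a - 1) * \<Phi> r) \<le> C * v powr (Re a - e - 1)" if "0 < v" "v < 1" "v \<le> r" "r \<le> 1" for v r
  proof -
    have "norm (complex_of_real v powr (a - 1) * \<Phi> r) = v powr (Re a - 1) * norm (\<Phi> r)"
      using that by (simp add: norm_mult norm_powr_real_powr)
    also have "\<dots> \<le> v powr (Re a - 1) * (C * r powr (- e))" using that by (intro mult_left_mono C(2)) auto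
    also have "r powr (- e) \<le> v powr (- e)" using that e by (intro powr_mono2') auto
    finally have "norm (complex_of_real v powr (a - 1) * \<Phi> r) \<le> v powr (Re a - 1) * (C * v powr (- e))"
      using C(1) by (simp add: mult_left_mono)
    also have "\<dots> = C * v powr (Re a - e - 1)" by (simp add: mult_ac flip: powr_add) (simp add: algebra_simps)
    finally show ?thesis .
  qed
  show "(\<lambda>v. of_real v powr (a - 1) * reg_hyp2f1 (- N) (1/2) 1 (1 - of_real v)) absolutely_integrable_on {0<..<1}"
    unfolding \<Phi>_def[symmetric]
  proof (rule continuous_bounded_imp_absolutely_integrable[OF _ int])
    show "continuous_on {0<..<1} (\<lambda>v. complex_of_real v powr (a - 1) * reg_hyp2f1 (- N) (1/2) 1 (1 - of_real v))"
    proof (intro continuous_on_mult continuous_on_powr_const)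
      show "continuous_on {0<..<1} (\<lambda>v. reg_hyp2f1 (- N) (1/2) 1 (1 - complex_of_real v))"
        by (rule continuous_on_subset[OF cont[unfolded \<Phi>_def]]) auto
    qed (auto intro!: continuous_intros simp: complex_nonpos_Reals_iff)
    show "norm (complex_of_real v powr (a - 1) * reg_hyp2f1 (- N) (1/2) 1 (1 - of_real v)) \<le> C * v powr (Re a - e - 1)" if "v \<in> {0<..<1}" for v
      using bnd[of v v] that by (simp add: \<Phi>_def)
  qed
  define r where "r = (\<lambda>n::nat. 1 / (real n + 2))"
  have r: "r n \<in> {0<..1}" "r n < 1" for n by (auto simp: r_def)
  have rl: "r \<longlonglongrightarrow> 0" unfolding r_def by real_asymp
  have "(\<lambda>n. integral {0<..<1} (\<lambda>v. of_real v powr (a - 1) * \<Phi> (1 - (1 - r n) * (1 - v)))) \<longlonglongrightarrow>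
      integral {0<..<1} (\<lambda>v. of_real v powr (a - 1) * \<Phi> v)"
  proof (rule dominated_convergence(2)[OF _ int])
    show "(\<lambda>v. of_real v powr (a - 1) * \<Phi> (1 - (1 - r n) * (1 - v))) integrable_on {0<..<1}" for n
      using mellin_partial[OF a, of "1 - r n" "- N" "1/2"] r[of n] by (auto simp: \<Phi>_def integrable_on_def)
    fix v :: real assume v: "v \<in> {0<..<1}"
    have ge: "v \<le> 1 - (1 - r n) * (1 - v)" "1 - (1 - r n) * (1 - v) \<le> 1" for n
    proof -
      have "0 \<le> r n * (1 - v)" using r[of n] v by auto
      thus "v \<le> 1 - (1 - r n) * (1 - v)" by (simp add: algebra_simps)
      have "0 \<le> (1 - r n) * (1 - v)" using r[of n] v by auto
      thus "1 - (1 - r n) * (1 - v) \<le> 1" by simp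
    qed
    show "norm (of_real v powr (a - 1) * \<Phi> (1 - (1 - r n) * (1 - v))) \<le> C * v powr (Re a - e - 1)" for n
      using v ge[of n] by (intro bnd) auto
    have "(\<lambda>n. \<Phi> (1 - (1 - r n) * (1 - v))) \<longlonglongrightarrow> \<Phi> (1 - (1 - 0) * (1 - v))"
    proof (rule continuous_on_tendsto_compose[OF cont])
      show "(\<lambda>n. 1 - (1 - r n) * (1 - v)) \<longlonglongrightarrow> 1 - (1 - 0) * (1 - v)" by (intro tendsto_intros rl)
      show "\<forall>\<^sub>F n in sequentially. 1 - (1 - r n) * (1 - v) \<in> {0<..1}"
      proof (intro always_eventually allI)
        fix n show "1 - (1 - r n) * (1 - v) \<in> {0<..1}" using ge[of n] v by auto
      qed
    qed (use v in auto)
    thus "(\<lambda>n. of_real v powr (a - 1) * \<Phi> (1 - (1 - r n) * (1 - v))) \<longlonglongrightarrow> of_real v powr (a - 1) * \<Phi> v"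
      by (intro tendsto_mult tendsto_const) simp
  qed
  moreover have "integral {0<..<1} (\<lambda>v. of_real v powr (a - 1) * \<Phi> (1 - (1 - r n) * (1 - v))) =
      Gamma a / (Gamma (1/2) * Gamma (a + 1/2)) * euler_integral (- N) (1/2) (a + 1) (1 - of_real (r n) * 1)" for n
  proof -
    have z: "complex_of_real (1 - r n) \<in> cut_plane" using r[of n] by (simp add: cut_plane_iff)
    have G: "Gamma (1/2::complex) \<noteq> 0" "Gamma (a + 1/2) \<noteq> 0"
      using a Re_pos_notin_nonpos_Ints[of "1/2"] Re_pos_notin_nonpos_Ints[of "a + 1/2"] by (auto simp: Gamma_eq_zero_iff)
    have "integral {0<..<1} (\<lambda>v. of_real v powr (a - 1) * \<Phi> (1 - (1 - r n) * (1 - v))) =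
       Gamma a * reg_hyp2f1 (- N) (1/2) (a + 1) (of_real (1 - r n))"
      using integral_unique[OF mellin_partial[OF a, of "1 - r n" "- N" "1/2"]] r[of n] by (simp add: \<Phi>_def)
    moreover have "Gamma (1/2) * Gamma (a + 1/2) * reg_hyp2f1 (- N) (1/2) (a + 1) (of_real (1 - r n))
        = euler_integral (- N) (1/2) (a + 1) (of_real (1 - r n))"
      using reg_hyp2f1_euler_integral[of "1/2" "a + 1" "of_real (1 - r n)" "- N"] a z by (simp add: algebra_simps)
    ultimately show ?thesis using G by (simp add: field_simps)
  qed
  moreover have "(\<lambda>n. Gamma a / (Gamma (1/2) * Gamma (a + 1/2)) * euler_integral (- N) (1/2) (a + 1) (1 - of_real (r n) * 1)) \<longlonglongrightarrow>
      Gamma a / (Gamma (1/2) * Gamma (a + 1/2)) * Beta (1/2) (a + 1 - 1/2 + N)"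
    using a N r rl by (intro tendsto_mult tendsto_const euler_integral_limit[where q = "min (Re N) 0" and K = "{1}"]) (auto simp: min_def)
  ultimately have "integral {0<..<1} (\<lambda>v. of_real v powr (a - 1) * \<Phi> v) =
      Gamma a / (Gamma (1/2) * Gamma (a + 1/2)) * Beta (1/2) (a + 1 - 1/2 + N)"
    using LIMSEQ_unique by simp
  also have "\<dots> = mellin_value N a"
  proof -
    have "Gamma (1/2::complex) \<noteq> 0" using Re_pos_notin_nonpos_Ints[of "1/2"] by (auto simp: Gamma_eq_zero_iff)
    moreover have e: "a + 1 - 1/2 + N = a + N + 1/2" "1/2 + (a + N + 1/2) = a + N + 1" by simp_all
    ultimately show ?thesis unfolding mellin_value_def Beta_def e by simp
  qed
  finally show "integral {0<..<1} (\<lambda>v. of_real v powr (a - 1) * reg_hyp2f1 (- N) (1/2) 1 (1 - of_real v)) = mellin_value N a"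
    unfolding \<Phi>_def .
qed

section \<open>Geometry of the Ferrers domain\<close>

lemma ferrers_domain_iff: "x \<in> ferrers_domain \<longleftrightarrow> Im x \<noteq> 0 \<or> -1 < Re x \<and> Re x < 1"
  by (auto simp: ferrers_domain_def image_iff complex_eq_iff not_le)

lemma open_ferrers_domain: "open ferrers_domain"
proof -
  have "ferrers_domain = ({z. -1 < Re z} \<inter> {z. Re z < 1}) \<union> ({z. Im z > 0} \<union> {z. Im z < 0})"
    using ferrers_domain_iff by (auto simp: linorder_neq_iff)
  also have "open \<dots>"
    by (intro open_Un open_Int open_halfspace_Re_lt open_halfspace_Re_gt open_halfspace_Im_gt open_halfspace_Im_lt)
  finally show ?thesis .
qed

lemma connected_ferrers_domain: "connected ferrers_domain"
proof -
  have "closed_segment 0 z \<subseteq> ferrers_domain" if z: "z \<in> ferrers_domain" for z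
  proof
    fix y assume "y \<in> closed_segment 0 z"
    then obtain u where u: "0 \<le> u" "u \<le> 1" "y = of_real u * z" by (auto simp: closed_segment_def scaleR_conv_of_real)
    have "\<bar>u * Re z\<bar> \<le> \<bar>Re z\<bar>" using u by (auto simp: abs_mult intro: mult_left_le_one_le)
    thus "y \<in> ferrers_domain" using z u by (cases "u = 0") (auto simp: ferrers_domain_iff)
  qed
  hence "starlike ferrers_domain" unfolding starlike_def by (intro bexI[of _ 0]) (auto simp: ferrers_domain_iff)
  thus ?thesis by (rule starlike_imp_connected)
qed

subsection \<open>The integrand along the segment\<close>

text \<open>A positive real factor does not change the argument, so no branch jump can
  occur.\<close>

lemma powr_of_real_mult:
  assumes "r > 0" "z \<noteq> 0"
  shows "(complex_of_real r * z) powr p = of_real r powr p * z powr p"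
proof -
  have 1: "Ln (of_real r * z) = of_real (ln r) + Ln z" using assms by (simp add: Ln_times_of_real Ln_of_real)
  show ?thesis using assms unfolding powr_def 1 by (simp add: Ln_of_real exp_add algebra_simps)
qed

lemma quotient_notin_nonpos_Reals:
  assumes "x \<in> ferrers_domain"
  shows "(1 + x) / (1 - x) \<notin> \<real>\<^sub>\<le>\<^sub>0"
proof
  have ne: "1 - x \<noteq> 0" using assms by (auto simp: ferrers_domain_iff complex_eq_iff)
  assume "(1 + x) / (1 - x) \<in> \<real>\<^sub>\<le>\<^sub>0"
  then obtain k where k: "k \<le> 0" "(1 + x) / (1 - x) = of_real k" by (auto elim!: nonpos_Reals_cases)
  hence eq: "1 + x = of_real k * (1 - x)" using ne by (simp add: field_simps)
  hence "Im x = - k * Im x" "1 + Re x = k * (1 - Re x)" by (auto simp: complex_eq_iff)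
  hence *: "(1 + k) * Im x = 0" "(1 + k) * Re x = k - 1" by (auto simp: algebra_simps)
  hence "1 + k \<noteq> 0" using k(1) by auto
  hence "Im x = 0" using * by simp
  hence R: "-1 < Re x" "Re x < 1" using assms by (auto simp: ferrers_domain_iff)
  have "1 + Re x = k * (1 - Re x)" by fact
  moreover have "k * (1 - Re x) \<le> 0" using k R by (simp add: mult_nonpos_nonneg)
  ultimately show False using R by simp
qed

lemma ferrers_domain_facts:
  assumes "x \<in> ferrers_domain"
  shows "1 + x \<notin> \<real>\<^sub>\<le>\<^sub>0" "1 - x \<notin> \<real>\<^sub>\<le>\<^sub>0" "1 + x \<noteq> 0" "1 - x \<noteq> 0" "(1 - x) / 2 \<in> cut_plane"
  using assms by (auto simp: ferrers_domain_iff complex_nonpos_Reals_iff complex_eq_iff cut_plane_iff)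

text \<open>For \<open>t = linepath x 1 s\<close>, \<open>segment_ratio\<close> is \<open>(1 + t) / (1 + x)\<close> and \<open>segment_base\<close> is
  \<open>(1 + t) / (1 - x)\<close>; in this form it is visible that both avoid the branch cut of the powers.\<close>

definition segment_ratio :: "complex \<Rightarrow> real \<Rightarrow> complex" where
  "segment_ratio x s = 1 - of_real s * (1 - 2 / (1 + x))"

definition segment_base :: "complex \<Rightarrow> real \<Rightarrow> complex" where
  "segment_base x s = of_real s + (1 + x) / (1 - x)"

lemma segment_ratio_notin_nonpos_Reals:
  assumes "x \<in> ferrers_domain" "0 \<le> s" "s \<le> 1"
  shows "segment_ratio x s \<notin> \<real>\<^sub>\<le>\<^sub>0"
  unfolding segment_ratio_def
proof (rule one_minus_of_real_mult_notin_nonpos[OF _ assms(2,3)])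
  have "2 / (1 + x) \<notin> \<real>\<^sub>\<le>\<^sub>0"
  proof
    assume "2 / (1 + x) \<in> \<real>\<^sub>\<le>\<^sub>0"
    then obtain k where k: "k \<le> 0" "2 / (1 + x) = of_real k" by (auto elim!: nonpos_Reals_cases)
    have "k \<noteq> 0" using k ferrers_domain_facts(3)[OF assms(1)] by auto
    hence "1 + x = 2 / of_real k" using k ferrers_domain_facts(3)[OF assms(1)] by (auto simp: field_simps)
    also have "\<dots> = of_real (2 / k)" by simp
    finally have "1 + x \<in> \<real>\<^sub>\<le>\<^sub>0" using k(1) by (simp add: complex_nonpos_Reals_iff divide_le_0_iff del: of_real_divide)
    thus False using ferrers_domain_facts(1)[OF assms(1)] by simp
  qed
  thus "1 - 2 / (1 + x) \<in> cut_plane" by (simp flip: one_minus_notin_nonpos_Reals_iff)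
qed

lemma segment_base_notin_nonpos_Reals:
  assumes "x \<in> ferrers_domain" "0 \<le> s"
  shows "segment_base x s \<notin> \<real>\<^sub>\<le>\<^sub>0"
  using quotient_notin_nonpos_Reals[OF assms(1)] assms(2)
  by (auto simp: segment_base_def complex_nonpos_Reals_iff)

text \<open>For \<open>s < 1\<close> the last identity shows \<open>(1 - t^2) / (1 - x^2)\<close> to
  be a positive multiple of \<open>segment_ratio\<close>. The third one serves the quotient
  \<open>(1 + t) / (1 - t)\<close> in the Ferrers function.\<close>

lemma segment_eqs:
  assumes "x \<in> ferrers_domain"
  defines "t \<equiv> \<lambda>s. linepath x 1 s"
  shows "1 + t s = segment_ratio x s * (1 + x)" "1 - t s = of_real (1 - s) * (1 - x)"
    "1 + t s = segment_base x s * (1 - x)"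
    "1 - (t s)\<^sup>2 = of_real (1 - s) * segment_ratio x s * (1 - x\<^sup>2)"
proof -
  have t: "t s = x + of_real s * (1 - x)" by (simp add: t_def linepath_def scaleR_conv_of_real algebra_simps)
  show 1: "1 + t s = segment_ratio x s * (1 + x)" "1 + t s = segment_base x s * (1 - x)"
    using ferrers_domain_facts[OF assms(1)] by (simp_all add: t segment_ratio_def segment_base_def field_simps)
  show 2: "1 - t s = of_real (1 - s) * (1 - x)" by (simp add: t algebra_simps)
  have "1 - (t s)\<^sup>2 = (1 + t s) * (1 - t s)" by (simp add: algebra_simps power2_eq_square)
  thus "1 - (t s)\<^sup>2 = of_real (1 - s) * segment_ratio x s * (1 - x\<^sup>2)"
    unfolding 1(1) 2 by (simp add: algebra_simps power2_eq_square)
qed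

lemma csqrt_Re_Im: "2 * Re (csqrt z) * Im (csqrt z) = Im z"
  by (metis Im_power2 power2_csqrt)

lemma csqrt_one_minus_square:
  assumes "x \<in> ferrers_domain"
  shows "csqrt (1 - x\<^sup>2) = csqrt (1 - x) * csqrt (1 + x)"
proof (rule csqrt_unique)
  show "(csqrt (1 - x) * csqrt (1 + x))\<^sup>2 = 1 - x\<^sup>2"
    by (simp add: power_mult_distrib) (simp add: algebra_simps power2_eq_square)
  define A B where "A = csqrt (1 - x)" and "B = csqrt (1 + x)"
  have pos: "Re A > 0" "Re B > 0"
    unfolding A_def B_def by (rule Re_csqrt_pos, rule ferrers_domain_facts[OF assms])+
  \<comment> \<open>The imaginary parts of the two roots cannot have the same strict sign, so the
    real part of the product is positive.\<close>
  have "2 * Re A * Im A = - Im x" "2 * Re B * Im B = Im x"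
    unfolding A_def B_def csqrt_Re_Im by simp_all
  hence "(2 * Re A * Im A) * (2 * Re B * Im B) \<le> 0" by simp
  hence "4 * (Re A * Re B) * (Im A * Im B) \<le> 0" by (simp add: mult_ac)
  hence "Im A * Im B \<le> 0" using pos by (simp add: mult_le_0_iff)
  moreover have "Re A * Re B > 0" using pos by simp
  ultimately have "Re (A * B) > 0" by simp
  thus "0 < Re (csqrt (1 - x) * csqrt (1 + x)) \<or>
    Re (csqrt (1 - x) * csqrt (1 + x)) = 0 \<and> 0 \<le> Im (csqrt (1 - x) * csqrt (1 + x))"
    unfolding A_def B_def by blast
qed

lemma linepath_in_ferrers_domain:
  assumes "x \<in> ferrers_domain" "0 \<le> s" "s < 1"
  shows "linepath x 1 s \<in> ferrers_domain"
proof (cases "Im x = 0")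
  case True
  hence R: "-1 < Re x" "Re x < 1" using assms by (auto simp: ferrers_domain_iff)
  have "(1 - s) * Re x + s < (1 - s) * 1 + s" using assms R by (intro add_strict_right_mono mult_strict_left_mono) auto
  moreover have "(1 - s) * (-1) + s < (1 - s) * Re x + s" using assms R by (intro add_strict_right_mono mult_strict_left_mono) auto
  ultimately show ?thesis using assms by (auto simp: ferrers_domain_iff linepath_def)
next
  case False
  thus ?thesis using assms by (auto simp: ferrers_domain_iff linepath_def)
qed

text \<open>Justifies the branch: the quotient of the principal roots is the principal root of the
  quotient. The roots of \<open>1 - t\<close> and \<open>1 - x\<close> differ by a positive factor,
  which leaves those of \<open>1 + t\<close> and \<open>1 + x\<close>.\<close>

lemma csqrt_ratio:
  assumes x: "x \<in> ferrers_domain" and s: "0 \<le> s" "s < 1"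
  defines "t \<equiv> linepath x 1 s"
  shows "csqrt (1 - t\<^sup>2) / csqrt (1 - x\<^sup>2) = csqrt (of_real (1 - s) * segment_ratio x s)"
proof (rule csqrt_unique[symmetric])
  have t: "t \<in> ferrers_domain" unfolding t_def using assms by (intro linepath_in_ferrers_domain)
  define A B B' where "A = csqrt (1 - x)" and "B = csqrt (1 + x)" and "B' = csqrt (1 + t)"
  have pos: "Re A > 0" "Re B > 0" "Re B' > 0"
    unfolding A_def B_def B'_def
    by (rule Re_csqrt_pos, rule ferrers_domain_facts[OF x] ferrers_domain_facts[OF t])+
  have A': "csqrt (1 - t) = of_real (sqrt (1 - s)) * A"
  proof (rule csqrt_unique)
    have "complex_of_real (sqrt (1 - s)) ^ 2 = of_real (1 - s)" using s by (simp flip: of_real_power)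
    thus "(complex_of_real (sqrt (1 - s)) * A)\<^sup>2 = 1 - t"
      using segment_eqs(2)[OF x, of s] by (simp add: power_mult_distrib A_def t_def)
  qed (use pos s in simp)
  have nz: "A \<noteq> 0" "B \<noteq> 0" using pos by auto
  have ratio: "csqrt (1 - t\<^sup>2) / csqrt (1 - x\<^sup>2) = of_real (sqrt (1 - s)) * (B' / B)"
    unfolding csqrt_one_minus_square[OF x] csqrt_one_minus_square[OF t] A'
    using nz by (simp add: A_def B_def B'_def field_simps)
  have x2: "1 - x\<^sup>2 \<noteq> 0"
  proof
    assume "1 - x\<^sup>2 = 0"
    hence "(1 - x) * (1 + x) = 0" by (simp add: algebra_simps power2_eq_square)
    thus False using ferrers_domain_facts[OF x] by simp
  qed
  thus "(csqrt (1 - t\<^sup>2) / csqrt (1 - x\<^sup>2))\<^sup>2 = of_real (1 - s) * segment_ratio x s"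
    using segment_eqs(4)[OF x, of s] by (simp add: power_divide t_def field_simps)
  \<comment> \<open>The imaginary parts of \<open>t\<close> and \<open>x\<close> have the same sign,
    so \<open>B\<close> and \<open>B'\<close> lie in one closed quadrant and their quotient has
    positive real part.\<close>
  have im: "2 * Re B' * Im B' = Im t" "2 * Re B * Im B = Im x"
    unfolding B'_def B_def csqrt_Re_Im by simp_all
  have "Im t = (1 - s) * Im x" by (simp add: t_def linepath_def)
  hence "(2 * Re B' * Im B') * (2 * Re B * Im B) = (1 - s) * (Im x)\<^sup>2"
    unfolding im by (simp add: power2_eq_square)
  moreover have "(2 * Re B' * Im B') * (2 * Re B * Im B) = 4 * (Re B * Re B') * (Im B * Im B')" by (simp add: mult_ac)
  moreover have "(1 - s) * (Im x)\<^sup>2 \<ge> 0" using s by simp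
  ultimately have "4 * (Re B * Re B') * (Im B * Im B') \<ge> 0" by linarith
  moreover have "4 * (Re B * Re B') > 0" using pos by simp
  ultimately have "Im B * Im B' \<ge> 0" by (metis mult_le_cancel_left_pos mult_zero_right)
  moreover have "Re B * Re B' > 0" using pos by simp
  ultimately have "Re (B' / B) > 0"
    using pos by (auto simp: Re_divide mult_ac intro!: divide_pos_pos add_pos_nonneg)
  hence "sqrt (1 - s) * Re (B' / B) > 0" using s by simp
  hence "Re (csqrt (1 - t\<^sup>2) / csqrt (1 - x\<^sup>2)) > 0" unfolding ratio by (simp only: times_complex.sel Re_complex_of_real Im_complex_of_real)
  thus "0 < Re (csqrt (1 - t\<^sup>2) / csqrt (1 - x\<^sup>2)) \<or>
    Re (csqrt (1 - t\<^sup>2) / csqrt (1 - x\<^sup>2)) = 0 \<and> 0 \<le> Im (csqrt (1 - t\<^sup>2) / csqrt (1 - x\<^sup>2))" by blast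
qed

text \<open>The Legendre argument is \<open>(q + 1 / q) / 2\<close> for the quotient
  \<open>q\<close> of the two roots, and \<open>csqrt_ratio\<close> identifies \<open>q\<close> with
  \<open>csqrt v\<close>.\<close>

lemma legendre_kernel:
  assumes x: "x \<in> ferrers_domain" and s: "0 \<le> s" "s < 1"
  defines "t \<equiv> linepath x 1 s" and "v \<equiv> of_real (1 - s) * segment_ratio x s"
  shows "legendre_P N ((2 - x\<^sup>2 - t\<^sup>2) / (2 * (csqrt (1 - x\<^sup>2) * csqrt (1 - t\<^sup>2)))) =
           v powr (- N / 2) * reg_hyp2f1 (- N) (1/2) 1 (1 - v)"
proof -
  have "segment_ratio x s \<notin> \<real>\<^sub>\<le>\<^sub>0" using x s by (intro segment_ratio_notin_nonpos_Reals) auto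
  hence v: "v \<notin> \<real>\<^sub>\<le>\<^sub>0" unfolding v_def using s by (auto simp: complex_nonpos_Reals_iff mult_le_0_iff)
  define X T where "X = csqrt (1 - x\<^sup>2)" and "T = csqrt (1 - t\<^sup>2)"
  have rho: "T / X = csqrt v" unfolding X_def T_def v_def t_def using x s by (rule csqrt_ratio)
  have "csqrt v \<noteq> 0" using v by auto
  hence nz: "T \<noteq> 0" "X \<noteq> 0" using rho by auto
  have "2 - x\<^sup>2 - t\<^sup>2 = X\<^sup>2 + T\<^sup>2" by (simp add: X_def T_def)
  hence eq: "(2 - x\<^sup>2 - t\<^sup>2) / (2 * (X * T)) = (csqrt v + 1 / csqrt v) / 2"
    unfolding rho[symmetric] using nz by (simp add: field_simps power2_eq_square)
  show ?thesis unfolding X_def[symmetric] T_def[symmetric] eq by (rule legendre_P_joukowski[OF v])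
qed

text \<open>Collects the factors that remain continuous up to the endpoint \<open>s = 1\<close>.
  There its hypergeometric factor has the argument 0 and hence the value
  \<open>rGamma (1 + \<mu>)\<close>.\<close>

definition segment_smooth :: "complex \<Rightarrow> complex \<Rightarrow> complex \<Rightarrow> real \<Rightarrow> complex" where
  "segment_smooth N \<mu> x s = segment_base x s powr (- \<mu> / 2) * reg_hyp2f1 (- N) (N + 1) (1 + \<mu>) (of_real (1 - s) * ((1 - x) / 2))
     * segment_ratio x s powr (- N / 2) / (segment_ratio x s * (1 + x))"

text \<open>The exponent of \<open>1 - s\<close> has three sources: \<open>\<mu> / 2\<close> from
  the Ferrers function, \<open>- N / 2\<close> from the power in the kernel, and \<open>- 1\<close>
  from \<open>1 / (1 - t^2)\<close>.\<close>

definition segment_integrand :: "complex \<Rightarrow> complex \<Rightarrow> complex \<Rightarrow> real \<Rightarrow> complex" where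
  "segment_integrand N \<mu> x s = of_real (1 - s) powr ((\<mu> - N) / 2 - 1) * segment_smooth N \<mu> x s
     * reg_hyp2f1 (- N) (1/2) 1 (1 - of_real (1 - s) * segment_ratio x s)"

lemma segment_integrand_eq:
  assumes x: "x \<in> ferrers_domain" and s: "0 \<le> s" "s < 1"
  shows "ferrers_integrand N \<mu> x (linepath x 1 s) * (1 - x) = segment_integrand N \<mu> x s"
proof -
  define t where "t = linepath x 1 s"
  define w b r where "w = segment_ratio x s" and "b = segment_base x s" and "r = 1 - s"
  have r: "r > 0" using s by (simp add: r_def)
  have w: "w \<noteq> 0" and b: "b \<noteq> 0"
    using segment_ratio_notin_nonpos_Reals[OF x, of s] segment_base_notin_nonpos_Reals[OF x, of s] s by (auto simp: w_def b_def)
  have x1: "1 - x \<noteq> 0" "1 + x \<noteq> 0" using ferrers_domain_facts[OF x] by auto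
  have t: "1 - t = of_real r * (1 - x)" "1 + t = w * (1 + x)" "1 + t = b * (1 - x)"
    using segment_eqs[OF x, of s] by (auto simp: t_def w_def b_def r_def)
  have "(1 + t) / (1 - t) = of_real (1 / r) * b"
    unfolding t(1,3) using x1 r by (simp add: field_simps)
  hence "((1 + t) / (1 - t)) powr (- \<mu> / 2) = of_real (1 / r) powr (- \<mu> / 2) * b powr (- \<mu> / 2)"
    using r b by (simp only:) (intro powr_of_real_mult, auto)
  also have "of_real (1 / r) powr (- \<mu> / 2) = complex_of_real r powr (\<mu> / 2)"
    using r by (simp add: powr_def Ln_of_real ln_div del: of_real_divide)
  finally have 1: "((1 + t) / (1 - t)) powr (- \<mu> / 2) = of_real r powr (\<mu> / 2) * b powr (- \<mu> / 2)" .
  have 2: "legendre_P N ((2 - x\<^sup>2 - t\<^sup>2) / (2 * (csqrt (1 - x\<^sup>2) * csqrt (1 - t\<^sup>2)))) =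
      of_real r powr (- N / 2) * w powr (- N / 2) * reg_hyp2f1 (- N) (1/2) 1 (1 - of_real r * w)"
    using legendre_kernel[OF x s, of N] powr_of_real_mult[OF r w, of "- N / 2"] by (simp add: t_def w_def r_def)
  have 3: "1 - t\<^sup>2 = of_real r * (1 - x) * (w * (1 + x))"
  proof -
    have "1 - t\<^sup>2 = (1 - t) * (1 + t)" by (simp add: algebra_simps power2_eq_square)
    thus ?thesis unfolding t(1,2) .
  qed
  have 4: "of_real r powr ((\<mu> - N) / 2 - 1) = complex_of_real r powr (\<mu> / 2) * of_real r powr (- N / 2) / of_real r"
  proof -
    have "(\<mu> - N) / 2 - 1 = \<mu> / 2 + (- N / 2) - 1" by (simp add: diff_divide_distrib)
    thus ?thesis using r by (simp only: powr_diff powr_add) simp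
  qed
  have 5: "(1 - t) / 2 = of_real r * ((1 - x) / 2)" unfolding t by simp
  \<comment> \<open>Here \<open>y\<close> stands for \<open>1 - x\<close>, the derivative of the
    path, which cancels one factor of \<open>1 - t^2\<close>.\<close>
  have gen: "A * B * C * (D * E * F) / (q * y * u) * y = A * D / q * (B * C * E / u) * F" if "y \<noteq> 0" for A B C D E F q y u :: complex
    using that by (cases "q = 0"; cases "u = 0") (simp_all add: divide_simps)
  show ?thesis
    unfolding ferrers_integrand_def ferrers_P_def segment_integrand_def segment_smooth_def t_def[symmetric] w_def[symmetric] b_def[symmetric] r_def[symmetric]
      2
    unfolding 3 4 5 1 minus_minus diff_minus_eq_add
    by (rule gen[OF x1(1)])
qed

lemma segment_argument_in_cut_plane:
  assumes "x \<in> ferrers_domain" "0 \<le> s" "s \<le> 1"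
  shows "complex_of_real (1 - s) * ((1 - x) / 2) \<in> cut_plane"
  using assms by (intro of_real_mult_in_cut_plane ferrers_domain_facts(5)) auto

lemma kernel_argument_in_cut_plane:
  assumes "x \<in> ferrers_domain" "0 \<le> s" "s < 1"
  shows "1 - complex_of_real (1 - s) * segment_ratio x s \<in> cut_plane"
  by (rule scaled_in_cut_plane[OF segment_ratio_notin_nonpos_Reals]) (use assms in auto)

lemma segment_ratio_holomorphic: "(\<lambda>x. segment_ratio x s) holomorphic_on ferrers_domain"
  unfolding segment_ratio_def by (intro holomorphic_intros) (use ferrers_domain_facts in auto)

lemma segment_smooth_holomorphic:
  assumes "0 \<le> s" "s \<le> 1"
  shows "(\<lambda>x. segment_smooth N \<mu> x s) holomorphic_on ferrers_domain"
proof -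
  have "(reg_hyp2f1 (- N) (N + 1) (1 + \<mu>) \<circ> (\<lambda>x. of_real (1 - s) * ((1 - x) / 2))) holomorphic_on ferrers_domain"
  proof (rule holomorphic_on_compose_gen[OF _ reg_hyp2f1_holomorphic])
    show "(\<lambda>x. of_real (1 - s) * ((1 - x) / 2)) ` ferrers_domain \<subseteq> cut_plane"
      using assms by (intro image_subsetI segment_argument_in_cut_plane)
  qed (intro holomorphic_intros, auto)
  hence 1: "(\<lambda>x. reg_hyp2f1 (- N) (N + 1) (1 + \<mu>) (of_real (1 - s) * ((1 - x) / 2))) holomorphic_on ferrers_domain"
    by (simp only: o_def)
  have 2: "(\<lambda>x. segment_base x s) holomorphic_on ferrers_domain"
    unfolding segment_base_def by (intro holomorphic_intros) (use ferrers_domain_facts in auto)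
  have nz: "segment_ratio x s \<noteq> 0" "1 + x \<noteq> 0" if "x \<in> ferrers_domain" for x
    using segment_ratio_notin_nonpos_Reals[OF that assms] ferrers_domain_facts[OF that] by auto
  show ?thesis
    unfolding segment_smooth_def
    by (intro holomorphic_intros 1 2 segment_ratio_holomorphic)
       (use nz segment_ratio_notin_nonpos_Reals[of _ s] segment_base_notin_nonpos_Reals[of _ s] assms in auto)
qed

lemma continuous_on_segment_ratio: "continuous_on (ferrers_domain \<times> {0..1}) (\<lambda>(x, s). segment_ratio x s)"
  unfolding segment_ratio_def case_prod_unfold
  by (intro continuous_intros) (use ferrers_domain_facts in auto)

lemma continuous_on_segment_smooth: "continuous_on (ferrers_domain \<times> {0..1}) (\<lambda>(x, s). segment_smooth N \<mu> x s)"
proof -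
  let ?D = "ferrers_domain \<times> {0..1::real}"
  have w: "continuous_on ?D (\<lambda>y. segment_ratio (fst y) (snd y))"
    using continuous_on_segment_ratio by (simp add: case_prod_unfold)
  have b: "continuous_on ?D (\<lambda>y. segment_base (fst y) (snd y))"
    unfolding segment_base_def by (intro continuous_intros) (use ferrers_domain_facts in auto)
  have r: "continuous_on ?D (\<lambda>y. reg_hyp2f1 (- N) (N + 1) (1 + \<mu>) (of_real (1 - snd y) * ((1 - fst y) / 2)))"
  proof (rule continuous_on_compose2[OF reg_hyp2f1_continuous])
    show "(\<lambda>y. of_real (1 - snd y) * ((1 - fst y) / 2)) ` ?D \<subseteq> cut_plane"
      by (intro image_subsetI segment_argument_in_cut_plane) auto
  qed (intro continuous_intros, auto)
  show ?thesis
    unfolding segment_smooth_def case_prod_unfold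
  proof (intro continuous_on_mult continuous_on_divide continuous_on_powr_const w b r)
    fix y assume y: "y \<in> ?D"
    show "segment_base (fst y) (snd y) \<notin> \<real>\<^sub>\<le>\<^sub>0" "segment_ratio (fst y) (snd y) \<notin> \<real>\<^sub>\<le>\<^sub>0"
      using y segment_base_notin_nonpos_Reals[of "fst y" "snd y"] segment_ratio_notin_nonpos_Reals[of "fst y" "snd y"]
      by auto
  next
    have "segment_ratio (fst y) (snd y) * (1 + fst y) \<noteq> 0" if "y \<in> ?D" for y
    proof -
      have "segment_ratio (fst y) (snd y) \<notin> \<real>\<^sub>\<le>\<^sub>0" using that by (intro segment_ratio_notin_nonpos_Reals) auto
      moreover have "1 + fst y \<noteq> 0" using that by (intro ferrers_domain_facts) auto
      ultimately show ?thesis by auto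
    qed
    thus "\<forall>y\<in>?D. segment_ratio (fst y) (snd y) * (1 + fst y) \<noteq> 0" by blast
  qed (intro continuous_intros)+
qed

lemma segment_integrand_holomorphic:
  assumes "0 \<le> s" "s < 1"
  shows "(\<lambda>x. segment_integrand N \<mu> x s) holomorphic_on ferrers_domain"
proof -
  have "(reg_hyp2f1 (- N) (1/2) 1 \<circ> (\<lambda>x. 1 - of_real (1 - s) * segment_ratio x s)) holomorphic_on ferrers_domain"
  proof (rule holomorphic_on_compose_gen[OF _ reg_hyp2f1_holomorphic])
    show "(\<lambda>x. 1 - of_real (1 - s) * segment_ratio x s) ` ferrers_domain \<subseteq> cut_plane"
      using assms by (intro image_subsetI kernel_argument_in_cut_plane) auto
  qed (intro holomorphic_intros segment_ratio_holomorphic)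
  hence "(\<lambda>x. reg_hyp2f1 (- N) (1/2) 1 (1 - of_real (1 - s) * segment_ratio x s)) holomorphic_on ferrers_domain"
    by (simp only: o_def)
  moreover have "(\<lambda>x. segment_smooth N \<mu> x s) holomorphic_on ferrers_domain"
    using assms by (intro segment_smooth_holomorphic) auto
  ultimately show ?thesis unfolding segment_integrand_def by (intro holomorphic_intros)
qed

lemma continuous_on_section:
  assumes "continuous_on (A \<times> B) (\<lambda>(x, s). f x s)" "x \<in> A" "C \<subseteq> B"
  shows "continuous_on C (f x)"
proof -
  have "continuous_on C ((\<lambda>(x, s). f x s) \<circ> (\<lambda>s. (x, s)))"
    by (intro continuous_on_compose continuous_intros continuous_on_subset[OF assms(1)]) (use assms(2,3) in auto)
  thus ?thesis by (simp add: o_def)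
qed

lemma continuous_on_segment_integrand:
  assumes "x \<in> ferrers_domain"
  shows "continuous_on {0<..<1} (segment_integrand N \<mu> x)"
proof -
  have "continuous_on {0<..<1} (\<lambda>s. reg_hyp2f1 (- N) (1/2) 1 (1 - of_real (1 - s) * segment_ratio x s))"
  proof (rule continuous_on_compose2[OF reg_hyp2f1_continuous])
    show "continuous_on {0<..<1} (\<lambda>s. 1 - of_real (1 - s) * segment_ratio x s)"
      by (intro continuous_intros continuous_on_section[OF continuous_on_segment_ratio assms]) auto
    show "(\<lambda>s. 1 - of_real (1 - s) * segment_ratio x s) ` {0<..<1} \<subseteq> cut_plane"
      using assms by (intro image_subsetI kernel_argument_in_cut_plane) auto
  qed
  moreover have "continuous_on {0<..<1} (segment_smooth N \<mu> x)"
    by (rule continuous_on_section[OF continuous_on_segment_smooth assms]) auto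
  moreover have "continuous_on {0<..<1::real} (\<lambda>s. complex_of_real (1 - s) powr ((\<mu> - N) / 2 - 1))"
    by (intro continuous_on_powr_const continuous_intros) (auto simp: complex_nonpos_Reals_iff)
  ultimately show ?thesis unfolding segment_integrand_def by (intro continuous_on_mult)
qed

lemma segment_integrand_bound:
  assumes K: "compact K" "K \<subseteq> ferrers_domain" and N: "Re N \<ge> -1/2" and \<mu>: "Re (\<mu> - N) > 0"
  obtains g where "g integrable_on {0<..<1}"
    "\<And>x s. x \<in> K \<Longrightarrow> s \<in> {0<..<1} \<Longrightarrow> norm (segment_integrand N \<mu> x s) \<le> g s"
proof -
  \<comment> \<open>The kernel bound takes at most half of the available exponent
    \<open>Re (\<mu> - N) / 2\<close>, so that \<open>\<eta>\<close> stays positive.\<close>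
  define e where "e = min (1/2) (Re (\<mu> - N) / 4)"
  define \<eta> where "\<eta> = Re (\<mu> - N) / 2 - e"
  have e: "0 < e" "e \<le> 1/2" "\<eta> > 0" using \<mu> unfolding e_def \<eta>_def by (auto simp: min_def)
  have cK: "compact (K \<times> {0..1::real})" by (intro compact_Times K) auto
  define W where "W = (\<lambda>(x, s). segment_ratio x s) ` (K \<times> {0..1})"
  have "compact W" unfolding W_def
    by (intro compact_continuous_image[OF _ cK] continuous_on_subset[OF continuous_on_segment_ratio]) (use K in auto)
  moreover have "W \<inter> \<real>\<^sub>\<le>\<^sub>0 = {}"
    unfolding W_def using K segment_ratio_notin_nonpos_Reals by fastforce
  ultimately obtain C where C: "C > 0" "\<And>w r. w \<in> W \<Longrightarrow> r \<in> {0<..1} \<Longrightarrow> norm (reg_hyp2f1 (- N) (1/2) 1 (1 - of_real r * w)) \<le> C * r powr (- e)"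
    using legendre_kernel_bound[OF _ _ N e(1,2)] by blast
  have "compact ((\<lambda>(x, s). segment_smooth N \<mu> x s) ` (K \<times> {0..1}))"
    by (intro compact_continuous_image[OF _ cK] continuous_on_subset[OF continuous_on_segment_smooth]) (use K in auto)
  from compact_imp_bounded[OF this] obtain B where B: "B > 0" "\<And>x s. x \<in> K \<Longrightarrow> s \<in> {0..1} \<Longrightarrow> norm (segment_smooth N \<mu> x s) \<le> B"
    unfolding bounded_pos by fastforce
  show ?thesis
  proof (rule that[of "\<lambda>s. B * C * (1 - s) powr (\<eta> - 1)"])
    have "(\<lambda>s::real. s powr (1 - 1) * (1 - s) powr (\<eta> - 1)) integrable_on {0<..<1}"
      using e by (intro Beta_integrable_open) auto
    hence "(\<lambda>s::real. (1 - s) powr (\<eta> - 1)) integrable_on {0<..<1}" by (rule integrable_eq) auto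
    thus "(\<lambda>s. B * C * (1 - s) powr (\<eta> - 1)) integrable_on {0<..<1}" by (rule integrable_on_mult_right)
    fix x s assume x: "x \<in> K" and s: "s \<in> {0<..<1::real}"
    have "norm (segment_integrand N \<mu> x s) = (1 - s) powr (Re (\<mu> - N) / 2 - 1) * norm (segment_smooth N \<mu> x s)
        * norm (reg_hyp2f1 (- N) (1/2) 1 (1 - of_real (1 - s) * segment_ratio x s))"
      unfolding segment_integrand_def using s norm_powr_real_powr[of "complex_of_real (1 - s)" "(\<mu> - N) / 2 - 1"]
      by (simp add: norm_mult)
    also have "\<dots> \<le> (1 - s) powr (Re (\<mu> - N) / 2 - 1) * B * (C * (1 - s) powr (- e))"
      using B(1) C(1) x s by (intro mult_mono B(2) C(2) mult_nonneg_nonneg) (auto simp: W_def intro!: image_eqI[of _ _ "(x, s)"])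
    also have "\<dots> = B * C * ((1 - s) powr (Re (\<mu> - N) / 2 - 1) * (1 - s) powr (- e))" by (simp only: mult_ac)
    also have "(1 - s) powr (Re (\<mu> - N) / 2 - 1) * (1 - s) powr (- e) = (1 - s) powr (\<eta> - 1)"
      by (simp flip: powr_add add: \<eta>_def algebra_simps)
    finally show "norm (segment_integrand N \<mu> x s) \<le> B * C * (1 - s) powr (\<eta> - 1)" .
  qed
qed

lemma segment_integrand_absolutely_integrable:
  assumes "x \<in> ferrers_domain" "Re N \<ge> -1/2" "Re (\<mu> - N) > 0"
  shows "segment_integrand N \<mu> x absolutely_integrable_on {0<..<1}"
proof -
  obtain g where g: "g integrable_on {0<..<1}" "\<And>y s. y \<in> {x} \<Longrightarrow> s \<in> {0<..<1} \<Longrightarrow> norm (segment_integrand N \<mu> y s) \<le> g s"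
    by (rule segment_integrand_bound[of "{x}" N \<mu>]) (use assms in auto)
  show ?thesis
    by (rule continuous_bounded_imp_absolutely_integrable[OF continuous_on_segment_integrand[OF assms(1)] g(1)]) (use g(2) in auto)
qed

lemma segment_integral_holomorphic:
  assumes "Re N \<ge> -1/2" "Re (\<mu> - N) > 0"
  shows "(\<lambda>x. integral {0<..<1} (segment_integrand N \<mu> x)) holomorphic_on ferrers_domain"
proof (rule holomorphic_on_dominated_integral[OF open_ferrers_domain])
  show "(\<lambda>x. segment_integrand N \<mu> x s) holomorphic_on ferrers_domain" if "s \<in> {0<..<1}" for s
    using that by (intro segment_integrand_holomorphic) auto
  show "segment_integrand N \<mu> x integrable_on {0<..<1}" if "x \<in> ferrers_domain" for x
    using segment_integrand_absolutely_integrable[OF that assms] by (rule set_lebesgue_integral_eq_integral(1))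
  fix x assume "x \<in> ferrers_domain"
  then obtain r where r: "r > 0" "cball x r \<subseteq> ferrers_domain"
    using open_ferrers_domain open_contains_cball by blast
  obtain g where g: "g integrable_on {0<..<1}" "\<And>y s. y \<in> cball x r \<Longrightarrow> s \<in> {0<..<1} \<Longrightarrow> norm (segment_integrand N \<mu> y s) \<le> g s"
    using segment_integrand_bound[OF compact_cball r(2) assms] by blast
  show "\<exists>r>0. \<exists>g. g integrable_on {0<..<1} \<and> ball x r \<subseteq> ferrers_domain \<and>
      (\<forall>y\<in>ball x r. \<forall>s\<in>{0<..<1}. norm (segment_integrand N \<mu> y s) \<le> g s)"
  proof (intro exI[of _ r] exI[of _ g] conjI ballI)
    show "ball x r \<subseteq> ferrers_domain" using r(2) ball_subset_cball by blast
    show "norm (segment_integrand N \<mu> y s) \<le> g s" if "y \<in> ball x r" "s \<in> {0<..<1}" for y s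
      using that by (intro g(2)) auto
  qed (use r g in auto)
qed

lemma ferrers_contour_integral_iff:
  assumes "x \<in> ferrers_domain"
  shows "(ferrers_integrand N \<mu> x has_contour_integral I) (linepath x 1) \<longleftrightarrow>
           (segment_integrand N \<mu> x has_integral I) {0<..<1}"
  unfolding has_contour_integral_linepath has_integral_Icc_iff_Ioo
  by (rule has_integral_cong) (use segment_integrand_eq[OF assms] in auto)

lemma complex_change_of_variables:
  fixes f :: "real \<Rightarrow> complex" and g :: "real \<Rightarrow> real"
  assumes S: "S \<in> sets lebesgue"
    and der: "\<And>x. x \<in> S \<Longrightarrow> (g has_field_derivative g' x) (at x within S)"
    and inj: "inj_on g S"
    and f: "f absolutely_integrable_on (g ` S)"
  shows "((\<lambda>x. of_real \<bar>g' x\<bar> * f (g x)) has_integral (integral (g ` S) f)) S"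
proof -
  have *: "((\<lambda>x. \<bar>g' x\<bar> * p (g x)) has_integral (integral (g ` S) p)) S" if "p absolutely_integrable_on (g ` S)" for p
    using has_absolute_integral_change_of_variables_1'[OF S der inj, of p "integral (g ` S) p"] that
    by (auto simp: has_integral_iff intro: set_lebesgue_integral_eq_integral(1))
  have lin: "(\<lambda>x. h (f x)) absolutely_integrable_on (g ` S)" if "bounded_linear h" for h :: "complex \<Rightarrow> real"
    using absolutely_integrable_linear[OF f that] by (simp add: o_def)
  have int: "(f has_integral integral (g ` S) f) (g ` S)"
    using f by (simp add: integrable_integral set_lebesgue_integral_eq_integral(1))
  have "((\<lambda>x. \<bar>g' x\<bar> * Re (f (g x))) has_integral (Re (integral (g ` S) f))) S"
    using *[OF lin[OF bounded_linear_Re]] has_integral_Re[OF int] by (simp add: integral_unique)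
  moreover have "((\<lambda>x. \<bar>g' x\<bar> * Im (f (g x))) has_integral (Im (integral (g ` S) f))) S"
    using *[OF lin[OF bounded_linear_Im]] has_integral_Im[OF int] by (simp add: integral_unique)
  ultimately have "((\<lambda>x. of_real (\<bar>g' x\<bar> * Re (f (g x))) + \<i> * of_real (\<bar>g' x\<bar> * Im (f (g x)))) has_integral
      (of_real (Re (integral (g ` S) f)) + \<i> * of_real (Im (integral (g ` S) f)))) S"
    by (intro has_integral_add has_integral_mult_right has_integral_of_real)
  moreover have "of_real (\<bar>g' x\<bar> * Re z) + \<i> * of_real (\<bar>g' x\<bar> * Im z) = of_real \<bar>g' x\<bar> * z" for x z
    by (simp add: complex_eq_iff)
  moreover have "of_real (Re z) + \<i> * of_real (Im z) = z" for z by (simp add: complex_eq_iff)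
  ultimately show ?thesis by simp
qed

text \<open>The core of the computation. By \<open>Gamma (b + n) = pochhammer b n * Gamma b\<close>,
  the Mellin value at \<open>a + n\<close> contributes a quotient of Pochhammer symbols whose
  denominator cancels those in the coefficient on the left and whose numerator puts those with
  \<open>a\<close> and \<open>a + N + 1/2\<close> in their place.\<close>

lemma mellin_value_shift:
  assumes "Re a > 0" "Re N \<ge> -1/2"
  shows "hyp_coeff (a + N + 1) (a + 1/2) c n * mellin_value N (a + of_nat n) =
           mellin_value N a * hyp_coeff a (a + N + 1/2) c n"
proof -
  have p: "Re a > 0" "Re (a + N + 1/2) > 0" "Re (a + 1/2) > 0" "Re (a + N + 1) > 0" using assms by auto
  note ni = p[THEN Re_pos_notin_nonpos_Ints]
  have shift: "a + of_nat n + N + 1/2 = (a + N + 1/2) + of_nat n" "a + of_nat n + 1/2 = (a + 1/2) + of_nat n"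
    "a + of_nat n + N + 1 = (a + N + 1) + of_nat n" by simp_all
  have nz: "Gamma (a + 1/2) \<noteq> 0" "Gamma (a + N + 1) \<noteq> 0" using ni by (simp_all add: Gamma_eq_zero_iff)
  have ph: "pochhammer (a + 1/2) n \<noteq> 0" "pochhammer (a + N + 1) n \<noteq> 0"
    using ni(3,4) by (auto simp: pochhammer_eq_0_iff)
  show ?thesis
    unfolding mellin_value_def shift Gamma_plus_nat[OF ni(1)] Gamma_plus_nat[OF ni(2)] Gamma_plus_nat[OF ni(3)] Gamma_plus_nat[OF ni(4)]
      hyp_coeff_def
    using nz ph by (simp add: field_simps)
qed

subsection \<open>The integral equation on the real interval\<close>

text \<open>Euler's transformation yields upper parameters \<open>1 + \<mu> + N\<close> and
  \<open>\<mu> - N\<close>. Their halves plus 1/2 sum to the lower parameter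
  \<open>1 + \<mu>\<close>, which is the condition for the quadratic transformation; with
  \<open>z = (1 - t) / 2\<close> its argument \<open>4z(1-z)\<close> is
  \<open>1 - t^2\<close>.\<close>

lemma ferrers_P_quadratic:
  assumes t: "0 < t" "t < (1::real)" and \<mu>: "1 + \<mu> \<notin> \<int>\<^sub>\<le>\<^sub>0"
  shows "ferrers_P N (- \<mu>) (of_real t) = 2 powr (- \<mu>) * of_real (1 - t\<^sup>2) powr (\<mu> / 2)
           * reg_hyp2f1 ((\<mu> - N) / 2) ((\<mu> - N) / 2 + N + 1/2) (1 + \<mu>) (of_real (1 - t\<^sup>2))"
proof -
  define a b where "a = (\<mu> - N) / 2" and "b = (\<mu> - N) / 2 + N + 1/2"
  define z where "z = (1 - complex_of_real t) / 2"
  have ab: "a + b + 1/2 = 1 + \<mu>" "2 * a = \<mu> - N" "2 * b = 1 + \<mu> + N" by (simp_all add: a_def b_def field_simps)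
  have z: "z \<in> cut_plane" using t by (simp add: z_def cut_plane_iff)
  have t2: "0 < t\<^sup>2" "t\<^sup>2 < 1" using t by (auto simp: power_less_one_iff)
  have "reg_hyp2f1 (- N) (N + 1) (1 + \<mu>) z = (1 - z) powr (1 + \<mu> - (- N) - (N + 1)) * reg_hyp2f1 (1 + \<mu> - (- N)) (1 + \<mu> - (N + 1)) (1 + \<mu>) z"
    by (rule euler_transformation[OF \<mu> z])
  also have "1 + \<mu> - (- N) - (N + 1) = \<mu>" by simp
  also have "1 + \<mu> - (- N) = 2 * b" using ab by simp
  also have "1 + \<mu> - (N + 1) = 2 * a" using ab by simp
  also have "reg_hyp2f1 (2 * b) (2 * a) (1 + \<mu>) z = reg_hyp2f1 (2 * a) (2 * b) (a + b + 1/2) z"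
    unfolding ab(1) by (subst reg_hyp2f1_commute) (rule refl)
  also have "reg_hyp2f1 (2 * a) (2 * b) (a + b + 1/2) z = reg_hyp2f1 a b (a + b + 1/2) (of_real (1 - t\<^sup>2))"
  proof -
    \<comment> \<open>The principal root of \<open>t^2\<close> is \<open>t\<close> because
      \<open>t\<close> is positive.\<close>
    have "(1 - csqrt (1 - of_real (1 - t\<^sup>2))) / 2 = z"
      using t by (simp add: z_def flip: of_real_power)
    moreover have "norm (complex_of_real (1 - t\<^sup>2)) < 1" unfolding norm_of_real using t2 by simp
    ultimately show ?thesis
      using quadratic_transformation[of a b "of_real (1 - t\<^sup>2)"] \<mu> unfolding ab(1) by simp
  qed
  finally have 1: "reg_hyp2f1 (- N) (N + 1) (1 + \<mu>) z = (1 - z) powr \<mu> * reg_hyp2f1 a b (1 + \<mu>) (of_real (1 - t\<^sup>2))"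
    unfolding ab(1) .
  have pw: "((1 + complex_of_real t) / (1 - of_real t)) powr (- \<mu> / 2) * (1 - z) powr \<mu> = 2 powr (- \<mu>) * of_real (1 - t\<^sup>2) powr (\<mu> / 2)"
  proof -
    have e: "complex_of_real r powr p = exp (p * of_real (ln r))" if "r > 0" for r p
      using that by (simp add: powr_def Ln_of_real)
    have c: "(1 + complex_of_real t) / (1 - of_real t) = of_real ((1 + t) / (1 - t))" "1 - z = of_real ((1 + t) / 2)" "(2::complex) = of_real 2"
      by (simp_all add: z_def field_simps)
    have l: "ln ((1 + t) / (1 - t)) = ln (1 + t) - ln (1 - t)" "ln ((1 + t) / 2) = ln (1 + t) - ln 2"
      using t by (simp_all add: ln_div)
    have "1 - t\<^sup>2 = (1 + t) * (1 - t)" by (simp add: algebra_simps power2_eq_square)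
    hence l2: "ln (1 - t\<^sup>2) = ln (1 + t) + ln (1 - t)" using t by (simp add: ln_mult)
    have "exp (- \<mu> / 2 * of_real (ln (1 + t) - ln (1 - t))) * exp (\<mu> * of_real (ln (1 + t) - ln 2)) =
        exp (- \<mu> * of_real (ln 2)) * exp (\<mu> / 2 * of_real (ln (1 + t) + ln (1 - t)))"
      unfolding exp_add[symmetric] by (rule arg_cong[of _ _ exp]) (simp add: field_simps)
    moreover have "0 < (1 + t) / (1 - t)" "0 < (1 + t) / 2" "0 < 1 - t\<^sup>2" using t t2 by auto
    ultimately show ?thesis unfolding c(1,2) unfolding c(3) by (simp only: e l l2 zero_less_numeral)
  qed
  show ?thesis unfolding ferrers_P_def z_def[symmetric] b_def[symmetric] minus_minus diff_minus_eq_add 1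
    unfolding a_def[symmetric] by (simp only: mult.assoc[symmetric] pw)
qed

text \<open>A second Euler transformation, now in the variable \<open>1 - t^2\<close>. Its exponent
  \<open>1 + \<mu> - a - b\<close> is 1/2, so the prefactor is the root of \<open>t^2\<close>; this
  is the \<open>t\<close> that cancels against the differential.\<close>

lemma ferrers_P_quadratic':
  assumes t: "0 < t" "t < (1::real)" and \<mu>: "1 + \<mu> \<notin> \<int>\<^sub>\<le>\<^sub>0"
  shows "ferrers_P N (- \<mu>) (of_real t) = of_real t * (2 powr (- \<mu>) * of_real (1 - t\<^sup>2) powr (\<mu> / 2)
           * reg_hyp2f1 ((\<mu> - N) / 2 + N + 1) ((\<mu> - N) / 2 + 1/2) (1 + \<mu>) (of_real (1 - t\<^sup>2)))"
proof -
  define a b where "a = (\<mu> - N) / 2" and "b = (\<mu> - N) / 2 + N + 1/2"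
  have t2: "0 < t\<^sup>2" "t\<^sup>2 < 1" using t by (auto simp: power_less_one_iff)
  have Y: "complex_of_real (1 - t\<^sup>2) \<in> cut_plane" unfolding cut_plane_iff using t2 by simp
  have "reg_hyp2f1 a b (1 + \<mu>) (of_real (1 - t\<^sup>2)) =
      (1 - of_real (1 - t\<^sup>2)) powr (1 + \<mu> - a - b) * reg_hyp2f1 (1 + \<mu> - a) (1 + \<mu> - b) (1 + \<mu>) (of_real (1 - t\<^sup>2))"
    by (rule euler_transformation[OF \<mu> Y])
  also have "1 + \<mu> - a - b = 1/2" by (simp add: a_def b_def field_simps)
  also have "1 + \<mu> - a = (\<mu> - N) / 2 + N + 1" by (simp add: a_def field_simps)
  also have "1 + \<mu> - b = (\<mu> - N) / 2 + 1/2" by (simp add: b_def field_simps)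
  also have "(1 - complex_of_real (1 - t\<^sup>2)) powr (1/2) = of_real t"
    unfolding csqrt_conv_powr[symmetric] using t by (simp flip: of_real_power)
  finally show ?thesis unfolding ferrers_P_quadratic[OF assms] a_def b_def by (simp only: mult_ac)
qed

text \<open>Since \<open>Y < 1\<close>, the coefficients times powers of \<open>Y\<close> are
  absolutely summable, and their sum \<open>S\<close> times the integrable Mellin integrand
  dominates the partial sums. The integrated terms are rewritten by
  \<open>mellin_value_shift\<close>.\<close>

lemma mellin_series:
  fixes c :: complex
  assumes Y: "0 < Y" "Y < (1::real)" and N: "Re N \<ge> -1/2" and a: "Re a > 0"
  defines "F \<equiv> \<lambda>v. of_real v powr (a - 1) * reg_hyp2f1 (a + N + 1) (a + 1/2) c (of_real (Y * v)) * reg_hyp2f1 (- N) (1/2) 1 (1 - of_real v)"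
  shows "F absolutely_integrable_on {0<..<1}"
    and "integral {0<..<1} F = mellin_value N a * reg_hyp2f1 a (a + N + 1/2) c (of_real Y)"
proof -
  define \<Phi> where "\<Phi> = (\<lambda>v. reg_hyp2f1 (- N) (1/2) 1 (1 - complex_of_real v))"
  define h where "h = hyp_coeff (a + N + 1) (a + 1/2) c"
  have Yn: "norm (complex_of_real Y) < 1" using Y by simp
  have su: "summable (\<lambda>n. norm (h n * of_real Y ^ n))" unfolding h_def by (rule hyp_coeff_summable[OF Yn])
  define S where "S = (\<Sum>n. norm (h n * of_real Y ^ n))"
  have trm: "((\<lambda>v. (h n * of_real (Y * v) ^ n) * (of_real v powr (a - 1) * \<Phi> v)) has_integral
      (mellin_value N a * (hyp_coeff a (a + N + 1/2) c n * of_real Y ^ n))) {0<..<1}" for n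
  proof -
    have an: "Re (a + of_nat n) > 0" using a by simp
    have "((\<lambda>v. of_real v powr (a + of_nat n - 1) * \<Phi> v) has_integral mellin_value N (a + of_nat n)) {0<..<1}"
      using mellin_transform[OF N an] unfolding \<Phi>_def
      by (simp add: has_integral_iff set_lebesgue_integral_eq_integral(1))
    hence "((\<lambda>v. (h n * of_real Y ^ n) * (of_real v powr (a + of_nat n - 1) * \<Phi> v)) has_integral
        (h n * of_real Y ^ n * mellin_value N (a + of_nat n))) {0<..<1}" by (rule has_integral_mult_right)
    moreover have "(h n * of_real Y ^ n) * (of_real v powr (a + of_nat n - 1) * \<Phi> v) =
        (h n * of_real (Y * v) ^ n) * (of_real v powr (a - 1) * \<Phi> v)" if "v \<in> {0<..<1}" for v
    proof -
      have "complex_of_real v powr (a + of_nat n - 1) = of_real v powr (a - 1) * of_real v powr (of_nat n)"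
        by (simp flip: powr_add add: algebra_simps)
      also have "complex_of_real v powr (of_nat n) = of_real v ^ n" using that by (simp add: powr_nat)
      finally show ?thesis by (simp add: power_mult_distrib mult_ac)
    qed
    ultimately have "((\<lambda>v. (h n * of_real (Y * v) ^ n) * (of_real v powr (a - 1) * \<Phi> v)) has_integral
        (h n * of_real Y ^ n * mellin_value N (a + of_nat n))) {0<..<1}"
      by (rule has_integral_eq[rotated])
    moreover have "h n * of_real Y ^ n * mellin_value N (a + of_nat n) = mellin_value N a * (hyp_coeff a (a + N + 1/2) c n * of_real Y ^ n)"
    proof -
      have "h n * of_real Y ^ n * mellin_value N (a + of_nat n) = (h n * mellin_value N (a + of_nat n)) * of_real Y ^ n"
        by (simp only: mult_ac)
      also have "h n * mellin_value N (a + of_nat n) = mellin_value N a * hyp_coeff a (a + N + 1/2) c n"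
        unfolding h_def by (rule mellin_value_shift[OF a N])
      finally show ?thesis by (simp only: mult_ac)
    qed
    ultimately show ?thesis by (simp only:)
  qed
  have dom0: "(\<lambda>v. of_real v powr (a - 1) * \<Phi> v) absolutely_integrable_on {0<..<1}"
    unfolding \<Phi>_def by (rule mellin_transform(1)[OF N a])
  have g: "(\<lambda>v. S * norm (of_real v powr (a - 1) * \<Phi> v)) integrable_on {0<..<1}"
    using dom0 unfolding absolutely_integrable_on_def by (intro integrable_on_mult_right) auto
  have pw: "norm (h n * of_real (Y * v) ^ n) \<le> norm (h n * of_real Y ^ n)" if "v \<in> {0<..<1}" for v n
    using that Y unfolding norm_mult norm_power norm_of_real
    by (intro mult_left_mono power_mono) (auto simp: abs_mult mult_left_le)
  have Sbd: "norm (\<Sum>n<k. h n * of_real (Y * v) ^ n) \<le> S" if v: "v \<in> {0<..<1}" for v k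
  proof -
    have "norm (\<Sum>n<k. h n * of_real (Y * v) ^ n) \<le> (\<Sum>n<k. norm (h n * of_real (Y * v) ^ n))" by (rule norm_sum)
    also have "\<dots> \<le> (\<Sum>n<k. norm (h n * of_real Y ^ n))" by (intro sum_mono pw v)
    also have "\<dots> \<le> S" unfolding S_def by (intro sum_le_suminf su) auto
    finally show ?thesis .
  qed
  have lim: "(\<lambda>k. \<Sum>n<k. h n * of_real (Y * v) ^ n) \<longlonglongrightarrow> reg_hyp2f1 (a + N + 1) (a + 1/2) c (of_real (Y * v))" if v: "v \<in> {0<..<1}" for v
  proof -
    have "\<bar>Y * v\<bar> < 1" using v Y by (simp add: abs_mult) (smt (verit) mult_left_le)
    hence n: "norm (complex_of_real (Y * v)) < 1" by (simp only: norm_of_real)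
    show ?thesis using hyp_coeff_sums[OF n, of "a + N + 1" "a + 1/2" c]
      unfolding sums_def h_def reg_hyp2f1_eq_series[OF n] .
  qed
  have F: "F = (\<lambda>v. reg_hyp2f1 (a + N + 1) (a + 1/2) c (of_real (Y * v)) * (of_real v powr (a - 1) * \<Phi> v))"
    by (simp add: F_def \<Phi>_def fun_eq_iff mult_ac)
  have int: "(F has_integral (mellin_value N a * reg_hyp2f1 a (a + N + 1/2) c (of_real Y))) {0<..<1}"
  proof (rule has_integral_dominated_convergence[OF _ g])
    show "((\<lambda>v. \<Sum>n<k. (h n * of_real (Y * v) ^ n) * (of_real v powr (a - 1) * \<Phi> v)) has_integral
      (\<Sum>n<k. mellin_value N a * (hyp_coeff a (a + N + 1/2) c n * of_real Y ^ n))) {0<..<1}" for k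
      by (intro has_integral_sum trm) auto
    show "\<forall>v\<in>{0<..<1}. norm (\<Sum>n<k. (h n * of_real (Y * v) ^ n) * (of_real v powr (a - 1) * \<Phi> v)) \<le> S * norm (of_real v powr (a - 1) * \<Phi> v)" for k
      unfolding sum_distrib_right[symmetric] using Sbd by (auto simp only: norm_mult intro!: mult_right_mono norm_ge_zero mult_nonneg_nonneg)
    show "\<forall>v\<in>{0<..<1}. (\<lambda>k. \<Sum>n<k. (h n * of_real (Y * v) ^ n) * (of_real v powr (a - 1) * \<Phi> v)) \<longlonglongrightarrow> F v"
      unfolding sum_distrib_right[symmetric] F by (intro ballI tendsto_mult tendsto_const lim)
    have "(\<lambda>n. mellin_value N a * (hyp_coeff a (a + N + 1/2) c n * of_real Y ^ n)) sums (mellin_value N a * reg_hyp2f1 a (a + N + 1/2) c (of_real Y))"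
      unfolding reg_hyp2f1_eq_series[OF Yn] by (intro sums_mult hyp_coeff_sums Yn)
    thus "(\<lambda>k. \<Sum>n<k. mellin_value N a * (hyp_coeff a (a + N + 1/2) c n * of_real Y ^ n)) \<longlonglongrightarrow> mellin_value N a * reg_hyp2f1 a (a + N + 1/2) c (of_real Y)"
      unfolding sums_def .
  qed
  thus "integral {0<..<1} F = mellin_value N a * reg_hyp2f1 a (a + N + 1/2) c (of_real Y)" by (rule integral_unique)
  show "F absolutely_integrable_on {0<..<1}"
  proof (rule absolutely_integrable_integrable_bound[OF _ _ g])
    show "F integrable_on {0<..<1}" using int by (rule has_integral_integrable)
    fix v :: real assume v: "v \<in> {0<..<1}"
    have "norm (reg_hyp2f1 (a + N + 1) (a + 1/2) c (of_real (Y * v))) \<le> S"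
      by (rule tendsto_upperbound[OF tendsto_norm[OF lim[OF v]]]) (use Sbd[OF v] in auto)
    thus "norm (F v) \<le> S * norm (of_real v powr (a - 1) * \<Phi> v)"
      unfolding F norm_mult by (intro mult_right_mono) auto
  qed
qed

text \<open>For these \<open>x\<close> the formula of \<open>ferrers_P_quadratic'\<close> is valid
  along the whole open segment, and \<open>V\<close> maps it bijectively onto the unit
  interval.\<close>

lemma segment_integral_real:
  assumes x: "0 < x" "x < (1::real)" and N: "Re N \<ge> -1/2" and \<mu>: "Re (\<mu> - N) > 0"
  shows "integral {0<..<1} (segment_integrand N \<mu> (of_real x)) =
           ferrers_P N (- \<mu>) (of_real x) * (mellin_value N ((\<mu> - N) / 2) / 2)"
proof -
  define a where "a = (\<mu> - N) / 2"
  have a: "Re a > 0" using \<mu> by (simp add: a_def)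
  have c: "1 + \<mu> \<notin> \<int>\<^sub>\<le>\<^sub>0" using N \<mu> by (intro Re_pos_notin_nonpos_Ints) simp
  have dom: "complex_of_real x \<in> ferrers_domain" using x by (simp add: ferrers_domain_iff)
  define Y where "Y = 1 - x\<^sup>2"
  have Y: "0 < Y" "Y < 1" using x by (auto simp: Y_def power_less_one_iff)
  define t where "t = (\<lambda>s::real. x + s * (1 - x))"
  have t: "x < t s" "0 < t s" "t s < 1" if "s \<in> {0<..<1}" for s
  proof -
    have "s * (1 - x) > 0" using that x by simp
    thus "x < t s" "0 < t s" using x by (auto simp: t_def)
    have "s * (1 - x) < 1 * (1 - x)" using that x by (intro mult_strict_right_mono) auto
    thus "t s < 1" by (simp add: t_def)
  qed
  define V V' where "V = (\<lambda>s. (1 - (t s)\<^sup>2) / Y)" and "V' = (\<lambda>s. - 2 * t s * (1 - x) / Y)"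
  have Vpos: "0 < V s" "V s < 1" if "s \<in> {0<..<1}" for s
  proof -
    have "(t s)\<^sup>2 < 1" "x\<^sup>2 < (t s)\<^sup>2"
      using t[OF that] x by (auto simp: power_less_one_iff intro: power_strict_mono)
    thus "0 < V s" "V s < 1" using Y by (auto simp: V_def Y_def)
  qed
  have V_image: "V ` {0<..<1} = {0<..<1}"
  proof (intro equalityI subsetI)
    fix v assume v: "v \<in> {0<..<1::real}"
    \<comment> \<open>The point of the segment at which \<open>V\<close> takes the value
      \<open>v\<close>, from \<open>1 - u^2 = Y v\<close>.\<close>
    define u where "u = sqrt (1 - Y * v)"
    have Yv: "0 < Y * v" "Y * v < Y" using v Y by auto
    have Yv1: "Y * v \<le> 1" using Yv Y by linarith
    have u2: "u\<^sup>2 = 1 - Y * v" unfolding u_def using Yv1 by simp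
    have "x\<^sup>2 < u\<^sup>2" "u\<^sup>2 < 1" unfolding u2 using Yv by (auto simp: Y_def)
    moreover have "u \<ge> 0" unfolding u_def using Yv1 by simp
    ultimately have u: "x < u" "u < 1" using x by (auto intro: power_less_imp_less_base simp: power_less_one_iff)
    define s where "s = (u - x) / (1 - x)"
    have s: "s \<in> {0<..<1}" using u x by (auto simp: s_def)
    have "t s = u" using x by (simp add: t_def s_def)
    hence "V s = v" using u2 Y by (simp add: V_def)
    thus "v \<in> V ` {0<..<1}" using s by blast
  qed (use Vpos in auto)
  have inj: "inj_on V {0<..<1}"
  proof (rule inj_onI)
    fix r s assume rs: "r \<in> {0<..<1}" "s \<in> {0<..<1}" "V r = V s"
    hence "(t r)\<^sup>2 = (t s)\<^sup>2" using Y by (simp add: V_def)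
    hence "t r = t s" using t(2)[OF rs(1)] t(2)[OF rs(2)] by simp
    thus "r = s" using x by (simp add: t_def)
  qed
  have der: "(V has_field_derivative V' s) (at s within {0<..<1})" for s
    unfolding V_def V'_def t_def using Y by (auto intro!: derivative_eq_intros simp: field_simps)
  define F where "F = (\<lambda>v. of_real v powr (a - 1) * reg_hyp2f1 (a + N + 1) (a + 1/2) (1 + \<mu>) (of_real (Y * v)) * reg_hyp2f1 (- N) (1/2) 1 (1 - of_real v))"
  \<comment> \<open>The factors independent of \<open>s\<close>; the division by 2 compensates the 2
    in \<open>V'\<close>.\<close>
  define k where "k = 2 powr (- \<mu>) * complex_of_real Y powr (\<mu> / 2) / 2"
  have F: "F absolutely_integrable_on {0<..<1}"
    "integral {0<..<1} F = mellin_value N a * reg_hyp2f1 a (a + N + 1/2) (1 + \<mu>) (of_real Y)"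
    unfolding F_def by (rule mellin_series[OF Y N a])+
  have eq: "segment_integrand N \<mu> (of_real x) s = k * (of_real \<bar>V' s\<bar> * F (V s))" if s: "s \<in> {0<..<1}" for s
  proof -
    define T v where "T = t s" and "v = V s"
    have T: "0 < T" "T < 1" unfolding T_def using t[OF s] by auto
    have v: "v > 0" unfolding v_def using Vpos[OF s] by auto
    have Yv: "1 - T\<^sup>2 = Y * v" unfolding T_def v_def V_def using Y by simp
    have lp: "linepath (of_real x) 1 s = complex_of_real T"
      by (simp add: linepath_def T_def t_def scaleR_conv_of_real algebra_simps)
    have ratio: "of_real (1 - s) * segment_ratio (of_real x) s = complex_of_real v"
    proof -
      have "of_real (1 - s) * segment_ratio (of_real x) s * (1 - complex_of_real x ^ 2) = 1 - (complex_of_real T)\<^sup>2"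
        using segment_eqs(4)[OF dom, of s] unfolding lp by simp
      also have "\<dots> = of_real (1 - T\<^sup>2)" by simp
      also have "\<dots> = of_real v * (1 - complex_of_real x ^ 2)" unfolding Yv by (simp add: Y_def)
      finally show ?thesis using Y by (simp add: Y_def flip: of_real_power)
    qed
    have L: "legendre_P N ((2 - (of_real x)\<^sup>2 - (of_real T)\<^sup>2) / (2 * (csqrt (1 - (of_real x)\<^sup>2) * csqrt (1 - (of_real T)\<^sup>2)))) =
        of_real v powr (- N / 2) * reg_hyp2f1 (- N) (1/2) 1 (1 - of_real v)"
      using legendre_kernel[OF dom, of s N] s unfolding lp ratio by simp
    have P: "ferrers_P N (- \<mu>) (of_real T) = of_real T * (2 powr (- \<mu>) * of_real (Y * v) powr (\<mu> / 2)
           * reg_hyp2f1 (a + N + 1) (a + 1/2) (1 + \<mu>) (of_real (Y * v)))"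
      using ferrers_P_quadratic'[OF T c, of N] unfolding Yv a_def .
    have pw: "complex_of_real (Y * v) powr (\<mu> / 2) = of_real Y powr (\<mu> / 2) * of_real v powr (\<mu> / 2)"
      using powr_of_real_mult[OF Y(1), of "of_real v" "\<mu> / 2"] v by simp
    have T2: "1 - (complex_of_real T)\<^sup>2 = of_real Y * of_real v"
      using arg_cong[OF Yv, of complex_of_real] by simp
    have absV: "\<bar>V' s\<bar> = 2 * T * (1 - x) / Y"
      using T x Y by (simp add: V'_def T_def[symmetric] abs_mult)
    have absV': "complex_of_real \<bar>V' s\<bar> = 2 * of_real T * (1 - of_real x) / of_real Y"
      unfolding absV by simp
    have va: "complex_of_real v powr (a - 1) = of_real v powr (\<mu> / 2) * of_real v powr (- N / 2) / of_real v"
    proof -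
      have "a - 1 = \<mu> / 2 + (- N / 2) - 1" by (simp add: a_def diff_divide_distrib)
      thus ?thesis using v by (simp only: powr_diff powr_add) simp
    qed
    \<comment> \<open>The letter \<open>\<tau>\<close> is the factor \<open>t\<close> split off by
      \<open>ferrers_P_quadratic'\<close>; on the right it belongs to the derivative
      \<open>V'\<close>.\<close>
    have gen: "\<tau> * (A * (B * C) * R) * (D * E) / (y * w) * q = A * B / 2 * (2 * \<tau> * q / y * (C * D / w * R * E))"
      for \<tau> A B C D E R y w q :: complex by simp
    have "segment_integrand N \<mu> (of_real x) s = ferrers_integrand N \<mu> (of_real x) (of_real T) * (1 - of_real x)"
      using segment_integrand_eq[OF dom, of s N \<mu>] s unfolding lp by simp
    also have "\<dots> = k * (of_real \<bar>V' s\<bar> * F v)"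
      unfolding ferrers_integrand_def L
      unfolding P pw T2 absV' F_def va k_def
      by (rule gen)
    finally show ?thesis unfolding v_def .
  qed
  have "((\<lambda>s. of_real \<bar>V' s\<bar> * F (V s)) has_integral integral {0<..<1} F) {0<..<1}"
    using complex_change_of_variables[of "{0<..<1}" V V' F] der inj F(1) unfolding V_image by auto
  hence "((\<lambda>s. k * (of_real \<bar>V' s\<bar> * F (V s))) has_integral k * integral {0<..<1} F) {0<..<1}"
    by (rule has_integral_mult_right)
  hence "(segment_integrand N \<mu> (of_real x) has_integral k * integral {0<..<1} F) {0<..<1}"
    by (rule has_integral_eq[rotated]) (simp add: eq)
  hence "integral {0<..<1} (segment_integrand N \<mu> (of_real x)) = k * integral {0<..<1} F" by (rule integral_unique)
  also have "\<dots> = ferrers_P N (- \<mu>) (of_real x) * (mellin_value N a / 2)"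
    unfolding F(2) ferrers_P_quadratic[OF x c] k_def a_def[symmetric] Y_def[symmetric] by (simp add: mult_ac)
  finally show ?thesis unfolding a_def .
qed

lemma ferrers_P_holomorphic: "ferrers_P N \<mu> holomorphic_on ferrers_domain"
proof -
  have "(reg_hyp2f1 (- N) (N + 1) (1 - \<mu>) \<circ> (\<lambda>x. (1 - x) / 2)) holomorphic_on ferrers_domain"
    by (rule holomorphic_on_compose_gen[OF _ reg_hyp2f1_holomorphic])
       (use ferrers_domain_facts(5) in \<open>auto intro!: holomorphic_intros\<close>)
  hence "(\<lambda>x. reg_hyp2f1 (- N) (N + 1) (1 - \<mu>) ((1 - x) / 2)) holomorphic_on ferrers_domain" by (simp only: o_def)
  thus ?thesis unfolding ferrers_P_def
    by (intro holomorphic_intros) (use quotient_notin_nonpos_Reals ferrers_domain_facts in auto)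
qed

theorem ferrers_integral_equation:
  assumes x: "x \<in> ferrers_domain" and N: "Re N \<ge> -1/2" and \<mu>: "Re (\<mu> - N) > 0"
  shows "(ferrers_integrand N \<mu> x has_contour_integral
            ferrers_P N (- \<mu>) x * (mellin_value N ((\<mu> - N) / 2) / 2)) (linepath x 1)"
proof -
  define m where "m = mellin_value N ((\<mu> - N) / 2) / 2"
  have "integral {0<..<1} (segment_integrand N \<mu> x) - ferrers_P N (- \<mu>) x * m = 0"
  proof (rule analytic_continuation[of "\<lambda>x. integral {0<..<1} (segment_integrand N \<mu> x) - ferrers_P N (- \<mu>) x * m"
        ferrers_domain "complex_of_real ` {0<..<1}" "1/2" x])
    show "(\<lambda>x. integral {0<..<1} (segment_integrand N \<mu> x) - ferrers_P N (- \<mu>) x * m) holomorphic_on ferrers_domain"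
      by (intro holomorphic_intros segment_integral_holomorphic[OF N \<mu>] ferrers_P_holomorphic)
    show "(1/2::complex) islimpt complex_of_real ` {0<..<1}"
      unfolding islimpt_approachable
    proof (intro allI impI)
      fix e :: real assume e: "e > 0"
      define d where "d = min (1/4) (e/2)"
      have d: "0 < d" "d \<le> 1/4" "d < e" using e by (auto simp: d_def)
      have "dist (complex_of_real (1/2 + d)) (complex_of_real (1/2)) < e"
        unfolding dist_of_real using d by (simp add: dist_real_def)
      moreover have "complex_of_real (1/2 + d) \<noteq> complex_of_real (1/2)" using d by (simp only: of_real_eq_iff)
      ultimately show "\<exists>x'\<in>complex_of_real ` {0<..<1}. x' \<noteq> 1 / 2 \<and> dist x' (1 / 2) < e"
        using d by (intro bexI[of _ "complex_of_real (1/2 + d)"] image_eqI[of _ _ "1/2 + d"]) auto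
    qed
    show "integral {0<..<1} (segment_integrand N \<mu> z) - ferrers_P N (- \<mu>) z * m = 0"
      if "z \<in> complex_of_real ` {0<..<1}" for z
      using that segment_integral_real[OF _ _ N \<mu>] by (auto simp: m_def)
  qed (use x open_ferrers_domain connected_ferrers_domain in \<open>auto simp: ferrers_domain_iff\<close>)
  hence "(segment_integrand N \<mu> x has_integral ferrers_P N (- \<mu>) x * m) {0<..<1}"
    using segment_integrand_absolutely_integrable[OF x N \<mu>]
    by (simp add: has_integral_iff set_lebesgue_integral_eq_integral(1))
  thus ?thesis unfolding ferrers_contour_integral_iff[OF x] m_def .
qed

subsection \<open>Divergence of the integral\<close>

text \<open>An indefinite integral is continuous at 1, so its increments over windows shrinking to 1
  tend to 0. If the power oscillates, only narrow windows of the form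
  \<open>1 - \<kappa> * \<delta>\<close> to \<open>1 - \<delta>\<close> avoid cancellation; on them
  the increment stays above a constant independent of \<open>\<delta>\<close>.\<close>

lemma power_singularity_not_integrable:
  fixes H :: "real \<Rightarrow> complex"
  assumes \<gamma>: "Re \<gamma> \<le> 0" and H0: "H0 \<noteq> 0" and lim: "(H \<longlongrightarrow> H0) (at 1 within {0<..<1})"
  shows "\<not> (\<lambda>s. of_real (1 - s) powr (\<gamma> - 1) * H s) integrable_on {0<..<1}"
proof
  define f where "f = (\<lambda>s. complex_of_real (1 - s) powr (\<gamma> - 1) * H s)"
  assume "(\<lambda>s. of_real (1 - s) powr (\<gamma> - 1) * H s) integrable_on {0<..<1}"
  hence int: "f integrable_on {0..1}" by (simp add: f_def integrable_on_Icc_iff_Ioo)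
  have "((\<lambda>\<rho>. complex_of_real \<rho> powr (\<gamma> - 1)) \<longlongrightarrow> of_real 1 powr (\<gamma> - 1)) (at 1)"
    by (intro tendsto_powr_complex tendsto_intros) auto
  hence "((\<lambda>\<rho>. complex_of_real \<rho> powr (\<gamma> - 1)) \<longlongrightarrow> 1) (at 1)" by simp
  then obtain d where d: "d > 0" "\<And>\<rho>. \<rho> \<noteq> 1 \<Longrightarrow> dist \<rho> 1 < d \<Longrightarrow> dist (complex_of_real \<rho> powr (\<gamma> - 1)) 1 < 1/4"
    unfolding tendsto_iff eventually_at by (metis UNIV_I zero_less_divide_1_iff zero_less_numeral)
  \<comment> \<open>So close to 1 that the power of a ratio between 1 and \<open>\<kappa>\<close>
    differs from 1 by at most 1/4.\<close>
  define \<kappa> where "\<kappa> = 1 + min (d/2) 1"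
  have \<kappa>: "1 < \<kappa>" "\<kappa> \<le> 2" "\<kappa> < 1 + d" using d(1) by (auto simp: \<kappa>_def min_def)
  have rho: "norm (complex_of_real \<rho> powr (\<gamma> - 1) - 1) \<le> 1/4" if "\<rho> \<in> {1..\<kappa>}" for \<rho>
    using d(2)[of \<rho>] that \<kappa> by (cases "\<rho> = 1") (auto simp: dist_norm intro: less_imp_le)
  \<comment> \<open>The scale-free lower bound for the increment: half of \<open>norm H0\<close>
    times the relative length of the window.\<close>
  define c where "c = norm H0 / 2 * (\<kappa> - 1)"
  have c: "c > 0" using H0 \<kappa> by (simp add: c_def)
  define I where "I = (\<lambda>s. integral {0..s} f)"
  have "continuous_on {0..1} I" unfolding I_def by (rule indefinite_integral_continuous_1[OF int])
  then obtain e1 where e1: "e1 > 0" "\<And>s. s \<in> {0..1} \<Longrightarrow> dist s 1 < e1 \<Longrightarrow> dist (I s) (I 1) < c / 2"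
    unfolding continuous_on_iff using c by (metis atLeastAtMost_iff half_gt_zero order_refl zero_le_one)
  obtain e2 where e2: "e2 > 0" "\<And>s. s \<in> {0<..<1} \<Longrightarrow> dist s 1 < e2 \<Longrightarrow> dist (H s) H0 < norm H0 / 4"
    using lim H0 unfolding tendsto_iff eventually_at
    by (metis greaterThanLessThan_iff less_irrefl zero_less_divide_iff zero_less_norm_iff zero_less_numeral)
  \<comment> \<open>The division by 4 leaves room for \<open>\<kappa> * \<delta>\<close>, which is
    at most \<open>2 * \<delta>\<close>.\<close>
  define \<delta> where "\<delta> = min (min e1 e2) 1 / 4"
  have \<delta>: "\<delta> > 0" "\<kappa> * \<delta> < e1" "\<kappa> * \<delta> < e2" "\<kappa> * \<delta> < 1" "\<delta> < e1" "\<delta> < e2" "\<delta> < \<kappa> * \<delta>"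
  proof -
    show p: "\<delta> > 0" using e1 e2 by (simp add: \<delta>_def)
    have "\<kappa> * \<delta> \<le> 2 * \<delta>" using p \<kappa> by (intro mult_right_mono) auto
    moreover have "2 * \<delta> < e1" "2 * \<delta> < e2" "2 * \<delta> < 1" using e1(1) e2(1) by (auto simp: \<delta>_def min_def)
    ultimately show "\<kappa> * \<delta> < e1" "\<kappa> * \<delta> < e2" "\<kappa> * \<delta> < 1" "\<delta> < e1" "\<delta> < e2" using p by linarith+
    show "\<delta> < \<kappa> * \<delta>" using p \<kappa> by simp
  qed
  define J where "J = {1 - \<kappa> * \<delta>..1 - \<delta>}"
  define D where "D = complex_of_real \<delta> powr (\<gamma> - 1)"
  have intJ: "f integrable_on J" unfolding J_def
    by (rule integrable_subinterval_real[OF int]) (use \<delta> in auto)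
  \<comment> \<open>On the window \<open>f\<close> is nearly the constant \<open>D * H0\<close>: an
    error of 1/4 comes from \<open>H\<close> and another 1/4 from the power, relative to the norm of
    this constant.\<close>
  have est: "norm (f s - D * H0) \<le> norm D * (norm H0 / 2)" if s: "s \<in> J" for s
  proof -
    define \<rho> where "\<rho> = (1 - s) / \<delta>"
    have \<rho>: "\<rho> \<in> {1..\<kappa>}" using s \<delta>(1) by (auto simp: \<rho>_def J_def field_simps)
    have "1 - s = \<delta> * \<rho>" using \<delta>(1) by (simp add: \<rho>_def)
    hence "complex_of_real (1 - s) powr (\<gamma> - 1) = D * of_real \<rho> powr (\<gamma> - 1)"
      using powr_of_real_mult[OF \<delta>(1), of "of_real \<rho>" "\<gamma> - 1"] \<rho> by (simp add: D_def)
    hence "f s - D * H0 = D * (of_real \<rho> powr (\<gamma> - 1) * (H s - H0) + (of_real \<rho> powr (\<gamma> - 1) - 1) * H0)"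
      by (simp add: f_def algebra_simps)
    also have "norm \<dots> \<le> norm D * (1 * (norm H0 / 4) + 1/4 * norm H0)"
      unfolding norm_mult
    proof (intro mult_left_mono order_trans[OF norm_triangle_ineq] add_mono)
      have "\<rho> powr (Re \<gamma> - 1) \<le> 1 powr (Re \<gamma> - 1)" using \<rho> \<gamma> by (intro powr_mono2') auto
      hence "norm (complex_of_real \<rho> powr (\<gamma> - 1)) \<le> 1" using \<rho> by (simp add: norm_powr_real_powr)
      moreover have "norm (H s - H0) \<le> norm H0 / 4"
      proof -
        have "s \<in> {0<..<1}" "dist s 1 < e2" using s \<delta> by (auto simp: J_def dist_real_def)
        thus ?thesis using e2(2)[of s] by (simp add: dist_norm)
      qed
      ultimately show "norm (complex_of_real \<rho> powr (\<gamma> - 1) * (H s - H0)) \<le> 1 * (norm H0 / 4)"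
        unfolding norm_mult by (intro mult_mono) auto
      show "norm ((complex_of_real \<rho> powr (\<gamma> - 1) - 1) * H0) \<le> 1/4 * norm H0"
        unfolding norm_mult using rho[OF \<rho>] by (intro mult_right_mono) auto
    qed auto
    finally show ?thesis by simp
  qed
  have "((\<lambda>s. f s - D * H0) has_integral (integral J f - ((1 - \<delta>) - (1 - \<kappa> * \<delta>)) *\<^sub>R (D * H0))) J"
    unfolding J_def
  proof (intro has_integral_diff)
    show "(f has_integral integral {1 - \<kappa> * \<delta>..1 - \<delta>} f) {1 - \<kappa> * \<delta>..1 - \<delta>}"
      using intJ unfolding J_def by (rule integrable_integral)
    show "((\<lambda>s. D * H0) has_integral ((1 - \<delta>) - (1 - \<kappa> * \<delta>)) *\<^sub>R (D * H0)) {1 - \<kappa> * \<delta>..1 - \<delta>}"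
      using has_integral_const_real[of "D * H0" "1 - \<kappa> * \<delta>" "1 - \<delta>"] \<delta> by simp
  qed
  moreover have len: "(1 - \<delta>) - (1 - \<kappa> * \<delta>) = (\<kappa> - 1) * \<delta>" by (simp add: algebra_simps)
  ultimately have hi: "((\<lambda>s. f s - D * H0) has_integral (integral J f - ((\<kappa> - 1) * \<delta>) *\<^sub>R (D * H0))) (cbox (1 - \<kappa> * \<delta>) (1 - \<delta>))"
    by (simp only: J_def box_real)
  have "norm (integral J f - ((\<kappa> - 1) * \<delta>) *\<^sub>R (D * H0)) \<le> norm D * (norm H0 / 2) * measure lborel (cbox (1 - \<kappa> * \<delta>) (1 - \<delta>))"
  proof (rule has_integral_bound[OF _ hi])
    show "norm (f s - D * H0) \<le> norm D * (norm H0 / 2)" if "s \<in> cbox (1 - \<kappa> * \<delta>) (1 - \<delta>)" for s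
      using est[of s] that by (simp only: J_def box_real)
  qed simp
  moreover have "measure lborel (cbox (1 - \<kappa> * \<delta>) (1 - \<delta>)) = (\<kappa> - 1) * \<delta>"
    using \<delta> len by simp
  ultimately have "norm (integral J f - ((\<kappa> - 1) * \<delta>) *\<^sub>R (D * H0)) \<le> norm D * (norm H0 / 2) * ((\<kappa> - 1) * \<delta>)"
    by (simp only:)
  moreover have "norm (((\<kappa> - 1) * \<delta>) *\<^sub>R (D * H0)) = norm D * norm H0 * ((\<kappa> - 1) * \<delta>)"
    using \<kappa> \<delta>(1) by (simp add: norm_mult mult_ac)
  moreover have "norm (((\<kappa> - 1) * \<delta>) *\<^sub>R (D * H0)) \<le>
      norm (integral J f) + norm (integral J f - ((\<kappa> - 1) * \<delta>) *\<^sub>R (D * H0))"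
    using norm_triangle_ineq4[of "integral J f" "integral J f - ((\<kappa> - 1) * \<delta>) *\<^sub>R (D * H0)"] by simp
  ultimately have "norm (integral J f) \<ge> norm D * \<delta> * c"
    by (simp add: c_def algebra_simps)
  \<comment> \<open>The product is \<open>\<delta>\<close> to the power \<open>Re \<gamma>\<close>,
    and both \<open>Re \<gamma> \<le> 0\<close> and \<open>\<delta> \<le> 1\<close>. This removes
    the dependence on \<open>\<delta>\<close>.\<close>
  moreover have "norm D * \<delta> \<ge> 1"
  proof -
    have "norm D * \<delta> = \<delta> powr (Re \<gamma> - 1) * \<delta> powr 1" using \<delta>(1) by (simp add: D_def norm_powr_real_powr)
    also have "\<dots> = \<delta> powr Re \<gamma>" by (simp only: powr_add[symmetric]) simp
    also have "\<dots> \<ge> 1 powr Re \<gamma>"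
    proof (rule powr_mono2')
      show "\<delta> \<le> 1" using \<delta>(4,7) by linarith
    qed (use \<gamma> \<delta>(1) in auto)
    finally show ?thesis by simp
  qed
  hence "1 * c \<le> norm D * \<delta> * c" by (rule mult_right_mono) (use c in simp)
  ultimately have "norm (integral J f) \<ge> c" by linarith
  hence big: "norm (I (1 - \<delta>) - I (1 - \<kappa> * \<delta>)) \<ge> c" if "integral J f = I (1 - \<delta>) - I (1 - \<kappa> * \<delta>)"
    using that by simp
  have "integral J f = I (1 - \<delta>) - I (1 - \<kappa> * \<delta>)"
  proof -
    have "integral {0..1 - \<kappa> * \<delta>} f + integral {1 - \<kappa> * \<delta>..1 - \<delta>} f = integral {0..1 - \<delta>} f"
      using \<delta> by (intro Henstock_Kurzweil_Integration.integral_combine integrable_subinterval_real[OF int]) auto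
    thus ?thesis by (simp add: I_def J_def algebra_simps)
  qed
  note big = big[OF this]
  have near: "dist (I (1 - \<eta>)) (I 1) < c / 2" if "0 \<le> \<eta>" "\<eta> < 1" "\<eta> < e1" for \<eta>
    using e1(2)[of "1 - \<eta>"] that by (simp add: dist_real_def)
  have d0: "0 \<le> \<delta>" "\<delta> < 1" "0 \<le> \<kappa> * \<delta>" using \<delta>(1,4,7) by linarith+
  have "dist (I (1 - \<delta>)) (I 1) < c / 2" by (rule near[OF d0(1,2) \<delta>(5)])
  moreover have "dist (I (1 - \<kappa> * \<delta>)) (I 1) < c / 2" by (rule near[OF d0(3) \<delta>(4,2)])
  ultimately have "dist (I (1 - \<delta>)) (I (1 - \<kappa> * \<delta>)) < c"
    using dist_triangle2[of "I (1 - \<delta>)" "I (1 - \<kappa> * \<delta>)" "I 1"] by linarith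
  with big show False by (simp add: dist_norm)
qed

text \<open>Since \<open>Re N\<close> exceeds -1/2 strictly, the hypergeometric kernel factor has
  the nonzero limit \<open>Beta (1/2) (N + 1/2) / pi\<close> at the endpoint. The remaining factor
  is nonzero there because \<open>rGamma (1 + \<mu>)\<close> is, so the pure power decides.\<close>

lemma segment_integrand_not_integrable:
  assumes x: "x \<in> ferrers_domain" and N: "Re N > -1/2" and \<mu>: "Re (\<mu> - N) \<le> 0" and c: "1 + \<mu> \<notin> \<int>\<^sub>\<le>\<^sub>0"
  shows "\<not> segment_integrand N \<mu> x integrable_on {0<..<1}"
proof -
  define H where "H = (\<lambda>s. segment_smooth N \<mu> x s * reg_hyp2f1 (- N) (1/2) 1 (1 - of_real (1 - s) * segment_ratio x s))"
  define H0 where "H0 = segment_smooth N \<mu> x 1 * (Beta (1/2) (N + 1/2) / of_real pi)"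
  define W where "W = segment_ratio x ` {0..1}"
  have W: "compact W" "W \<inter> \<real>\<^sub>\<le>\<^sub>0 = {}"
    unfolding W_def using segment_ratio_notin_nonpos_Reals[OF x]
    by (auto intro!: compact_continuous_image continuous_on_section[OF continuous_on_segment_ratio x])
  have "(H \<longlongrightarrow> H0) (at 1 within {0<..<1})"
    unfolding tendsto_at_iff_sequentially
  proof (intro allI impI)
    fix X :: "nat \<Rightarrow> real" assume "\<forall>i. X i \<in> {0<..<1} - {1}" and X1: "X \<longlonglongrightarrow> 1"
    hence X: "X i \<in> {0<..<1}" for i by blast
    have r: "1 - X n \<in> {0<..1}" "(\<lambda>n. 1 - X n) \<longlonglongrightarrow> 0" for n
      using X[of n] tendsto_diff[OF tendsto_const[of 1] X1] by auto
    have w: "segment_ratio x (X n) \<in> W" for n using X[of n] by (auto simp: W_def)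
    have "(\<lambda>n. euler_integral (- N) (1/2) 1 (1 - of_real (1 - X n) * segment_ratio x (X n))) \<longlonglongrightarrow> Beta (1/2) (1 - 1/2 + N)"
      by (rule euler_integral_limit[OF W w, where q = "min (Re N) 0"]) (use N r in \<open>auto simp: min_def\<close>)
    hence "(\<lambda>n. euler_integral (- N) (1/2) 1 (1 - of_real (1 - X n) * segment_ratio x (X n)) / of_real pi) \<longlonglongrightarrow> Beta (1/2) (N + 1/2) / of_real pi"
      by (intro tendsto_divide tendsto_const) (auto simp: add.commute)
    moreover have "euler_integral (- N) (1/2) 1 (1 - of_real (1 - X n) * segment_ratio x (X n)) / of_real pi =
        reg_hyp2f1 (- N) (1/2) 1 (1 - of_real (1 - X n) * segment_ratio x (X n))" for n
    proof -
      define Z where "Z = 1 - complex_of_real (1 - X n) * segment_ratio x (X n)"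
      have "Z \<in> cut_plane" unfolding Z_def using X[of n] by (intro kernel_argument_in_cut_plane x) auto
      from reg_hyp2f1_euler_integral[OF _ _ this, of "1/2" 1 "- N"]
      have eq: "of_real pi * reg_hyp2f1 (- N) (1/2) 1 Z = euler_integral (- N) (1/2) 1 Z"
        by (simp add: Gamma_one_half_complex flip: of_real_mult)
      show ?thesis unfolding Z_def[symmetric] eq[symmetric] by simp
    qed
    ultimately have "(\<lambda>n. reg_hyp2f1 (- N) (1/2) 1 (1 - of_real (1 - X n) * segment_ratio x (X n))) \<longlonglongrightarrow> Beta (1/2) (N + 1/2) / of_real pi"
      by (simp only:)
    moreover have "(\<lambda>n. segment_smooth N \<mu> x (X n)) \<longlonglongrightarrow> segment_smooth N \<mu> x 1"
      by (rule continuous_on_tendsto_compose[OF continuous_on_section[OF continuous_on_segment_smooth x order_refl] X1])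
         (use X in \<open>auto intro!: always_eventually less_imp_le\<close>)
    ultimately show "(H \<circ> X) \<longlonglongrightarrow> H0" unfolding H_def H0_def o_def by (intro tendsto_mult)
  qed
  moreover have "H0 \<noteq> 0"
  proof -
    have "segment_ratio x 1 \<notin> \<real>\<^sub>\<le>\<^sub>0" "segment_base x 1 \<notin> \<real>\<^sub>\<le>\<^sub>0"
      using segment_ratio_notin_nonpos_Reals[OF x, of 1] segment_base_notin_nonpos_Reals[OF x, of 1] by simp_all
    hence "segment_ratio x 1 \<noteq> 0" "segment_base x 1 \<noteq> 0" by auto
    moreover have "rGamma (1 + \<mu>) \<noteq> 0" using c by (simp add: rGamma_eq_zero_iff)
    ultimately have "segment_smooth N \<mu> x 1 \<noteq> 0"
      using ferrers_domain_facts(3)[OF x] by (simp add: segment_smooth_def reg_hyp2f1_0)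
    moreover have "Beta (1/2) (N + 1/2) \<noteq> 0"
      using Re_pos_notin_nonpos_Ints[of "1/2"] Re_pos_notin_nonpos_Ints[of "N + 1/2"] Re_pos_notin_nonpos_Ints[of "N + 1"] N
      by (auto simp: Beta_def Gamma_eq_zero_iff add_ac)
    ultimately show ?thesis by (simp add: H0_def)
  qed
  moreover have "Re ((\<mu> - N) / 2) \<le> 0" using \<mu> by simp
  ultimately have "\<not> (\<lambda>s. of_real (1 - s) powr ((\<mu> - N) / 2 - 1) * H s) integrable_on {0<..<1}"
    by (intro power_singularity_not_integrable)
  thus ?thesis unfolding segment_integrand_def H_def mult.assoc .
qed

subsection \<open>The integral equation\<close>

text \<open>At \<open>c = 0\<close> the constant term vanishes with \<open>rGamma 0\<close>, and
  shifting the index by 1 raises both upper parameters by 1 and the lower one to 2.\<close>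

lemma reg_hyp2f1_zero_c:
  assumes "z \<in> cut_plane"
  shows "reg_hyp2f1 a b 0 z = a * b * z * reg_hyp2f1 (a + 1) (b + 1) 2 z"
proof -
  have fps: "hyp_fps a b 0 = fps_const (a * b) * (fps_X * hyp_fps (a + 1) (b + 1) 2)"
  proof (rule fps_ext)
    fix n
    show "fps_nth (hyp_fps a b 0) n = fps_nth (fps_const (a * b) * (fps_X * hyp_fps (a + 1) (b + 1) 2)) n"
    proof (cases n)
      case (Suc m)
      have "rGamma (of_nat (Suc m)) = of_nat (Suc m) * rGamma (2 + of_nat m :: complex)"
        using rGamma_plus1[of "of_nat (Suc m) :: complex"] by (simp add: add_ac)
      thus ?thesis unfolding Suc
        by (simp add: hyp_fps_def hyp_coeff_def pochhammer_rec fact_Suc del: of_nat_Suc)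
    qed (simp add: hyp_fps_def hyp_coeff_def)
  qed
  have "a * b * z * reg_hyp2f1 (a + 1) (b + 1) 2 z = reg_hyp2f1 a b 0 z"
  proof (rule hyp_continuation_unique[OF _ assms])
    show "hyp_continuation a b 0 (\<lambda>z. a * b * z * reg_hyp2f1 (a + 1) (b + 1) 2 z)"
      unfolding hyp_continuation_def
    proof (intro conjI ballI holomorphic_intros reg_hyp2f1_holomorphic)
      fix z :: complex assume "z \<in> ball 0 1"
      hence z: "norm z < 1" by simp
      show "a * b * z * reg_hyp2f1 (a + 1) (b + 1) 2 z = reg_hyp2f1_series a b 0 z"
        unfolding eval_hyp_fps[OF z, symmetric] fps using z
        by (simp add: eval_hyp_simps eval_hyp_fps reg_hyp2f1_eq_series)
    qed
  qed
  thus ?thesis by simp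
qed

text \<open>The factor \<open>z\<close> left by the vanishing constant term and the factor
  \<open>1 / (1 - z)\<close> from Euler's transformation combine to
  \<open>(1 - x) / (1 + x)\<close>, which lowers the exponent of the prefactor from 1/2 to
  -1/2.\<close>

lemma ferrers_P_one:
  assumes x: "x \<in> ferrers_domain"
  shows "ferrers_P N 1 x = - N * (N + 1) * ferrers_P N (- 1) x"
proof -
  define z q where "z = (1 - x) / 2" and "q = (1 + x) / (1 - x)"
  note nz = ferrers_domain_facts(3,4)[OF x]
  have z: "z \<in> cut_plane" unfolding z_def by (rule ferrers_domain_facts(5)[OF x])
  have q: "q \<noteq> 0" using nz by (simp add: q_def)
  have z1: "1 - z = (1 + x) / 2" by (simp add: z_def field_simps)
  have "(2::complex) \<notin> \<int>\<^sub>\<le>\<^sub>0" by (rule Re_pos_notin_nonpos_Ints) simp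
  hence "reg_hyp2f1 (- N + 1) (N + 1 + 1) 2 z = (1 - z) powr (2 - (- N + 1) - (N + 1 + 1)) * reg_hyp2f1 (2 - (- N + 1)) (2 - (N + 1 + 1)) 2 z"
    by (rule euler_transformation[OF _ z])
  also have "2 - (- N + 1) - (N + 1 + 1) = (-1::complex)" by simp
  also have "(1 - z) powr (-1) = 1 / (1 - z)" using nz by (simp add: z1 powr_minus field_simps)
  also have "reg_hyp2f1 (2 - (- N + 1)) (2 - (N + 1 + 1)) 2 z = reg_hyp2f1 (- N) (N + 1) 2 z"
    by (subst reg_hyp2f1_commute) (simp add: add.commute)
  finally have "reg_hyp2f1 (- N) (N + 1) 0 z = - N * (N + 1) * (z / (1 - z)) * reg_hyp2f1 (- N) (N + 1) 2 z"
    unfolding reg_hyp2f1_zero_c[OF z] by simp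
  also have "z / (1 - z) = 1 / q"
  proof -
    have "u / 2 / (w / 2) = 1 / (w / u)" for u w :: complex by simp
    thus ?thesis unfolding z1 unfolding z_def q_def .
  qed
  finally have R: "reg_hyp2f1 (- N) (N + 1) 0 z = - N * (N + 1) * (1 / q) * reg_hyp2f1 (- N) (N + 1) 2 z" .
  have "q powr (1/2) = q * q powr (-1/2)" using q powr_add[of q 1 "-1/2"] by simp
  thus ?thesis unfolding ferrers_P_def z_def[symmetric] q_def[symmetric]
    using q by (simp add: R)
qed

section \<open>Invariance under the reflection of \<nu> to - 1 - \<nu>, and the constant
  factor\<close>

lemma ferrers_P_reflect: "ferrers_P (- 1 - \<nu>) \<mu> = ferrers_P \<nu> \<mu>"
proof -
  have "reg_hyp2f1 (- (- 1 - \<nu>)) (- 1 - \<nu> + 1) c = reg_hyp2f1 (- \<nu>) (\<nu> + 1) c" for c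
    by (subst reg_hyp2f1_commute) (simp add: add.commute)
  thus ?thesis by (simp add: ferrers_P_def fun_eq_iff)
qed

lemma legendre_P_reflect: "legendre_P (- 1 - \<nu>) = legendre_P \<nu>"
proof -
  have "reg_hyp2f1 (- (- 1 - \<nu>)) (- 1 - \<nu> + 1) 1 = reg_hyp2f1 (- \<nu>) (\<nu> + 1) 1"
    by (subst reg_hyp2f1_commute) (simp add: add.commute)
  thus ?thesis by (simp add: legendre_P_def fun_eq_iff)
qed

lemma ferrers_integrand_reflect: "ferrers_integrand (- 1 - \<nu>) \<mu> = ferrers_integrand \<nu> \<mu>"
  by (simp add: ferrers_integrand_def fun_eq_iff ferrers_P_reflect legendre_P_reflect)

definition ferrers_factor :: "complex \<Rightarrow> complex \<Rightarrow> complex" where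
  "ferrers_factor \<nu> \<mu> = (2 * (\<nu> - \<mu>) * Gamma ((\<mu> - \<nu> + 3) / 2) * Gamma ((\<nu> + \<mu> + 2) / 2)) /
              ((\<nu> - \<mu> - 1) * Gamma ((\<mu> - \<nu> + 2) / 2) * Gamma ((\<nu> + \<mu> + 1) / 2))"

lemma mellin_value_eq:
  "mellin_value N ((\<mu> - N) / 2) = Gamma ((\<mu> - N) / 2) * Gamma ((\<mu> + N + 1) / 2) /
     (Gamma ((\<mu> - N + 1) / 2) * Gamma ((\<mu> + N + 2) / 2))"
proof -
  have "(\<mu> - N) / 2 + N + 1/2 = (\<mu> + N + 1) / 2" "(\<mu> - N) / 2 + 1/2 = (\<mu> - N + 1) / 2" "(\<mu> - N) / 2 + N + 1 = (\<mu> + N + 2) / 2"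
    by (simp_all add: field_simps)
  thus ?thesis by (simp only: mellin_value_def)
qed

text \<open>The reflection merely exchanges the two Gamma functions in the numerator and the two in
  the denominator.\<close>

lemma mellin_value_reflect:
  "mellin_value (- 1 - \<nu>) ((\<mu> - (- 1 - \<nu>)) / 2) = mellin_value \<nu> ((\<mu> - \<nu>) / 2)"
proof -
  have e: "\<mu> - (- 1 - \<nu>) = \<mu> + \<nu> + 1" "\<mu> + (- 1 - \<nu>) + 1 = \<mu> - \<nu>" "\<mu> + \<nu> + 1 + 1 = \<mu> + \<nu> + 2" "\<mu> + (- 1 - \<nu>) + 2 = \<mu> - \<nu> + 1"
    by (simp_all add: algebra_simps)
  show ?thesis
    using mellin_value_eq[of "- 1 - \<nu>" \<mu>] mellin_value_eq[of \<nu> \<mu>] by (simp only: e mult_ac)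
qed

text \<open>The linear factors of the stated constant are absorbed by the functional equation of
  Gamma at \<open>(\<mu> - \<nu> + 1) / 2\<close> and \<open>(\<mu> - \<nu>) / 2\<close>.\<close>

lemma ferrers_factor_eq:
  assumes "Re (\<mu> - \<nu>) > 0"
  shows "ferrers_factor \<nu> \<mu> = 2 * Gamma ((\<mu> - \<nu> + 1) / 2) * Gamma ((\<mu> + \<nu> + 2) / 2) / (Gamma ((\<mu> - \<nu>) / 2) * Gamma ((\<mu> + \<nu> + 1) / 2))"
proof -
  define d where "d = \<mu> - \<nu>"
  have d: "Re d > 0" using assms by (simp add: d_def)
  have "d \<noteq> 0" "d + 1 \<noteq> 0" using d by (auto simp: complex_eq_iff)
  have g1: "Gamma ((d + 3) / 2) = (d + 1) / 2 * Gamma ((d + 1) / 2)"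
    using Gamma_plus1[of "(d + 1) / 2"] Re_pos_notin_nonpos_Ints[of "(d + 1) / 2"] d by (simp add: add_divide_distrib add_ac)
  have g2: "Gamma ((d + 2) / 2) = d / 2 * Gamma (d / 2)"
    using Gamma_plus1[of "d / 2"] Re_pos_notin_nonpos_Ints[of "d / 2"] d by (simp add: add_divide_distrib add_ac)
  have e: "\<nu> - \<mu> = - d" "- d - 1 = - (d + 1)" "\<nu> + \<mu> = \<mu> + \<nu>" by (simp_all add: d_def)
  have "2 * (- d) * (E / 2 * A) * B / (- E * (d / 2 * C) * D) = 2 * A * B / (C * D)" if "E \<noteq> 0" for A B C D E
    using \<open>d \<noteq> 0\<close> that by simp
  from this[OF \<open>d + 1 \<noteq> 0\<close>]
  show ?thesis unfolding ferrers_factor_def e d_def[symmetric] g1 g2 .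
qed

text \<open>Under these hypotheses all four Gamma arguments have positive real part, so no value is
  a pole or a default and the cancellation is legitimate.\<close>

lemma ferrers_factor_mellin_value:
  assumes "Re (\<mu> - \<nu>) > 0" "Re (\<mu> + \<nu>) > -1"
  shows "ferrers_factor \<nu> \<mu> * (mellin_value \<nu> ((\<mu> - \<nu>) / 2) / 2) = 1"
proof -
  have "Gamma ((\<mu> - \<nu> + 1) / 2) \<noteq> 0" "Gamma ((\<mu> + \<nu> + 2) / 2) \<noteq> 0" "Gamma ((\<mu> - \<nu>) / 2) \<noteq> 0" "Gamma ((\<mu> + \<nu> + 1) / 2) \<noteq> 0"
    unfolding Gamma_eq_zero_iff by (rule Re_pos_notin_nonpos_Ints, use assms in simp)+
  thus ?thesis unfolding ferrers_factor_eq[OF assms(1)] mellin_value_eq by (simp add: divide_simps)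
qed

text \<open>The factor is taken at \<open>\<mu> = -1\<close> but the Mellin value at
  \<open>\<mu> = 1\<close>, because the integral equation is transferred from there. The arguments
  \<open>\<nu> / 2\<close> and \<open>(\<nu> + 1) / 2\<close> have real parts strictly between -1
  and 0, so Gamma has no pole at them.\<close>

lemma ferrers_factor_minus_one:
  assumes "-2 < Re \<nu>" "Re \<nu> < -1"
  shows "ferrers_factor \<nu> (-1) * (mellin_value \<nu> ((1 - \<nu>) / 2) / 2) = 1"
proof -
  have "w \<notin> \<int>\<^sub>\<le>\<^sub>0" if "-1 < Re w" "Re w < 0" for w :: complex
  proof
    assume "w \<in> \<int>\<^sub>\<le>\<^sub>0"
    then obtain k where "w = of_int k" by (auto elim!: nonpos_Ints_cases)
    hence "real_of_int (-1) < real_of_int k" "real_of_int k < real_of_int 0" using that by simp_all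
    hence "-1 < k" "k < 0" by (simp_all only: of_int_less_iff)
    thus False by simp
  qed
  hence nonint: "\<nu> / 2 \<notin> \<int>\<^sub>\<le>\<^sub>0" "(\<nu> + 1) / 2 \<notin> \<int>\<^sub>\<le>\<^sub>0" using assms by simp_all
  have g: "Gamma ((1 + \<nu> + 1) / 2) = \<nu> / 2 * Gamma (\<nu> / 2)" "Gamma ((1 + \<nu> + 2) / 2) = (\<nu> + 1) / 2 * Gamma ((\<nu> + 1) / 2)"
    using Gamma_plus1[OF nonint(1)] Gamma_plus1[OF nonint(2)] by (simp_all add: add_divide_distrib add_ac)
  have "Re ((1 - \<nu>) / 2) > 0" "Re ((1 - \<nu> + 1) / 2) > 0" using assms by simp_all
  note pos = this[THEN Re_pos_notin_nonpos_Ints]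
  have nz: "Gamma ((1 - \<nu>) / 2) \<noteq> 0" "Gamma ((1 - \<nu> + 1) / 2) \<noteq> 0" "Gamma (\<nu> / 2) \<noteq> 0" "Gamma ((\<nu> + 1) / 2) \<noteq> 0"
    unfolding Gamma_eq_zero_iff by (fact pos nonint)+
  have "\<nu> \<noteq> 0" "\<nu> + 1 \<noteq> 0" using assms by (auto simp: complex_eq_iff)
  have "\<nu> * 2 + 2 = 2 * (\<nu> + 1)" by simp
  hence "\<nu> * 2 + 2 \<noteq> 0" using \<open>\<nu> + 1 \<noteq> 0\<close> by (metis mult_eq_0_iff zero_neq_numeral)
  have e: "\<nu> - -1 = \<nu> + 1" "\<nu> + 1 - 1 = \<nu>" "-1 - \<nu> + 3 = 1 - \<nu> + 1" "-1 - \<nu> + 2 = 1 - \<nu>" "\<nu> + -1 + 2 = \<nu> + 1" "\<nu> + -1 + 1 = \<nu>"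
    by simp_all
  show ?thesis unfolding ferrers_factor_def mellin_value_eq e g
    using nz \<open>\<nu> \<noteq> 0\<close> \<open>\<nu> + 1 \<noteq> 0\<close> \<open>\<nu> * 2 + 2 \<noteq> 0\<close> by (simp add: divide_simps)
qed

theorem theorem56:
  fixes \<nu> \<mu> x :: complex
  assumes "\<nu> \<noteq> 0" and "\<mu> \<noteq> 0"
    and "x \<in> ferrers_domain"
    and "Re (\<mu> + \<nu>) > -3" and "Re (\<mu> - \<nu>) > 0"
  shows "(Re (\<mu> + \<nu>) > -1 \<longrightarrow> ferrers_integrand \<nu> \<mu> x contour_integrable_on linepath x 1) \<and>
         (ferrers_integrand \<nu> \<mu> x contour_integrable_on linepath x 1 \<longrightarrow>
            ferrers_P \<nu> (- \<mu>) x =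
              (2 * (\<nu> - \<mu>) * Gamma ((\<mu> - \<nu> + 3) / 2) * Gamma ((\<nu> + \<mu> + 2) / 2)) /
              ((\<nu> - \<mu> - 1) * Gamma ((\<mu> - \<nu> + 2) / 2) * Gamma ((\<nu> + \<mu> + 1) / 2)) *
              contour_integral (linepath x 1) (ferrers_integrand \<nu> \<mu> x))"
proof -
  note x = assms(3)
  define N where "N = (if Re \<nu> \<ge> -1/2 then \<nu> else - 1 - \<nu>)"
  have N: "Re N \<ge> -1/2" by (auto simp: N_def)
  have refl: "ferrers_integrand N = ferrers_integrand \<nu>" "ferrers_P N = ferrers_P \<nu>"
    "mellin_value N ((m - N) / 2) = mellin_value \<nu> ((m - \<nu>) / 2)" for m
    by (simp_all add: N_def fun_eq_iff ferrers_integrand_reflect ferrers_P_reflect mellin_value_reflect del: diff_minus_eq_add)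
  \<comment> \<open>Stated for every \<open>m\<close>, because the case \<open>\<mu> = -1\<close>
    uses it with \<open>m = 1\<close>.\<close>
  have solves: "(ferrers_integrand \<nu> m x has_contour_integral ferrers_P \<nu> (- m) x * (mellin_value \<nu> ((m - \<nu>) / 2) / 2)) (linepath x 1)"
    if "Re (m - N) > 0" for m
    using ferrers_integral_equation[OF x N that] unfolding refl .
  consider (main) "Re (\<mu> - N) > 0" | (one) "Re (\<mu> - N) \<le> 0" "\<mu> = -1" | (diverge) "Re (\<mu> - N) \<le> 0" "\<mu> \<noteq> -1"
    by linarith
  hence "(Re (\<mu> + \<nu>) > -1 \<longrightarrow> ferrers_integrand \<nu> \<mu> x contour_integrable_on linepath x 1) \<and>
         (ferrers_integrand \<nu> \<mu> x contour_integrable_on linepath x 1 \<longrightarrow>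
            ferrers_P \<nu> (- \<mu>) x = ferrers_factor \<nu> \<mu> * contour_integral (linepath x 1) (ferrers_integrand \<nu> \<mu> x))"
  proof cases
    case main
    \<comment> \<open>If \<open>N = \<nu>\<close>, then
      \<open>Re \<mu> > Re \<nu> \<ge> -1/2\<close>; otherwise \<open>\<mu> - N\<close> is
      \<open>\<mu> + \<nu> + 1\<close>.\<close>
    have "Re (\<mu> + \<nu>) > -1" using main assms(5) by (auto simp: N_def split: if_splits)
    from ferrers_factor_mellin_value[OF assms(5) this] contour_integral_unique[OF solves[OF main]]
    have "ferrers_P \<nu> (- \<mu>) x = ferrers_factor \<nu> \<mu> * contour_integral (linepath x 1) (ferrers_integrand \<nu> \<mu> x)"
      by (metis mult.left_commute mult.right_neutral)
    thus ?thesis using has_contour_integral_integrable[OF solves[OF main]] by blast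
  next
    case one
    have \<nu>: "-2 < Re \<nu>" "Re \<nu> < -1" using assms(4,5) one(2) by auto
    \<comment> \<open>Here \<open>N = - 1 - \<nu>\<close>, so the real part is
      \<open>2 + Re \<nu>\<close>.\<close>
    have "Re (1 - N) > 0" using \<nu> by (simp add: N_def)
    have integrand: "ferrers_integrand \<nu> (-1) x t = - \<nu> * (\<nu> + 1) * ferrers_integrand \<nu> 1 x t" if "t \<in> ferrers_domain" for t
      using ferrers_P_one[OF that, of \<nu>] by (simp add: ferrers_integrand_def)
    define L where "L = mellin_value \<nu> ((1 - \<nu>) / 2) / 2"
    have "((\<lambda>s. ferrers_integrand \<nu> 1 x (linepath x 1 s) * (1 - x)) has_integral ferrers_P \<nu> (- 1) x * L) {0<..<1}"
      using solves[OF \<open>Re (1 - N) > 0\<close>] unfolding has_contour_integral_linepath has_integral_Icc_iff_Ioo L_def .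
    hence "((\<lambda>s. - \<nu> * (\<nu> + 1) * (ferrers_integrand \<nu> 1 x (linepath x 1 s) * (1 - x))) has_integral - \<nu> * (\<nu> + 1) * (ferrers_P \<nu> (- 1) x * L)) {0<..<1}"
      by (rule has_integral_mult_right)
    \<comment> \<open>The two integrands are proportional in the Ferrers domain only, which the path
      leaves at its endpoint 1; hence the open interval.\<close>
    hence "((\<lambda>s. ferrers_integrand \<nu> (-1) x (linepath x 1 s) * (1 - x)) has_integral - \<nu> * (\<nu> + 1) * (ferrers_P \<nu> (- 1) x * L)) {0<..<1}"
      by (rule has_integral_eq[rotated]) (simp add: integrand linepath_in_ferrers_domain[OF x])
    hence "(ferrers_integrand \<nu> (-1) x has_contour_integral - \<nu> * (\<nu> + 1) * (ferrers_P \<nu> (- 1) x * L)) (linepath x 1)"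
      unfolding has_contour_integral_linepath has_integral_Icc_iff_Ioo .
    hence "contour_integral (linepath x 1) (ferrers_integrand \<nu> \<mu> x) = ferrers_P \<nu> (- \<mu>) x * L"
      unfolding one(2) minus_minus ferrers_P_one[OF x] by (simp add: contour_integral_unique mult_ac)
    moreover have "ferrers_factor \<nu> \<mu> * L = 1"
      using ferrers_factor_minus_one[OF \<nu>] unfolding one(2) L_def .
    ultimately have "ferrers_P \<nu> (- \<mu>) x = ferrers_factor \<nu> \<mu> * contour_integral (linepath x 1) (ferrers_integrand \<nu> \<mu> x)"
      by (metis mult.left_commute mult.right_neutral)
    moreover have "\<not> Re (\<mu> + \<nu>) > -1" using \<nu> one(2) by simp
    ultimately show ?thesis by blast
  next
    case diverge
    have \<nu>: "Re \<nu> < -1/2" "N = - 1 - \<nu>" using diverge(1) assms(5) by (auto simp: N_def split: if_splits)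
    \<comment> \<open>Adding the two hypotheses on real parts gives \<open>Re \<mu> > -3/2\<close>,
      so the only nonpositive integer that \<open>1 + \<mu>\<close> could be is 0, and that is the
      previous case.\<close>
    have "1 + \<mu> \<notin> \<int>\<^sub>\<le>\<^sub>0"
    proof
      assume "1 + \<mu> \<in> \<int>\<^sub>\<le>\<^sub>0"
      then obtain k where k: "1 + \<mu> = of_int k" "k \<le> 0" by (auto elim!: nonpos_Ints_cases)
      hence R: "1 + Re \<mu> = of_int k" by (metis Re_complex_of_real complex_Re_of_int one_complex.sel(1) plus_complex.sel(1))
      hence "real_of_int k > -1/2" using assms(4,5) by simp
      hence "k = 0" using k(2) by linarith
      thus False using k(1) diverge(2) by (simp add: add_eq_0_iff)
    qed
    moreover have "Re N > -1/2" using \<nu> by simp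
    ultimately have "\<not> segment_integrand N \<mu> x integrable_on {0<..<1}"
      using diverge(1) by (intro segment_integrand_not_integrable x)
    hence "\<not> ferrers_integrand N \<mu> x contour_integrable_on linepath x 1"
      using ferrers_contour_integral_iff[OF x] unfolding contour_integrable_on_def integrable_on_def by blast
    \<comment> \<open>With the integral divergent and this inequality, both implications of the
      claim hold vacuously.\<close>
    moreover have "\<not> Re (\<mu> + \<nu>) > -1" using diverge(1) \<nu>(2) by simp
    ultimately show ?thesis unfolding refl by blast
  qed
  thus ?thesis unfolding ferrers_factor_def .
qed

end
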